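(* Let $\mathbb{K}$ be a field, $n\ge 1$, and let $q\in\mathbb{K}^*$ not be a root of unity. If $M$ is a nonzero finitely generated (right) module over the quantum Heisenberg space $F_q(n)$ that is not a $\mathscr{Z}$-torsion module, then $$\operatorname{GK-dim}(M)\ \ge\ n-1=\frac{\operatorname{GK-dim}(F_q(n))}{2}-1.$$
   Context: Definition of $K_n$: let $P=(p_1,\ldots,p_n)$ and $Q=(q_1,\ldots,q_n)$ be $n$-tuples of elements of $\mathbb{K}^*$ with $p_i\ne q_i$ for all $i$, and let $\Gamma=(\gamma_{ij})$ be a multiplicatively antisymmetric $n\times n$ matrix over $\mathbb{K}$ (that is, $\gamma_{ii}=1$ and $\gamma_{ij}\gamma_{ji}=1$ for all $i,j$). The algebra $K_n=K_{n,\Gamma}^{P,Q}(\mathbb{K})$ is the $\mathbb{K}$-algebra generated by $x_1,y_1,\ldots,x_n,y_n$ subject to the relations $x_ix_j=q_ip_j^{-1}\gamma_{ij}x_jx_i$ for $i<j$; $y_iy_j=\gamma_{ij}y_jy_i$ for $i<j$; $x_iy_j=p_j\gamma_{ij}^{-1}y_jx_i$ for $i<j$; $x_iy_j=q_j\gamma_{ij}^{-1}y_jx_i$ for $i>j$; $x_iy_i-q_iy_ix_i=\sum_{l=1}^{i-1}(q_l-p_l)y_lx_l$ for all $i$. The quantum Heisenberg space $F_q(n)$ is the algebra $K_{n,\Gamma}^{P,Q}(\mathbb{K})$ with $p_i=q^{2}$, $q_i=1$ for all $i$ and $\gamma_{ij}=q$ for all $i<j$. The elements $z_i:=\sum_{l\le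 i}(q_l-p_l)y_lx_l$ ($1\le i\le n$) are normal in $K_n$ and commute with each other, and $\mathscr{Z}:=\{z_1^{j_1}\cdots z_n^{j_n}: j_i\in\mathbb{Z}_{\ge 0}\}$ is an Ore set. A module $M$ is $\mathscr{Z}$-torsion if every $m\in M$ satisfies $ms=0$ for some $s\in\mathscr{Z}$. $\operatorname{GK-dim}$ denotes Gelfand--Kirillov dimension over $\mathbb{K}$. *)

theory Defs
  imports
    Complex_Main
    "HOL-Library.Poly_Mapping"
    "HOL-Library.Extended_Real"
    "HOL-Library.Liminf_Limsup"
    "HOL-Algebra.QuotRing"
    "Jordan_Normal_Form.VS_Connect"
begin

section \<open>Free associative algebras and presented algebras\<close>

text \<open>
  The words over an alphabet form a monoid, written additively so that the convolution product
  of \<^theory>\<open>HOL-Library.Poly_Mapping\<close> makes the finitely supported functions on words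
  into the (noncommutative) free algebra.
\<close>

datatype 'a free_word = Free_Word (letters: "'a list")

instantiation free_word :: (type) monoid_add
begin

definition zero_free_word :: "'a free_word"
  where "0 = Free_Word []"

definition plus_free_word :: "'a free_word \<Rightarrow> 'a free_word \<Rightarrow> 'a free_word"
  where "u + v = Free_Word (letters u @ letters v)"

instance
  by standard (simp_all add: zero_free_word_def plus_free_word_def)

end

type_synonym ('g, 'k) free_alg = "'g free_word \<Rightarrow>\<^sub>0 'k"

definition var :: "'g \<Rightarrow> ('g, 'k::field) free_alg"
  where "var g = Poly_Mapping.single (Free_Word [g]) 1"

definition scale :: "'k::field \<Rightarrow> ('g, 'k) free_alg \<Rightarrow> ('g, 'k) free_alg"
  where "scale c f = Poly_Mapping.map ((*) c) f"

text \<open>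
  Algebras over a field are represented by the record \<^typ>\<open>('k, 'a) module\<close>, which has
  both a ring multiplication and a scalar multiplication.
\<close>

definition free_algebra :: "'g set \<Rightarrow> ('k::field, ('g, 'k) free_alg) module"
  where "free_algebra G =
    \<lparr>carrier = {f. \<forall>w \<in> Poly_Mapping.keys f. set (letters w) \<subseteq> G},
     mult = (*), one = 1, zero = 0, add = (+), smult = scale\<rparr>"

definition quotient_algebra :: "('k, 'a) module \<Rightarrow> 'a set \<Rightarrow> ('k, 'a set) module"
  where "quotient_algebra A I =
    \<lparr>carrier = carrier (A Quot I), mult = mult (A Quot I), one = one (A Quot I),
     zero = zero (A Quot I), add = add (A Quot I),
     smult = (\<lambda>c X. \<Union>x\<in>X. I +>\<^bsub>A\<^esub> (c \<odot>\<^bsub>A\<^esub> x))\<rparr>"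

section \<open>The algebras $K_n$ and quantum Heisenberg space\<close>

datatype gen = X nat | Y nat

abbreviation gens :: "nat \<Rightarrow> gen set"
  where "gens n \<equiv> X ` {1..n} \<union> Y ` {1..n}"

text \<open>
  The parameters matter only at indices between 1 and \<open>n\<close>; a relation
  \<open>lhs = rhs\<close> is encoded as the element \<open>lhs - rhs\<close>.
\<close>

definition Kn_relations ::
    "nat \<Rightarrow> (nat \<Rightarrow> 'k) \<Rightarrow> (nat \<Rightarrow> 'k) \<Rightarrow> (nat \<Rightarrow> nat \<Rightarrow> 'k::field) \<Rightarrow> (gen, 'k) free_alg set"
  where "Kn_relations n p q \<gamma> =
    (let x = (\<lambda>i. var (X i)); y = (\<lambda>i. var (Y i)) in
      {x i * x j - scale (q i * inverse (p j) * \<gamma> i j) (x j * x i) |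
         i j. 1 \<le> i \<and> i < j \<and> j \<le> n}
    \<union> {y i * y j - scale (\<gamma> i j) (y j * y i) |
         i j. 1 \<le> i \<and> i < j \<and> j \<le> n}
    \<union> {x i * y j - scale (p j * inverse (\<gamma> i j)) (y j * x i) |
         i j. 1 \<le> i \<and> i < j \<and> j \<le> n}
    \<union> {x i * y j - scale (q j * inverse (\<gamma> i j)) (y j * x i) |
         i j. 1 \<le> j \<and> j < i \<and> i \<le> n}
    \<union> {x i * y i - scale (q i) (y i * x i) - (\<Sum>l = 1..<i. scale (q l - p l) (y l * x l)) |
         i. 1 \<le> i \<and> i \<le> n})"

definition Kn_ideal ::
    "nat \<Rightarrow> (nat \<Rightarrow> 'k) \<Rightarrow> (nat \<Rightarrow> 'k) \<Rightarrow> (nat \<Rightarrow> nat \<Rightarrow> 'k::field) \<Rightarrow> (gen, 'k) free_alg set"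
  where "Kn_ideal n p q \<gamma> = Idl\<^bsub>free_algebra (gens n)\<^esub> (Kn_relations n p q \<gamma>)"

definition Kn ::
    "nat \<Rightarrow> (nat \<Rightarrow> 'k) \<Rightarrow> (nat \<Rightarrow> 'k) \<Rightarrow> (nat \<Rightarrow> nat \<Rightarrow> 'k::field) \<Rightarrow> ('k, (gen, 'k) free_alg set) module"
  where "Kn n p q \<gamma> = quotient_algebra (free_algebra (gens n)) (Kn_ideal n p q \<gamma>)"

definition Kn_gen ::
    "nat \<Rightarrow> (nat \<Rightarrow> 'k) \<Rightarrow> (nat \<Rightarrow> 'k) \<Rightarrow> (nat \<Rightarrow> nat \<Rightarrow> 'k::field) \<Rightarrow> gen \<Rightarrow> (gen, 'k) free_alg set"
  where "Kn_gen n p q \<gamma> g = Kn_ideal n p q \<gamma> +>\<^bsub>free_algebra (gens n)\<^esub> var g"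

definition Kn_z ::
    "nat \<Rightarrow> (nat \<Rightarrow> 'k) \<Rightarrow> (nat \<Rightarrow> 'k) \<Rightarrow> (nat \<Rightarrow> nat \<Rightarrow> 'k::field) \<Rightarrow> nat \<Rightarrow> (gen, 'k) free_alg set"
  where "Kn_z n p q \<gamma> i =
    (\<Oplus>\<^bsub>Kn n p q \<gamma>\<^esub> l \<in> {1..i}. (q l - p l) \<odot>\<^bsub>Kn n p q \<gamma>\<^esub>
       (Kn_gen n p q \<gamma> (Y l) \<otimes>\<^bsub>Kn n p q \<gamma>\<^esub> Kn_gen n p q \<gamma> (X l)))"

text \<open>The product is folded in the order \<open>z\<^sub>1, \<dots>, z\<^sub>n\<close>, since the ring is not commutative.\<close>

definition Kn_Z ::
    "nat \<Rightarrow> (nat \<Rightarrow> 'k) \<Rightarrow> (nat \<Rightarrow> 'k) \<Rightarrow> (nat \<Rightarrow> nat \<Rightarrow> 'k::field) \<Rightarrow> (gen, 'k) free_alg set set"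
  where "Kn_Z n p q \<gamma> =
    {foldr (\<lambda>i a. (Kn_z n p q \<gamma> i [^]\<^bsub>Kn n p q \<gamma>\<^esub> e i) \<otimes>\<^bsub>Kn n p q \<gamma>\<^esub> a)
       [1..<Suc n] \<one>\<^bsub>Kn n p q \<gamma>\<^esub> | e :: nat \<Rightarrow> nat. True}"

text \<open>Below the diagonal and on it, \<open>\<gamma>\<close> is determined by multiplicative antisymmetry.\<close>

definition heisenberg_gamma :: "'k::field \<Rightarrow> nat \<Rightarrow> nat \<Rightarrow> 'k"
  where "heisenberg_gamma q i j = (if i < j then q else if i = j then 1 else inverse q)"

definition quantum_heisenberg :: "nat \<Rightarrow> 'k::field \<Rightarrow> ('k, (gen, 'k) free_alg set) module"
  where "quantum_heisenberg n q = Kn n (\<lambda>_. q\<^sup>2) (\<lambda>_. 1) (heisenberg_gamma q)"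

definition heisenberg_Z :: "nat \<Rightarrow> 'k::field \<Rightarrow> (gen, 'k) free_alg set set"
  where "heisenberg_Z n q = Kn_Z n (\<lambda>_. q\<^sup>2) (\<lambda>_. 1) (heisenberg_gamma q)"

section \<open>Right modules\<close>

text \<open>
  The library's modules are over commutative rings. As there, the multiplicative fields of the
  underlying ring record of a module play no role.
\<close>

record ('a, 'm) right_module = "'m ring" +
  ract :: "['m, 'a] \<Rightarrow> 'm" (infixl \<open>\<triangleleft>\<index>\<close> 70)

locale right_module = A?: ring A + M?: abelian_group M
  for A :: "('a, 'b) ring_scheme" (structure) and M :: "('a, 'm, 'c) right_module_scheme" (structure) +
  assumes ract_closed:
      "\<lbrakk>m \<in> carrier M; a \<in> carrier A\<rbrakk> \<Longrightarrow> m \<triangleleft>\<^bsub>M\<^esub> a \<in> carrier M"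
    and ract_add_left:
      "\<lbrakk>m \<in> carrier M; m' \<in> carrier M; a \<in> carrier A\<rbrakk>
        \<Longrightarrow> (m \<oplus>\<^bsub>M\<^esub> m') \<triangleleft>\<^bsub>M\<^esub> a = m \<triangleleft>\<^bsub>M\<^esub> a \<oplus>\<^bsub>M\<^esub> m' \<triangleleft>\<^bsub>M\<^esub> a"
    and ract_add_right:
      "\<lbrakk>m \<in> carrier M; a \<in> carrier A; b \<in> carrier A\<rbrakk>
        \<Longrightarrow> m \<triangleleft>\<^bsub>M\<^esub> (a \<oplus>\<^bsub>A\<^esub> b) = m \<triangleleft>\<^bsub>M\<^esub> a \<oplus>\<^bsub>M\<^esub> m \<triangleleft>\<^bsub>M\<^esub> b"
    and ract_mult:
      "\<lbrakk>m \<in> carrier M; a \<in> carrier A; b \<in> carrier A\<rbrakk>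
        \<Longrightarrow> m \<triangleleft>\<^bsub>M\<^esub> (a \<otimes>\<^bsub>A\<^esub> b) = (m \<triangleleft>\<^bsub>M\<^esub> a) \<triangleleft>\<^bsub>M\<^esub> b"
    and ract_one:
      "m \<in> carrier M \<Longrightarrow> m \<triangleleft>\<^bsub>M\<^esub> \<one>\<^bsub>A\<^esub> = m"

definition fin_gen_right_module ::
    "('a, 'b) ring_scheme \<Rightarrow> ('a, 'm, 'c) right_module_scheme \<Rightarrow> bool"
  where "fin_gen_right_module A M \<longleftrightarrow>
    (\<exists>F. finite F \<and> F \<subseteq> carrier M \<and>
      (\<forall>m \<in> carrier M. \<exists>a \<in> F \<rightarrow> carrier A. m = (\<Oplus>\<^bsub>M\<^esub> f \<in> F. f \<triangleleft>\<^bsub>M\<^esub> a f)))"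

definition torsion_right_module :: "'a set \<Rightarrow> ('a, 'm, 'c) right_module_scheme \<Rightarrow> bool"
  where "torsion_right_module S M \<longleftrightarrow>
    (\<forall>m \<in> carrier M. \<exists>s \<in> S. m \<triangleleft>\<^bsub>M\<^esub> s = \<zero>\<^bsub>M\<^esub>)"

text \<open>The vector space underlying a right module over an algebra \<open>A\<close>.\<close>

definition underlying_space ::
    "('k, 'a) module \<Rightarrow> ('a, 'm) right_module \<Rightarrow> ('k, 'm) module"
  where "underlying_space A M =
    \<lparr>carrier = carrier M, mult = mult M, one = one M, zero = zero M, add = add M,
     smult = (\<lambda>c m. m \<triangleleft>\<^bsub>M\<^esub> (c \<odot>\<^bsub>A\<^esub> \<one>\<^bsub>A\<^esub>))\<rparr>"

section \<open>Gelfand--Kirillov dimension\<close>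

definition fin_dim_subspaces :: "'k ring \<Rightarrow> ('k, 'v) module \<Rightarrow> 'v set set"
  where "fin_dim_subspaces K V =
    {W. VectorSpace.subspace K W V \<and> vectorspace.fin_dim K (V\<lparr>carrier := W\<rparr>)}"

text \<open>\<open>\<Sum>\<^sub>i\<^sub>\<le>\<^sub>m V\<^sup>i\<close>, with \<open>V\<^sup>0\<close> the span of the unit (the empty product).\<close>

definition power_sum :: "'k ring \<Rightarrow> ('k, 'a) module \<Rightarrow> 'a set \<Rightarrow> nat \<Rightarrow> 'a set"
  where "power_sum K A V m =
    LinearCombinations.module.span K A
      {foldr (mult A) vs \<one>\<^bsub>A\<^esub> | vs. set vs \<subseteq> V \<and> length vs \<le> m}"

text \<open>
  \<open>limsup log\<^sub>m d(m)\<close>, where the logarithm of 0 is \<open>-\<infinity>\<close>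
  (whereas \<^term>\<open>log b 0 = 0\<close> in HOL).
\<close>

definition growth_exponent :: "(nat \<Rightarrow> nat) \<Rightarrow> ereal"
  where "growth_exponent d =
    limsup (\<lambda>m. if d m = 0 then -\<infinity> else ereal (log (real m) (real (d m))))"

definition GK_dim :: "'k ring \<Rightarrow> ('k, 'a) module \<Rightarrow> ereal"
  where "GK_dim K A =
    (SUP V \<in> fin_dim_subspaces K A.
       growth_exponent (\<lambda>m. vectorspace.dim K (A\<lparr>carrier := power_sum K A V m\<rparr>)))"

definition GK_dim_module ::
    "'k ring \<Rightarrow> ('k, 'a) module \<Rightarrow> ('a, 'm) right_module \<Rightarrow> ereal"
  where "GK_dim_module K A M =
    (let N = underlying_space A M in
      SUP (V, F) \<in> fin_dim_subspaces K A \<times> fin_dim_subspaces K N.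
        growth_exponent (\<lambda>m. vectorspace.dim K
          (N\<lparr>carrier := LinearCombinations.module.span K N
                {f \<triangleleft>\<^bsub>M\<^esub> a | f a. f \<in> F \<and> a \<in> power_sum K A V m}\<rparr>)))"

end

theory Submission
  imports Defs
begin

text \<open>
  \<^emph>\<open>Module bound.\<close> Let \<open>m\<close> be a vector that no product of the \<open>z\<^sub>i\<close> kills. The
  products \<open>x\<^sub>j y\<^sub>j\<close> and \<open>y\<^sub>j x\<^sub>j\<close> are combinations of \<open>z\<^sub>j\<close> and \<open>z\<^sub>j\<^sub>-\<^sub>1\<close>, and as \<open>q\<close> is not a root of unity one
  can move \<open>m\<close> and choose for each \<open>j \<ge> 2\<close> one of \<open>x\<^sub>j\<close>, \<open>y\<^sub>j\<close>, say \<open>u\<^sub>j\<close>, such that no word in the \<open>z\<^sub>i\<close>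
  and \<open>u\<^sub>j\<close> kills \<open>m\<close>. The \<open>2 (n - 1)\<close> elements \<open>z\<^sub>1, \<dots>, z\<^sub>n\<^sub>-\<^sub>1, u\<^sub>2, \<dots>, u\<^sub>n\<close> commute up to powers of \<open>q\<close>
  given by a nondegenerate form, so they generate a copy of a simple quantum torus, and Joseph's
  proof of Bernstein's inequality applies: commutators with the generators isolate any single
  monomial, hence the monomials with exponents at most \<open>d\<close> are linearly independent as maps between
  spaces of words of length \<open>O(d)\<close> applied to \<open>m\<close>. Therefore \<open>(d + 1)\<^bsup>2 (n - 1)\<^esup>\<close> is at most the square of
  the dimension of such a space.

  \<^emph>\<open>Dimension of the algebra.\<close> Monomials in the \<open>z\<^sub>i\<close> and in one of \<open>x\<^sub>j\<close>, \<open>y\<^sub>j\<close> for each \<open>j\<close> span, which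
  bounds the growth from above by \<open>2 n\<close>. From below, the algebra acts through a quantum torus in
  which the \<open>z\<^sub>i\<close> and \<open>x\<^sub>j\<close> become independent monomials.
\<close>

section \<open>Free algebras\<close>

text \<open>The count stops at \<open>n - 1\<close> pairs because \<open>z\<^sub>n\<close> commutes
  with every \<open>x\<^sub>j\<close> and \<open>y\<^sub>j\<close>; a nondegenerate form cannot
  contain it. Of the remaining \<open>2 n - 1\<close> elements one more must go, since an
  alternating form of odd size is degenerate, and \<open>u\<^sub>1\<close> commutes with all
  \<open>z\<^sub>i\<close>. Without it, \<open>z\<^sub>i\<close> is matched with
  \<open>u\<^sub>i\<^sub>+\<^sub>1\<close>. On the module side everything stays in the free algebra:
  the annihilator of one vector is a right ideal \<open>J\<close>, and the invertibility available
  in a torus is replaced by the fact that no word of the family lies in \<open>J\<close>. A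
  commutator therefore leaves a trailing generator that cannot be cancelled, but the result is still
  a multiple of a word, and words are harmless. A choice between \<open>x\<^sub>j\<close> and
  \<open>y\<^sub>j\<close> is unavoidable because either may act nilpotently on a vector. They
  cannot both do so: \<open>x\<^sub>j y\<^sub>j\<close> and \<open>y\<^sub>j x\<^sub>j\<close>
  contain \<open>z\<^sub>j\<^sub>-\<^sub>1\<close> with coefficients of ratio
  \<open>q\<^sup>2\<close>, and no power of \<open>z\<^sub>j\<^sub>-\<^sub>1\<close> kills the
  vector. For the algebra itself, two families of growth \<open>2 n\<close> are compared: one spans,
  a smaller one is independent.\<close>

lemma scale_eq: "scale c f = Poly_Mapping.single 0 c * f"
  by (simp add: scale_def mult_map_scale_conv_mult)

lemma poly_mapping_eq_sum_single:
  "f = (\<Sum>w\<in>Poly_Mapping.keys f. Poly_Mapping.single w (Poly_Mapping.lookup f w))"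
  by (rule poly_mapping_eqI) (auto simp: lookup_sum lookup_single when_def in_keys_iff sum.delta)

lemma single_0_commute:
  fixes f :: "('g, 'k::field) free_alg"
  shows "Poly_Mapping.single 0 c * f = f * Poly_Mapping.single 0 c"
proof -
  have "Poly_Mapping.single 0 c * (\<Sum>w\<in>A. Poly_Mapping.single w (g w)) =
      (\<Sum>w\<in>A. Poly_Mapping.single w (g w)) * Poly_Mapping.single 0 c"
    for A :: "'g free_word set" and g
    by (simp add: sum_distrib_left sum_distrib_right mult_single mult.commute)
  then show ?thesis
    by (metis poly_mapping_eq_sum_single)
qed

lemma scale_mult_left: "scale c (f * g) = scale c f * g"
  by (simp add: scale_eq mult.assoc)

lemma scale_mult_right: "scale c (f * g) = f * scale c g"
  by (simp add: scale_eq mult.assoc[symmetric] single_0_commute[of c f])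

interpretation free_alg: vector_space "scale :: 'k::field \<Rightarrow> ('g, 'k) free_alg \<Rightarrow> ('g, 'k) free_alg"
  by unfold_locales (simp_all add: scale_eq distrib_left distrib_right single_add
      mult.assoc[symmetric] mult_single)

definition proj_alg :: "'g set \<Rightarrow> ('g, 'k::field) free_alg \<Rightarrow> ('g, 'k) free_alg"
  where "proj_alg G f = Poly_Mapping.mapp (\<lambda>w c. c when set (letters w) \<subseteq> G) f"

lemma lookup_proj_alg:
  "Poly_Mapping.lookup (proj_alg G f) w = (Poly_Mapping.lookup f w when set (letters w) \<subseteq> G)"
  by (auto simp: proj_alg_def lookup_mapp when_def in_keys_iff)

lemma proj_alg_add: "proj_alg G (f + g) = proj_alg G f + proj_alg G g"
  by (rule poly_mapping_eqI) (auto simp: lookup_proj_alg lookup_add when_def)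

lemma proj_alg_zero [simp]: "proj_alg G 0 = 0"
  by (rule poly_mapping_eqI) (auto simp: lookup_proj_alg)

lemma proj_alg_minus: "proj_alg G (f - g) = proj_alg G f - proj_alg G g"
  by (rule poly_mapping_eqI) (auto simp: lookup_proj_alg lookup_minus when_def)

lemma proj_alg_sum: "proj_alg G (sum f A) = (\<Sum>a\<in>A. proj_alg G (f a))"
  by (induction A rule: infinite_finite_induct) (auto simp: proj_alg_add)

lemma proj_alg_single:
  "proj_alg G (Poly_Mapping.single w c) = (Poly_Mapping.single w c when set (letters w) \<subseteq> G)"
  by (rule poly_mapping_eqI) (auto simp: lookup_proj_alg lookup_single when_def)

lemma letters_zero [simp]: "letters 0 = []"
  and letters_plus [simp]: "letters (u + v) = letters u @ letters v"
  by (simp_all add: zero_free_word_def plus_free_word_def)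

text \<open>A concatenation has all letters in \<open>G\<close> exactly when both parts do, so
  discarding the other words is an algebra endomorphism, the one that sends letters outside
  \<open>G\<close> to 0.\<close>

lemma proj_alg_mult:
  fixes f g :: "('g, 'k::field) free_alg"
  shows "proj_alg G (f * g) = proj_alg G f * proj_alg G g"
proof -
  let ?f = "\<Sum>v\<in>Poly_Mapping.keys f. Poly_Mapping.single v (Poly_Mapping.lookup f v)"
  let ?g = "\<Sum>v\<in>Poly_Mapping.keys g. Poly_Mapping.single v (Poly_Mapping.lookup g v)"
  have "proj_alg G (?f * ?g) = proj_alg G ?f * proj_alg G ?g"
    by (auto simp: sum_product mult_single proj_alg_sum proj_alg_single when_def intro!: sum.cong)
  then show ?thesis
    by (simp flip: poly_mapping_eq_sum_single)
qed

lemma proj_alg_one [simp]: "proj_alg G 1 = 1"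
  by (simp flip: single_one add: proj_alg_single)

lemma proj_alg_scale: "proj_alg G (scale c f) = scale c (proj_alg G f)"
  by (simp add: scale_eq proj_alg_mult proj_alg_single)

lemma proj_alg_var: "proj_alg G (var g) = (if g \<in> G then var g else 0)"
  by (simp add: var_def proj_alg_single)

lemma carrier_free_algebra: "f \<in> carrier (free_algebra G) \<longleftrightarrow> proj_alg G f = f"
proof -
  have "proj_alg G f = f \<longleftrightarrow> (\<forall>w. Poly_Mapping.lookup (proj_alg G f) w = Poly_Mapping.lookup f w)"
    by (auto intro: poly_mapping_eqI)
  also have "\<dots> \<longleftrightarrow> f \<in> carrier (free_algebra G)"
    by (auto simp: lookup_proj_alg free_algebra_def in_keys_iff when_def)
  finally show ?thesis
    by simp
qed

lemma proj_alg_idem [simp]: "proj_alg G (proj_alg G f) = proj_alg G f"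
  by (rule poly_mapping_eqI) (auto simp: lookup_proj_alg when_def)

lemma proj_alg_in_carrier [simp]: "proj_alg G f \<in> carrier (free_algebra G)"
  by (simp add: carrier_free_algebra)

lemma free_algebra_simps [simp]:
  "mult (free_algebra G) = (*)" "one (free_algebra G) = 1" "zero (free_algebra G) = 0"
  "add (free_algebra G) = (+)" "module.smult (free_algebra G) = scale"
  by (simp_all add: free_algebra_def)

lemma ring_free_algebra: "ring (free_algebra G :: ('k::field, ('g, 'k) free_alg) module)"
proof (rule ringI)
  let ?A = "free_algebra G :: ('k, ('g, 'k) free_alg) module"
  show "abelian_group ?A"
  proof (rule abelian_groupI)
    show "\<exists>y\<in>carrier ?A. y \<oplus>\<^bsub>?A\<^esub> x = \<zero>\<^bsub>?A\<^esub>" if "x \<in> carrier ?A" for x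
      using that proj_alg_minus[of G 0 x] by (intro bexI[of _ "- x"]) (auto simp: carrier_free_algebra)
  qed (auto simp: carrier_free_algebra proj_alg_add algebra_simps)
  show "Group.monoid ?A"
    by (rule monoidI) (auto simp: carrier_free_algebra proj_alg_mult mult.assoc)
qed (auto simp: distrib_left distrib_right)

section \<open>Ideals and presented algebras\<close>

locale alg_ideal =
  fixes N :: "('g, 'k::field) free_alg set"
  assumes N_zero [simp]: "0 \<in> N"
    and N_add: "f \<in> N \<Longrightarrow> g \<in> N \<Longrightarrow> f + g \<in> N"
    and N_mult_left: "f \<in> N \<Longrightarrow> h * f \<in> N"
    and N_mult_right: "f \<in> N \<Longrightarrow> f * h \<in> N"
begin

definition cong (infix \<open>\<approx>\<close> 50)
  where "f \<approx> g \<longleftrightarrow> f - g \<in> N"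

lemma N_scale: "f \<in> N \<Longrightarrow> scale c f \<in> N"
  by (simp add: scale_eq N_mult_left)

lemma N_uminus: "f \<in> N \<Longrightarrow> - f \<in> N"
  using N_scale[of f "-1"] by simp

lemma N_diff: "f \<in> N \<Longrightarrow> g \<in> N \<Longrightarrow> f - g \<in> N"
  using N_add[of f "- g"] N_uminus[of g] by simp

lemma cong_refl [simp]: "f \<approx> f"
  by (simp add: cong_def)

lemma cong_sym: "f \<approx> g \<Longrightarrow> g \<approx> f"
  using N_uminus[of "f - g"] by (simp add: cong_def)

lemma cong_trans [trans]: "f \<approx> g \<Longrightarrow> g \<approx> h \<Longrightarrow> f \<approx> h"
  using N_add[of "f - g" "g - h"] by (simp add: cong_def)

lemma cong_add: "f \<approx> f' \<Longrightarrow> g \<approx> g' \<Longrightarrow> f + g \<approx> f' + g'"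
  using N_add[of "f - f'" "g - g'"] by (simp add: cong_def algebra_simps)

lemma cong_diff: "f \<approx> f' \<Longrightarrow> g \<approx> g' \<Longrightarrow> f - g \<approx> f' - g'"
  using N_diff[of "f - f'" "g - g'"] by (simp add: cong_def algebra_simps)

lemma cong_mult_left: "f \<approx> g \<Longrightarrow> h * f \<approx> h * g"
  using N_mult_left[of "f - g" h] by (simp add: cong_def algebra_simps)

lemma cong_mult_right: "f \<approx> g \<Longrightarrow> f * h \<approx> g * h"
  using N_mult_right[of "f - g" h] by (simp add: cong_def algebra_simps)

lemma cong_scale: "f \<approx> g \<Longrightarrow> scale c f \<approx> scale c g"
  by (simp add: scale_eq cong_mult_left)

lemma cong_sum: "(\<And>i. i \<in> S \<Longrightarrow> f i \<approx> g i) \<Longrightarrow> (\<Sum>i\<in>S. f i) \<approx> (\<Sum>i\<in>S. g i)"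
  by (induction S rule: infinite_finite_induct) (auto intro: cong_add)

definition scomm :: "'k \<Rightarrow> ('g, 'k) free_alg \<Rightarrow> ('g, 'k) free_alg \<Rightarrow> bool"
  where "scomm c f g \<longleftrightarrow> f * g \<approx> scale c (g * f)"

lemma scomm_refl [simp]: "scomm 1 f f"
  by (simp add: scomm_def)

lemma scomm_sym:
  assumes "scomm c f g" "c \<noteq> 0" shows "scomm (inverse c) g f"
  using cong_scale[OF assms(1)[unfolded scomm_def], of "inverse c"] assms(2)
  by (simp add: scomm_def cong_sym)

lemma scomm_mult_right:
  assumes "scomm c f g" "scomm d f h" shows "scomm (c * d) f (g * h)"
proof -
  have "f * (g * h) \<approx> scale c (g * f) * h"
    using cong_mult_right[OF assms(1)[unfolded scomm_def]] by (simp add: mult.assoc)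
  also have "\<dots> = scale c (g * (f * h))"
    by (simp add: scale_mult_left mult.assoc)
  also have "\<dots> \<approx> scale c (g * scale d (h * f))"
    by (intro cong_scale cong_mult_left assms(2)[unfolded scomm_def])
  also have "\<dots> = scale (c * d) (g * h * f)"
    by (simp add: scale_mult_right[symmetric] mult.assoc)
  finally show ?thesis
    by (simp add: scomm_def)
qed

lemma scomm_mult_left:
  assumes "scomm c f h" "scomm d g h" shows "scomm (c * d) (f * g) h"
proof -
  have "f * g * h \<approx> f * scale d (h * g)"
    using cong_mult_left[OF assms(2)[unfolded scomm_def]] by (simp add: mult.assoc)
  also have "\<dots> = scale d (f * h * g)"
    by (simp add: scale_mult_right[symmetric] mult.assoc)
  also have "\<dots> \<approx> scale d (scale c (h * f) * g)"
    by (intro cong_scale cong_mult_right assms(1)[unfolded scomm_def])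
  also have "\<dots> = scale (c * d) (h * (f * g))"
    by (simp add: scale_mult_left[symmetric] mult.assoc mult.commute)
  finally show ?thesis
    by (simp add: scomm_def)
qed

lemma scomm_zero_left [simp]: "scomm c 0 g"
  by (simp add: scomm_def)

lemma scomm_add_left: "scomm c f h \<Longrightarrow> scomm c g h \<Longrightarrow> scomm c (f + g) h"
  using cong_add[of "f * h" "scale c (h * f)" "g * h" "scale c (h * g)"]
  by (simp add: scomm_def distrib_left distrib_right free_alg.scale_right_distrib)

lemma scomm_scale_left: "scomm c f g \<Longrightarrow> scomm c (scale d f) g"
  using cong_scale[of "f * g" "scale c (g * f)" d]
  by (simp add: scomm_def scale_mult_left[symmetric] scale_mult_right[symmetric] mult.commute)

lemma scomm_sum_left: "(\<And>i. i \<in> S \<Longrightarrow> scomm c (f i) g) \<Longrightarrow> scomm c (\<Sum>i\<in>S. f i) g"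
  by (induction S rule: infinite_finite_induct) (auto intro: scomm_add_left)

text \<open>Rearranging factors inside a span, or testing membership in a right ideal, is
  insensitive to nonzero scalars; there the exact factor is forgotten.\<close>

definition qcomm :: "('g, 'k) free_alg \<Rightarrow> ('g, 'k) free_alg \<Rightarrow> bool"
  where "qcomm f g \<longleftrightarrow> (\<exists>c. c \<noteq> 0 \<and> scomm c f g)"

lemma qcommI: "scomm c f g \<Longrightarrow> c \<noteq> 0 \<Longrightarrow> qcomm f g"
  by (auto simp: qcomm_def)

lemma qcomm_sym: "qcomm f g \<Longrightarrow> qcomm g f"
  unfolding qcomm_def using scomm_sym nonzero_imp_inverse_nonzero by blast

lemma qcomm_one_right [simp]: "qcomm f 1"
  by (rule qcommI[of 1]) (simp_all add: scomm_def)

lemma qcomm_mult_right: "qcomm f g \<Longrightarrow> qcomm f h \<Longrightarrow> qcomm f (g * h)"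
  unfolding qcomm_def by (meson scomm_mult_right no_zero_divisors)

lemma qcomm_power_right: "qcomm f g \<Longrightarrow> qcomm f (g ^ m)"
  by (induction m) (auto intro: qcomm_mult_right)

lemma qcomm_prod_list: "(\<And>g. g \<in> set gs \<Longrightarrow> qcomm f g) \<Longrightarrow> qcomm f (prod_list gs)"
  by (induction gs) (auto intro: qcomm_mult_right)

end

section \<open>Quotient of a free algebra by an ideal\<close>

locale presented_algebra =
  fixes G :: "'g set" and I :: "('g, 'k::field) free_alg set"
  assumes ideal: "ideal I (free_algebra G)"
begin

sublocale ideal I "free_algebra G"
  by (rule ideal)

definition A :: "('k, ('g, 'k) free_alg set) module"
  where "A = quotient_algebra (free_algebra G) I"

definition cls :: "('g, 'k) free_alg \<Rightarrow> ('g, 'k) free_alg set"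
  where "cls f = I +>\<^bsub>free_algebra G\<^esub> proj_alg G f"

text \<open>
  Letters outside \<open>G\<close> are sent to 0, so this is a two-sided ideal of the whole
  type \<^typ>\<open>('g, 'k) free_alg\<close>, and computations modulo it need no carrier conditions.
\<close>

definition N :: "('g, 'k) free_alg set"
  where "N = {f. proj_alg G f \<in> I}"

lemma I_carrier: "f \<in> I \<Longrightarrow> proj_alg G f = f"
  using a_subset carrier_free_algebra by blast

lemma I_zero: "0 \<in> I"
  using additive_subgroup.zero_closed[OF is_additive_subgroup] by simp

lemma I_add: "f \<in> I \<Longrightarrow> g \<in> I \<Longrightarrow> f + g \<in> I"
  using additive_subgroup.a_closed[OF is_additive_subgroup] by simp

sublocale alg_ideal N
proof
  show "0 \<in> N"
    using I_zero by (simp add: N_def)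
  show "f + g \<in> N" if "f \<in> N" "g \<in> N" for f g
    using that I_add[of "proj_alg G f" "proj_alg G g"] by (simp add: N_def proj_alg_add)
  show "h * f \<in> N" "f * h \<in> N" if "f \<in> N" for f h
    using that I_l_closed[of "proj_alg G f" "proj_alg G h"] I_r_closed[of "proj_alg G f" "proj_alg G h"]
    by (simp_all add: N_def proj_alg_mult)
qed

lemma cls_def': "cls f = (\<lambda>i. i + proj_alg G f) ` I"
  by (auto simp: cls_def a_r_coset_def')

lemma cls_eq_iff: "cls f = cls g \<longleftrightarrow> f - g \<in> N"
proof
  assume "cls f = cls g"
  moreover have "proj_alg G f \<in> cls f"
    using I_zero by (auto simp: cls_def' image_iff intro!: bexI[of _ 0])
  ultimately obtain i where "i \<in> I" "proj_alg G f = i + proj_alg G g"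
    by (auto simp: cls_def')
  then show "f - g \<in> N"
    by (simp add: N_def proj_alg_minus)
next
  have *: "cls f \<subseteq> cls g" if "f - g \<in> N" for f g
  proof
    fix h assume "h \<in> cls f"
    then obtain i where i: "i \<in> I" "h = i + proj_alg G f"
      by (auto simp: cls_def')
    then have "i + (proj_alg G f - proj_alg G g) \<in> I"
      using that I_add[of i "proj_alg G (f - g)"] by (simp add: N_def proj_alg_minus)
    then show "h \<in> cls g"
      using i by (auto simp: cls_def' image_iff intro!: bexI[of _ "i + (proj_alg G f - proj_alg G g)"])
  qed
  assume "f - g \<in> N"
  moreover from N_uminus[OF this] have "g - f \<in> N"
    by simp
  ultimately show "cls f = cls g"
    using * by blast
qed

lemma cls_proj [simp]: "cls (proj_alg G f) = cls f"
  by (simp add: cls_def)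

lemma carrier_A: "carrier A = range cls"
proof -
  have "carrier A = (\<lambda>f. I +>\<^bsub>free_algebra G\<^esub> f) ` carrier (free_algebra G)"
    by (auto simp: A_def quotient_algebra_def FactRing_def A_RCOSETS_def RCOSETS_def a_r_coset_def)
  also have "\<dots> = range cls"
    by (auto simp: cls_def image_iff carrier_free_algebra) metis
  finally show ?thesis .
qed

lemma cls_in_carrier [simp]: "cls f \<in> carrier A"
  by (simp add: carrier_A)

lemma mult_cls [simp]: "cls f \<otimes>\<^bsub>A\<^esub> cls g = cls (f * g)"
  using rcoset_mult_add[of "proj_alg G f" "proj_alg G g"]
  by (simp add: cls_def A_def quotient_algebra_def FactRing_def proj_alg_mult)

lemma add_cls [simp]: "cls f \<oplus>\<^bsub>A\<^esub> cls g = cls (f + g)"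
  using a_rcos_sum[of "proj_alg G f" "proj_alg G g"]
  by (simp add: cls_def A_def quotient_algebra_def FactRing_def proj_alg_add)

lemma one_A: "\<one>\<^bsub>A\<^esub> = cls 1"
  by (simp add: cls_def A_def quotient_algebra_def FactRing_def)

lemma zero_A: "\<zero>\<^bsub>A\<^esub> = cls 0"
  by (simp add: cls_def' A_def quotient_algebra_def FactRing_def)

text \<open>The scalar multiple in the quotient is a union of cosets over all representatives. It
  collapses to one coset because representatives differ by elements of \<open>I\<close>, whose
  scalar multiples lie in \<open>N\<close>.\<close>

lemma smult_cls [simp]: "c \<odot>\<^bsub>A\<^esub> cls f = cls (scale c f)"
proof -
  have "cls (scale c h) = cls (scale c f)" if "h \<in> cls f" for h
  proof -
    from that obtain i where i: "i \<in> I" "h = i + proj_alg G f"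
      by (auto simp: cls_def')
    have "scale c i \<in> N"
      using i I_carrier by (intro N_scale) (simp add: N_def)
    moreover have "scale c h - scale c (proj_alg G f) = scale c i"
      by (simp add: i(2) free_alg.scale_right_distrib)
    ultimately show ?thesis
      using cls_eq_iff[of "scale c h" "scale c (proj_alg G f)"] cls_proj
      by (metis proj_alg_scale)
  qed
  moreover have "h = proj_alg G h" if "h \<in> cls f" for h
    using that I_carrier by (auto simp: cls_def' proj_alg_add)
  moreover have "proj_alg G f \<in> cls f"
    using I_zero by (auto simp: cls_def' image_iff intro!: bexI[of _ 0])
  ultimately have "(\<Union>h\<in>cls f. I +>\<^bsub>free_algebra G\<^esub> scale c h) = cls (scale c f)"
    by (auto simp: cls_def) (metis proj_alg_scale)+
  then show ?thesis
    by (simp add: A_def quotient_algebra_def)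
qed

lemma cls_eq_zero_iff: "cls f = \<zero>\<^bsub>A\<^esub> \<longleftrightarrow> f \<in> N"
  by (simp add: zero_A cls_eq_iff)

lemma carrier_A_cases:
  assumes "a \<in> carrier A" obtains f where "a = cls f"
  using assms by (auto simp: carrier_A)

lemma ring_A: "ring A"
proof (rule ringI)
  show "abelian_group A"
  proof (rule abelian_groupI)
    show "\<exists>y\<in>carrier A. y \<oplus>\<^bsub>A\<^esub> x = \<zero>\<^bsub>A\<^esub>" if "x \<in> carrier A" for x
    proof -
      obtain f where "x = cls f"
        using \<open>x \<in> carrier A\<close> by (rule carrier_A_cases)
      then show ?thesis
        by (intro bexI[of _ "cls (- f)"]) (simp_all add: zero_A)
    qed
  qed (auto simp: carrier_A zero_A algebra_simps)
  show "Group.monoid A"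
    by (rule monoidI) (auto simp: carrier_A one_A mult.assoc)
qed (auto simp: carrier_A algebra_simps)

lemma vectorspace_A: "vectorspace class_ring A"
proof -
  have neg: "\<exists>g. cls (f + g) = cls 0" for f
    by (rule exI[of _ "- f"]) simp
  show ?thesis
  proof (rule vs_criteria)
    show "field (class_ring :: 'k ring)"
      by (rule class_field.field_axioms)
  qed (use neg in \<open>auto simp: carrier_A zero_A algebra_simps free_alg.scale_right_distrib
        free_alg.scale_left_distrib free_alg.scale_scale\<close>)
qed

end

section \<open>Dimension counts\<close>

text \<open>Independent subsets of \<open>U\<close> stay independent in the span of
  \<open>S\<close>, so they have at most \<open>card S\<close> elements. Hence a maximal one exists,
  and it generates \<open>U\<close>.\<close>

lemma (in vectorspace) subspace_of_finite_span:
  assumes S: "finite S" "S \<subseteq> carrier V" and U: "VectorSpace.subspace K U V" "U \<subseteq> span S"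
  shows "vectorspace.fin_dim K (vs U)" "vectorspace.dim K (vs U) \<le> card S"
proof -
  have W: "VectorSpace.subspace K (span S) V"
    using S by (intro span_is_subspace)
  interpret W: vectorspace K "vs (span S)"
    by (rule subspace_is_vs[OF W])
  interpret U: vectorspace K "vs U"
    by (rule subspace_is_vs[OF U(1)])
  have sW: "submodule K (span S) V" and sU: "submodule K U V"
    using W U(1) by (simp_all add: VectorSpace.subspace_def)
  have S_sub: "S \<subseteq> span S"
    using S by (intro in_own_span)
  have gen: "W.span S = carrier (vs (span S))"
    using span_li_not_depend(1)[OF S_sub sW] by simp
  have fdW: "W.fin_dim"
    unfolding W.fin_dim_def using S S_sub gen by auto
  have dimW: "W.dim \<le> card S"
    using W.gen_ge_dim[OF S(1) _ gen] S_sub by simp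
  have bound: "finite B \<and> card B \<le> card S" if "B \<subseteq> carrier (vs U) \<and> U.lin_indpt B" for B
  proof -
    have B: "B \<subseteq> U" "B \<subseteq> span S"
      using that U(2) by auto
    then have "W.lin_indpt B"
      using that span_li_not_depend(2)[OF B(1) sU] span_li_not_depend(2)[OF B(2) sW] by simp
    then show ?thesis
      using W.li_le_dim[OF fdW, of B] B(2) dimW by auto
  qed
  have "{} \<subseteq> carrier (vs U) \<and> U.lin_indpt {}"
    by (auto simp: U.lin_dep_def)
  from maximal_exists[of "\<lambda>B. B \<subseteq> carrier (vs U) \<and> U.lin_indpt B", OF bound this]
  obtain B where B: "finite B" "maximal B (\<lambda>B. B \<subseteq> carrier (vs U) \<and> U.lin_indpt B)"
    by blast
  have genB: "U.span B = carrier (vs U)"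
    by (rule U.max_li_is_gen[OF B(2)])
  have B_sub: "B \<subseteq> carrier (vs U)" "U.lin_indpt B"
    using B(2) by (auto simp: maximal_def)
  show "U.fin_dim"
    unfolding U.fin_dim_def using B(1) B_sub genB by blast
  show "U.dim \<le> card S"
    using U.gen_ge_dim[OF B(1) B_sub(1) genB] bound[of B] B_sub by simp
qed

section \<open>Linear maps from a free algebra to a vector space\<close>

locale free_alg_map = vectorspace class_ring V
  for V :: "('k::field, 'v, 'z) module_scheme" +
  fixes \<Phi> :: "('g, 'k) free_alg \<Rightarrow> 'v"
  assumes map_closed [simp]: "\<Phi> f \<in> carrier V"
    and map_add: "\<Phi> (f + g) = \<Phi> f \<oplus>\<^bsub>V\<^esub> \<Phi> g"
    and map_scale: "\<Phi> (scale c f) = c \<odot>\<^bsub>V\<^esub> \<Phi> f"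
begin

lemma map_zero: "\<Phi> 0 = \<zero>\<^bsub>V\<^esub>"
  using map_scale[of 0 0] smult_l_null[of "\<Phi> 0"] by simp

lemma map_sum: "finite B \<Longrightarrow> \<Phi> (\<Sum>b\<in>B. f b) = (\<Oplus>\<^bsub>V\<^esub>b\<in>B. \<Phi> (f b))"
  by (induction B rule: finite_induct) (auto simp: map_zero map_add)

lemma map_minus_eq_zero_iff: "\<Phi> (f - g) = \<zero>\<^bsub>V\<^esub> \<longleftrightarrow> \<Phi> f = \<Phi> g"
proof
  assume "\<Phi> (f - g) = \<zero>\<^bsub>V\<^esub>"
  then show "\<Phi> f = \<Phi> g"
    using map_add[of "f - g" g] by simp
next
  assume "\<Phi> f = \<Phi> g"
  then have "\<Phi> (f - g) \<oplus>\<^bsub>V\<^esub> \<Phi> g = \<Phi> g"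
    using map_add[of "f - g" g] by simp
  then show "\<Phi> (f - g) = \<zero>\<^bsub>V\<^esub>"
    using M.add.right_cancel[of "\<Phi> g" "\<Phi> (f - g)" "\<zero>\<^bsub>V\<^esub>"] by simp
qed

lemma lincomb_image:
  assumes "finite B" "inj_on \<Phi> B"
  shows "lincomb a (\<Phi> ` B) = \<Phi> (\<Sum>b\<in>B. scale (a (\<Phi> b)) b)"
proof -
  have "(\<Oplus>\<^bsub>V\<^esub>v\<in>\<Phi> ` B. a v \<odot>\<^bsub>V\<^esub> v) = (\<Oplus>\<^bsub>V\<^esub>b\<in>B. a (\<Phi> b) \<odot>\<^bsub>V\<^esub> \<Phi> b)"
    using assms(2) by (intro M.finsum_reindex) auto
  then show ?thesis
    using assms(1) by (simp add: lincomb_def map_sum map_scale)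
qed

text \<open>Coefficients are indexed by the elements of \<open>B\<close> and not by their images, so
  two elements with equal image already violate independence. This makes \<open>card B\<close> a
  valid lower bound for a dimension.\<close>

definition indep :: "('g, 'k) free_alg set \<Rightarrow> bool"
  where "indep B \<longleftrightarrow> (\<forall>\<alpha>. \<Phi> (\<Sum>b\<in>B. scale (\<alpha> b) b) = \<zero>\<^bsub>V\<^esub> \<longrightarrow> (\<forall>b\<in>B. \<alpha> b = 0))"

lemma indep_inj_on:
  assumes "finite B" "indep B"
  shows "inj_on \<Phi> B"
proof (rule inj_onI)
  fix b c assume bc: "b \<in> B" "c \<in> B" "\<Phi> b = \<Phi> c"
  show "b = c"
  proof (rule ccontr)
    assume "b \<noteq> c"
    let ?\<alpha> = "\<lambda>d. if d = b then 1::'k else if d = c then -1 else 0"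
    have "(\<Sum>d\<in>B. scale (?\<alpha> d) d) = (\<Sum>d\<in>{b, c}. scale (?\<alpha> d) d)"
      using assms(1) bc by (intro sum.mono_neutral_right) auto
    also have "\<dots> = b - c"
      using \<open>b \<noteq> c\<close> by simp
    finally have "\<Phi> (\<Sum>d\<in>B. scale (?\<alpha> d) d) = \<zero>\<^bsub>V\<^esub>"
      using bc map_minus_eq_zero_iff[of b c] by simp
    then have "\<forall>d\<in>B. ?\<alpha> d = 0"
      using assms(2) unfolding indep_def by (elim allE[where x = ?\<alpha>] impE)
    then show False
      using bc by auto
  qed
qed

lemma indep_card_le_dim:
  assumes U: "VectorSpace.subspace class_ring U V" "vectorspace.fin_dim class_ring (vs U)"
    and B: "finite B" "\<Phi> ` B \<subseteq> U" "indep B"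
  shows "card B \<le> vectorspace.dim class_ring (vs U)"
proof -
  interpret U: vectorspace class_ring "vs U"
    by (rule subspace_is_vs[OF U(1)])
  have inj: "inj_on \<Phi> B"
    using B indep_inj_on by blast
  have "lin_indpt (\<Phi> ` B)"
  proof (rule finite_lin_indpt2)
    fix a assume "lincomb a (\<Phi> ` B) = \<zero>\<^bsub>V\<^esub>"
    then show "\<forall>v\<in>\<Phi> ` B. a v = \<zero>\<^bsub>class_ring\<^esub>"
      using B(3) unfolding lincomb_image[OF B(1) inj] indep_def
      by (auto dest: spec[of _ "\<lambda>b. a (\<Phi> b)"])
  qed (use B in auto)
  then have "U.lin_indpt (\<Phi> ` B)"
    using span_li_not_depend(2)[OF B(2)] U(1) by (simp add: VectorSpace.subspace_def)
  then have "card (\<Phi> ` B) \<le> U.dim"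
    using U.li_le_dim(2)[OF U(2)] B(2) by simp
  then show ?thesis
    using inj by (simp add: card_image)
qed

lemma map_in_span:
  assumes "f \<in> free_alg.span S"
  shows "\<Phi> f \<in> span (\<Phi> ` S)"
  using assms
proof (induction rule: free_alg.span_induct_alt)
  case base
  have "span {} \<subseteq> span (\<Phi> ` S)"
    by (rule span_is_monotone) auto
  then show ?case
    by (auto simp: map_zero span_def lincomb_def)
next
  case (step c f g)
  have sub: "submodule class_ring (span (\<Phi> ` S)) V"
    by (rule span_is_submodule) auto
  have "\<Phi> f \<in> span (\<Phi> ` S)"
    using in_own_span[of "\<Phi> ` S"] step.hyps(1) map_closed by blast
  then show ?case
    using sub step.IH by (auto simp: map_add map_scale submodule_def)
qed

lemma span_image: "span (\<Phi> ` S) = \<Phi> ` free_alg.span S"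
proof
  have sub: "submodule class_ring (\<Phi> ` free_alg.span S) V"
    unfolding submodule_def
  proof (intro conjI allI impI)
    show "\<zero>\<^bsub>V\<^esub> \<in> \<Phi> ` free_alg.span S"
      using map_zero by (metis free_alg.span_zero imageI)
    show "v \<oplus>\<^bsub>V\<^esub> w \<in> \<Phi> ` free_alg.span S"
      if "v \<in> \<Phi> ` free_alg.span S" "w \<in> \<Phi> ` free_alg.span S" for v w
      using that by (auto simp flip: map_add intro!: imageI free_alg.span_add)
    show "c \<odot>\<^bsub>V\<^esub> v \<in> \<Phi> ` free_alg.span S" if "v \<in> \<Phi> ` free_alg.span S" for c v
      using that by (auto simp flip: map_scale intro!: imageI free_alg.span_scale)
  qed (auto intro: module_axioms)
  show "span (\<Phi> ` S) \<subseteq> \<Phi> ` free_alg.span S"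
    by (rule span_is_subset[OF _ sub]) (auto intro: free_alg.span_base)
qed (auto intro: map_in_span)

end

text \<open>Gaussian elimination, by induction on the equations: an unknown \<open>s\<close> with
  nonzero coefficient in the equation \<open>e\<close> is removed from all others, and its value is
  recovered from \<open>e\<close> at the end.\<close>

lemma ex_nontrivial_solution:
  fixes C :: "'e \<Rightarrow> 't \<Rightarrow> 'k::field"
  assumes "finite E" "finite T" "card E < card T"
  shows "\<exists>\<alpha>. (\<exists>t\<in>T. \<alpha> t \<noteq> 0) \<and> (\<forall>e\<in>E. (\<Sum>t\<in>T. \<alpha> t * C e t) = 0)"
  using assms
proof (induction E arbitrary: T C rule: finite_induct)
  case empty
  then have "T \<noteq> {}"
    by auto
  then show ?case
    by (intro exI[of _ "\<lambda>_. 1"]) auto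
next
  case (insert e E)
  show ?case
  proof (cases "\<forall>t\<in>T. C e t = 0")
    case True
    then show ?thesis
      using insert.IH[of T C] insert.prems insert.hyps by (auto simp: sum.neutral)
  next
    case False
    then obtain s where s: "s \<in> T" "C e s \<noteq> 0"
      by blast
    define D where "D = (\<lambda>f t. C f t - C f s * C e t / C e s)"
    have "\<exists>\<alpha>. (\<exists>t\<in>T - {s}. \<alpha> t \<noteq> 0) \<and> (\<forall>f\<in>E. (\<Sum>t\<in>T - {s}. \<alpha> t * D f t) = 0)"
      using insert.prems insert.hyps s by (intro insert.IH) auto
    then obtain \<alpha> where \<alpha>: "\<exists>t\<in>T - {s}. \<alpha> t \<noteq> 0" "\<And>f. f \<in> E \<Longrightarrow> (\<Sum>t\<in>T - {s}. \<alpha> t * D f t) = 0"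
      by blast
    define \<Sigma> where "\<Sigma> f = (\<Sum>t\<in>T - {s}. \<alpha> t * C f t)" for f
    define \<beta> where "\<beta> = \<alpha>(s := - \<Sigma> e / C e s)"
    have sum_\<beta>: "(\<Sum>t\<in>T. \<beta> t * C f t) = \<Sigma> f - \<Sigma> e / C e s * C f s" for f
    proof -
      have "(\<Sum>t\<in>T - {s}. \<beta> t * C f t) = \<Sigma> f"
        unfolding \<Sigma>_def \<beta>_def by (intro sum.cong) auto
      then show ?thesis
        using s(1) insert.prems(1) by (simp add: sum.remove[of T s] \<beta>_def)
    qed
    have "\<Sigma> f - \<Sigma> e / C e s * C f s = (\<Sum>t\<in>T - {s}. \<alpha> t * D f t)" for f
      by (simp add: \<Sigma>_def D_def right_diff_distrib sum_subtractf sum_distrib_left sum_divide_distrib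
          mult_ac)
    moreover have "D e t = 0" for t
      using s(2) by (simp add: D_def)
    ultimately have "(\<Sum>t\<in>T. \<beta> t * C f t) = 0" if "f \<in> insert e E" for f
      using that \<alpha>(2) by (auto simp: sum_\<beta>)
    moreover have "\<exists>t\<in>T. \<beta> t \<noteq> 0"
      using \<alpha>(1) by (auto simp: \<beta>_def)
    ultimately show ?thesis
      by blast
  qed
qed

text \<open>The model for \<open>J\<close> is the annihilator of a vector in a right module; the
  free algebra modulo \<open>J\<close> is then the cyclic submodule generated by that
  vector.\<close>

locale alg_right_ideal = alg_ideal N
  for N :: "('g, 'k::field) free_alg set" +
  fixes J :: "('g, 'k) free_alg set"
  assumes J_add: "f \<in> J \<Longrightarrow> g \<in> J \<Longrightarrow> f + g \<in> J"
    and J_mult_right: "f \<in> J \<Longrightarrow> f * h \<in> J"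
    and N_subset_J: "N \<subseteq> J"
begin

lemma J_zero [simp]: "0 \<in> J"
  using N_subset_J N_zero by blast

lemma J_scale: "f \<in> J \<Longrightarrow> scale c f \<in> J"
  by (simp add: scale_eq single_0_commute J_mult_right)

lemma J_scale_iff: "c \<noteq> 0 \<Longrightarrow> scale c f \<in> J \<longleftrightarrow> f \<in> J"
  using J_scale[of f c] J_scale[of "scale c f" "inverse c"] by auto

lemma J_diff: "f \<in> J \<Longrightarrow> g \<in> J \<Longrightarrow> f - g \<in> J"
  using J_add[of f "scale (-1) g"] J_scale[of g "-1"] by simp

lemma J_sum: "(\<And>i. i \<in> S \<Longrightarrow> f i \<in> J) \<Longrightarrow> (\<Sum>i\<in>S. f i) \<in> J"
  by (induction S rule: infinite_finite_induct) (auto intro: J_add)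

lemma J_cong: assumes "f \<approx> g" shows "f \<in> J \<longleftrightarrow> g \<in> J"
proof -
  have "f - g \<in> J" "g - f \<in> J"
    using assms cong_sym[OF assms] N_subset_J by (auto simp: cong_def)
  then show ?thesis
    using J_add[of "f - g" g] J_add[of "g - f" f] by auto
qed

definition indep_mod :: "('g, 'k) free_alg set \<Rightarrow> bool"
  where "indep_mod B \<longleftrightarrow> (\<forall>\<alpha>. (\<Sum>b\<in>B. scale (\<alpha> b) b) \<in> J \<longrightarrow> (\<forall>b\<in>B. \<alpha> b = 0))"

lemma ex_indep_mod_spanning:
  assumes "finite S"
  obtains B where "B \<subseteq> S" "indep_mod B" "\<forall>s\<in>S. \<exists>\<beta>. s - (\<Sum>b\<in>B. scale (\<beta> b) b) \<in> J"
proof -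
  from assms have "\<exists>B\<subseteq>S. indep_mod B \<and> (\<forall>s\<in>S. \<exists>\<beta>. s - (\<Sum>b\<in>B. scale (\<beta> b) b) \<in> J)"
  proof (induction S rule: finite_induct)
    case empty
    then show ?case
      by (auto simp: indep_mod_def)
  next
    case (insert s S)
    then obtain B where B: "B \<subseteq> S" "indep_mod B"
      "\<And>t. t \<in> S \<Longrightarrow> \<exists>\<beta>. t - (\<Sum>b\<in>B. scale (\<beta> b) b) \<in> J"
      by blast
    have fin: "finite B" "s \<notin> B"
      using B(1) insert.hyps finite_subset by blast+
    show ?case
    proof (cases "\<exists>\<beta>. s - (\<Sum>b\<in>B. scale (\<beta> b) b) \<in> J")
      case True
      then show ?thesis
        using B by (intro exI[of _ B]) auto
    next
      case False
      have "indep_mod (insert s B)"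
        unfolding indep_mod_def
      proof (intro allI impI)
        fix \<alpha> assume *: "(\<Sum>b\<in>insert s B. scale (\<alpha> b) b) \<in> J"
        have "\<alpha> s = 0"
        proof (rule ccontr)
          assume "\<alpha> s \<noteq> 0"
          have eq: "scale (inverse (\<alpha> s)) (\<Sum>b\<in>insert s B. scale (\<alpha> b) b) =
              s - (\<Sum>b\<in>B. scale (- inverse (\<alpha> s) * \<alpha> b) b)"
            using fin \<open>\<alpha> s \<noteq> 0\<close>
            by (simp add: free_alg.scale_right_distrib free_alg.scale_sum_right sum_negf)
          have "\<exists>\<beta>. s - (\<Sum>b\<in>B. scale (\<beta> b) b) \<in> J"
            using J_scale[OF *, of "inverse (\<alpha> s)"] unfolding eq
            by (rule exI[of _ "\<lambda>b. - inverse (\<alpha> s) * \<alpha> b"])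
          then show False
            using False by contradiction
        qed
        then show "\<forall>b\<in>insert s B. \<alpha> b = 0"
          using * B(2) fin by (auto simp: indep_mod_def)
      qed
      moreover have "\<exists>\<beta>. t - (\<Sum>b\<in>insert s B. scale (\<beta> b) b) \<in> J" if "t \<in> insert s S" for t
      proof (cases "t = s")
        case True
        then have "t - (\<Sum>b\<in>insert s B. scale (if b = s then 1 else 0) b) \<in> J"
          using fin by (simp add: if_distrib[of "\<lambda>c. scale c _"] sum.delta cong: if_cong)
        then show ?thesis
          by (rule exI[of _ "\<lambda>b. if b = s then 1 else 0"])
      next
        case False
        with that B(3)[of t] obtain \<beta> where \<beta>: "t - (\<Sum>b\<in>B. scale (\<beta> b) b) \<in> J"
          by auto
        have "(\<Sum>b\<in>insert s B. scale ((\<beta>(s := 0)) b) b) = (\<Sum>b\<in>B. scale (\<beta> b) b)"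
          using fin by (simp, intro sum.cong) auto
        then show ?thesis
          using \<beta> by (intro exI[of _ "\<beta>(s := 0)"]) (simp only:)
      qed
      ultimately show ?thesis
        using B(1) by (intro exI[of _ "insert s B"]) blast
    qed
  qed
  then show ?thesis
    using that by (elim exE conjE)
qed

end

section \<open>Families commuting up to powers of q\<close>

lemma power_int_eq_iff_of_no_root:
  fixes q :: "'k::field"
  assumes "q \<noteq> 0" "\<forall>k::nat. k > 0 \<longrightarrow> q ^ k \<noteq> 1"
  shows "q powi a = q powi b \<longleftrightarrow> a = b"
proof
  assume *: "q powi a = q powi b"
  have aux: "False" if "q powi a = q powi b" "a < b" for a b
  proof -
    have "q powi (b - a) = 1"
      using that assms(1) by (simp add: power_int_diff)
    moreover have "q powi (b - a) = q ^ nat (b - a)"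
      using that by (simp add: power_int_def)
    ultimately show False
      using assms(2) that by auto
  qed
  show "a = b"
    using aux[of a b] aux[of b a] * by (cases a b rule: linorder_cases) auto
qed simp

text \<open>Since \<open>q\<close> has infinite order, a trivial kernel of the exponent matrix means
  that distinct monomials commute with the generators by distinct systems of factors. The last
  assumption says that no word kills the vector behind \<open>J\<close>.\<close>

locale q_commuting_family = alg_right_ideal N J
  for N J :: "('g, 'k::field) free_alg set" +
  fixes q :: 'k and ks :: "'i list" and gen :: "'i \<Rightarrow> ('g, 'k) free_alg" and c :: "'i \<Rightarrow> 'i \<Rightarrow> int"
  assumes q: "q \<noteq> 0" "\<forall>k::nat. k > 0 \<longrightarrow> q ^ k \<noteq> 1"
    and distinct: "distinct ks"
    and gen_commute: "k \<in> set ks \<Longrightarrow> l \<in> set ks \<Longrightarrow>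
      scomm (q powi c k l) (gen k) (gen l)"
    and nondegenerate: "\<And>\<delta> :: 'i \<Rightarrow> int. (\<And>k. k \<in> set ks \<Longrightarrow> (\<Sum>l\<in>set ks. c k l * \<delta> l) = 0) \<Longrightarrow>
      l \<in> set ks \<Longrightarrow> \<delta> l = 0"
    and words_notin_J: "set xs \<subseteq> set ks \<Longrightarrow> prod_list (map gen xs) \<notin> J"
begin

definition monom :: "('i \<Rightarrow> nat) \<Rightarrow> ('g, 'k) free_alg"
  where "monom e = prod_list (map (\<lambda>k. gen k ^ e k) ks)"

text \<open>The exponent of \<open>q\<close> produced when generator \<open>k\<close> crosses a
  monomial: the eigenvalue by which commutators separate monomials.\<close>

definition weight :: "'i \<Rightarrow> ('i \<Rightarrow> nat) \<Rightarrow> int"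
  where "weight k e = (\<Sum>l\<in>set ks. c k l * int (e l))"

definition words :: "nat \<Rightarrow> ('g, 'k) free_alg set"
  where "words r = {prod_list (map gen xs) | xs. set xs \<subseteq> set ks \<and> length xs \<le> r}"

lemma finite_words: "finite (words r)"
proof -
  have "words r = (\<lambda>xs. prod_list (map gen xs)) ` {xs. set xs \<subseteq> set ks \<and> length xs \<le> r}"
    by (auto simp: words_def)
  then show ?thesis
    by (simp add: finite_lists_length_le)
qed

lemma words_mono: "r \<le> s \<Longrightarrow> words r \<subseteq> words s"
  by (fastforce simp: words_def)

lemma words_mult: "v \<in> words r \<Longrightarrow> w \<in> words s \<Longrightarrow> v * w \<in> words (r + s)"
proof -
  assume "v \<in> words r" "w \<in> words s"
  then obtain xs ys where "v = prod_list (map gen xs)" "set xs \<subseteq> set ks" "length xs \<le> r"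
    "w = prod_list (map gen ys)" "set ys \<subseteq> set ks" "length ys \<le> s"
    by (auto simp: words_def)
  then show ?thesis
    by (auto simp: words_def intro!: exI[of _ "xs @ ys"])
qed

lemma one_in_words [simp]: "1 \<in> words r"
  by (auto simp: words_def intro!: exI[of _ "[]"])

lemma gen_in_words: "k \<in> set ks \<Longrightarrow> gen k \<in> words 1"
  by (auto simp: words_def intro!: exI[of _ "[k]"])

lemma gen_power_in_words: "k \<in> set ks \<Longrightarrow> gen k ^ m \<in> words m"
proof (induction m)
  case (Suc m)
  then show ?case
    using words_mult[OF gen_in_words[of k] Suc.IH] by simp
qed simp

lemma monom_in_words:
  assumes "\<And>k. k \<in> set ks \<Longrightarrow> e k \<le> d"
  shows "monom e \<in> words (length ks * d)"
proof -
  have "prod_list (map (\<lambda>k. gen k ^ e k) ls) \<in> words (length ls * d)" if "set ls \<subseteq> set ks" for ls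
    using that
  proof (induction ls)
    case (Cons l ls)
    have "gen l ^ e l \<in> words d"
      using gen_power_in_words[of l "e l"] words_mono[of "e l" d] assms Cons.prems by auto
    then show ?case
      using words_mult[OF _ Cons.IH, of "gen l ^ e l" d] Cons.prems by (simp add: algebra_simps)
  qed simp
  then show ?thesis
    by (simp add: monom_def)
qed

lemma gen_commute_power:
  assumes "k \<in> set ks" "l \<in> set ks"
  shows "scomm (q powi (c k l * int m)) (gen k) (gen l ^ m)"
proof (induction m)
  case (Suc m)
  show ?case
    using scomm_mult_right[OF gen_commute[OF assms] Suc] q(1)
    by (simp add: power_int_add[symmetric] algebra_simps)
qed (simp add: scomm_def)

lemma gen_commute_monom:
  assumes "k \<in> set ks"
  shows "scomm (q powi weight k e) (gen k) (monom e)"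
proof -
  have "scomm (q powi (\<Sum>l\<in>set ls. c k l * int (e l))) (gen k) (prod_list (map (\<lambda>l. gen l ^ e l) ls))"
    if "set ls \<subseteq> set ks" "distinct ls" for ls
    using that
  proof (induction ls)
    case (Cons l ls)
    then have "scomm (q powi (c k l * int (e l))) (gen k) (gen l ^ e l)"
      using assms by (intro gen_commute_power) auto
    from scomm_mult_right[OF this Cons.IH] Cons.prems show ?case
      using q(1) by (simp add: power_int_add[symmetric])
  qed (simp add: scomm_def)
  then show ?thesis
    using distinct by (simp add: monom_def weight_def)
qed

lemma gen_qcomm_words:
  assumes "k \<in> set ks" "set xs \<subseteq> set ks"
  shows "qcomm (gen k) (prod_list (map gen xs))"
proof (rule qcomm_prod_list)
  fix g assume "g \<in> set (map gen xs)"
  then obtain l where l: "g = gen l" "l \<in> set ks"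
    using assms by auto
  then show "qcomm (gen k) g"
    using gen_commute[OF assms(1) l(2)] q(1) by (auto intro: qcommI)
qed

text \<open>
  Commuting the generator \<open>k\<close> past the relation and subtracting \<open>\<mu>\<close> times the relation kills
  the monomials on which \<open>k\<close> acts with eigenvalue \<open>\<mu>\<close>, at the price of a trailing generator.
\<close>

lemma kill_weights:
  assumes "set (map fst ps) \<subseteq> set ks" "length ps \<le> r"
    and "\<And>w. w \<in> words r \<Longrightarrow> (\<Sum>e\<in>T. scale (\<alpha> e) (w * monom e)) \<in> J"
    and "w \<in> words (r - length ps)"
  shows "(\<Sum>e\<in>T. scale (\<alpha> e * prod_list (map (\<lambda>(k, \<mu>). q powi weight k e - \<mu>) ps))
    (w * monom e * prod_list (map gen (rev (map fst ps))))) \<in> J"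
  using assms
proof (induction ps arbitrary: w)
  case Nil
  then show ?case
    by simp
next
  case (Cons p ps)
  obtain k \<mu> where p: "p = (k, \<mu>)"
    by (cases p)
  have k: "k \<in> set ks"
    using Cons.prems p by auto
  define t where "t = prod_list (map gen (rev (map fst ps)))"
  define \<beta> where "\<beta> e = \<alpha> e * prod_list (map (\<lambda>(k, \<mu>). q powi weight k e - \<mu>) ps)" for e
  have IH: "(\<Sum>e\<in>T. scale (\<beta> e) (v * monom e * t)) \<in> J" if "v \<in> words (r - length ps)" for v
    using Cons.IH[OF _ _ _ that] Cons.prems by (auto simp: \<beta>_def t_def)
  \<comment> \<open>\<open>J\<close> is only a right ideal, so the relation with
    \<open>gen k\<close> on the left must be among those assumed. Each pair of the list therefore
    uses up one letter of the allowed left factor.\<close>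
  have wk: "w * gen k \<in> words (r - length ps)"
    using words_mult[OF Cons.prems(4) gen_in_words[OF k]] Cons.prems(2)
    by (simp add: Suc_diff_Suc)
  have w: "w \<in> words (r - length ps)"
    by (rule subsetD[OF words_mono Cons.prems(4)]) (simp add: diff_le_mono2)
  \<comment> \<open>The generator must also cross the trailing word. The factor \<open>\<nu>\<close>
    is the same for every monomial and can be divided out.\<close>
  obtain \<nu> where \<nu>: "\<nu> \<noteq> 0" "scomm \<nu> (gen k) t"
    using gen_qcomm_words[OF k, of "rev (map fst ps)"] Cons.prems(1) by (auto simp: qcomm_def t_def)
  have comm: "w * gen k * monom e * t \<approx> scale (q powi weight k e * \<nu>) (w * monom e * (t * gen k))" for e
  proof -
    have "scomm (q powi weight k e * \<nu>) (gen k) (monom e * t)"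
      by (rule scomm_mult_right[OF gen_commute_monom[OF k] \<nu>(2)])
    from cong_mult_left[OF this[unfolded scomm_def], of w] show ?thesis
      by (simp add: mult.assoc scale_mult_right[symmetric])
  qed
  have "(\<Sum>e\<in>T. scale (\<beta> e) (w * gen k * monom e * t)) \<approx>
      (\<Sum>e\<in>T. scale (\<beta> e) (scale (q powi weight k e * \<nu>) (w * monom e * (t * gen k))))"
    by (intro cong_sum cong_scale comm)
  then have 1: "(\<Sum>e\<in>T. scale (\<beta> e * q powi weight k e * \<nu>) (w * monom e * (t * gen k))) \<in> J"
    using J_cong IH[OF wk] by (simp add: mult.assoc)
  have 2: "(\<Sum>e\<in>T. scale (\<beta> e * \<mu> * \<nu>) (w * monom e * (t * gen k))) \<in> J"
    using J_scale[OF J_mult_right[OF IH[OF w], of "gen k"], of "\<mu> * \<nu>"]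
    by (simp add: sum_distrib_right free_alg.scale_sum_right scale_mult_left[symmetric] mult_ac)
  have "(\<Sum>e\<in>T. scale (\<beta> e * (q powi weight k e - \<mu>)) (w * monom e * (t * gen k))) \<in> J"
  proof -
    have "\<beta> e * (q powi weight k e - \<mu>) =
        inverse \<nu> * (\<beta> e * q powi weight k e * \<nu> - \<beta> e * \<mu> * \<nu>)" for e
      using \<nu>(1) by (simp add: field_simps)
    then show ?thesis
      using J_scale[OF J_diff[OF 1 2], of "inverse \<nu>"]
      by (simp only: sum_subtractf[symmetric] free_alg.scale_left_diff_distrib[symmetric]
          free_alg.scale_sum_right free_alg.scale_scale)
  qed
  then show ?case
    by (simp add: p \<beta>_def t_def mult_ac)
qed

definition weight_bound :: nat
  where "weight_bound = (\<Sum>k\<in>set ks. \<Sum>l\<in>set ks. nat \<bar>c k l\<bar>)"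

definition box :: "nat \<Rightarrow> ('i \<Rightarrow> nat) set"
  where "box d = set ks \<rightarrow>\<^sub>E {..d}"

lemma finite_box: "finite (box d)"
  by (auto simp: box_def intro: finite_PiE)

lemma card_box: "card (box d) = (d + 1) ^ length ks"
  by (simp add: box_def card_PiE distinct_card[OF distinct])

lemma abs_weight_le:
  assumes "e \<in> box d" "k \<in> set ks"
  shows "\<bar>weight k e\<bar> \<le> int (weight_bound * d)"
proof -
  have "\<bar>weight k e\<bar> \<le> (\<Sum>l\<in>set ks. \<bar>c k l\<bar> * int d)"
    unfolding weight_def
  proof (rule order_trans[OF sum_abs], rule sum_mono)
    fix l assume "l \<in> set ks"
    then have "e l \<le> d"
      using assms by (auto simp: box_def)
    then show "\<bar>c k l * int (e l)\<bar> \<le> \<bar>c k l\<bar> * int d"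
      by (simp add: abs_mult mult_left_mono)
  qed
  also have "\<dots> = int ((\<Sum>l\<in>set ks. nat \<bar>c k l\<bar>) * d)"
    by (simp add: sum_distrib_right)
  also have "\<dots> \<le> int (weight_bound * d)"
    unfolding weight_bound_def using assms(2)
    by (intro iffD2[OF of_nat_le_iff] mult_right_mono member_le_sum) auto
  finally show ?thesis .
qed

lemma weight_inj:
  assumes "e \<in> box d" "e' \<in> box d" "\<And>k. k \<in> set ks \<Longrightarrow> weight k e = weight k e'"
  shows "e = e'"
proof -
  have eq: "int (e l) - int (e' l) = 0" if "l \<in> set ks" for l
  proof (rule nondegenerate[of "\<lambda>l. int (e l) - int (e' l)", OF _ that])
    fix k assume "k \<in> set ks"
    then show "(\<Sum>l\<in>set ks. c k l * (int (e l) - int (e' l))) = 0"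
      using assms(3)[of k] by (simp add: weight_def right_diff_distrib sum_subtractf)
  qed
  from assms(1,2) show ?thesis
    unfolding box_def by (rule PiE_ext) (use eq in force)
qed

text \<open>The number of commutators that suffice: for each generator, at most all integers in the
  range from \<open>- weight_bound * d\<close> to \<open>weight_bound * d\<close> in which its
  weights lie.\<close>

definition radius :: "nat \<Rightarrow> nat"
  where "radius d = length ks * (2 * weight_bound * d + 1)"

text \<open>Otherwise \<open>kill_weights\<close> applies to the list of all possible eigenvalues
  other than those of \<open>e0\<close>. Only the term of \<open>e0\<close> survives, a nonzero
  multiple of a word, and words are not in \<open>J\<close>.\<close>

lemma monoms_separated:
  assumes "e0 \<in> box d" "\<alpha> e0 \<noteq> 0"
  shows "\<exists>w\<in>words (radius d). (\<Sum>e\<in>box d. scale (\<alpha> e) (w * monom e)) \<notin> J"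
proof (rule ccontr)
  assume "\<not> ?thesis"
  then have *: "\<And>w. w \<in> words (radius d) \<Longrightarrow> (\<Sum>e\<in>box d. scale (\<alpha> e) (w * monom e)) \<in> J"
    by blast
  define B where "B = int (weight_bound * d)"
  define ps where "ps = concat (map (\<lambda>k. map (\<lambda>v. (k, q powi v)) (filter (\<lambda>v. v \<noteq> weight k e0) [- B..B])) ks)"
  define F where "F e = prod_list (map (\<lambda>(k, \<mu>). q powi weight k e - \<mu>) ps)" for e
  define t where "t = prod_list (map gen (rev (map fst ps)))"
  have fst_ps: "set (map fst ps) \<subseteq> set ks"
    by (auto simp: ps_def)
  have "length ps \<le> sum_list (map (\<lambda>k. 2 * weight_bound * d + 1) ks)"
    unfolding ps_def length_concat map_map comp_def length_map
    by (intro sum_list_mono order_trans[OF length_filter_le]) (simp add: B_def nat_le_iff)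
  then have len: "length ps \<le> radius d"
    by (simp add: radius_def sum_list_triv)
  have F0: "F e0 \<noteq> 0"
    using power_int_eq_iff_of_no_root[OF q] by (auto simp: F_def ps_def prod_list_zero_iff)
  \<comment> \<open>By nondegeneracy \<open>e\<close> and \<open>e0\<close> differ in the weight of
    some generator, and the eigenvalue of \<open>e\<close> there is in the list.\<close>
  have F: "F e = 0" if e: "e \<in> box d" "e \<noteq> e0" for e
  proof -
    obtain k where k: "k \<in> set ks" "weight k e \<noteq> weight k e0"
      using weight_inj[OF e(1) assms(1)] e(2) by blast
    have "\<bar>weight k e\<bar> \<le> B"
      unfolding B_def by (rule abs_weight_le[OF e(1) k(1)])
    then have "(k, q powi weight k e) \<in> set ps"
      using k by (force simp: ps_def)
    then show ?thesis
      by (force simp: F_def prod_list_zero_iff)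
  qed
  have "(\<Sum>e\<in>box d. scale (\<alpha> e * F e) (1 * monom e * t)) \<in> J"
    unfolding F_def t_def by (rule kill_weights[OF fst_ps len *]) auto
  also have "(\<Sum>e\<in>box d. scale (\<alpha> e * F e) (1 * monom e * t)) = scale (\<alpha> e0 * F e0) (monom e0 * t)"
    using assms(1) F finite_box by (subst sum.remove[of _ e0]) (auto intro!: sum.neutral)
  finally have "monom e0 * t \<in> J"
    using J_scale_iff F0 assms(2) by simp
  moreover have "monom e0 \<in> words (length ks * d)"
    using assms(1) by (intro monom_in_words) (auto simp: box_def)
  moreover have "t \<in> words (length ps)"
    using fst_ps by (auto simp: t_def words_def intro!: exI[of _ "rev (map fst ps)"])
  ultimately have "monom e0 * t \<in> J" "monom e0 * t \<in> words (length ks * d + length ps)"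
    by (simp_all add: words_mult)
  then obtain xs where xs: "set xs \<subseteq> set ks" "prod_list (map gen xs) \<in> J"
    unfolding words_def by fastforce
  from words_notin_J[OF xs(1)] xs(2) show False
    by (rule notE)
qed

text \<open>
  By the previous lemma the span of the monomials in a box embeds into the linear maps
  from one finite-dimensional space of words modulo \<open>J\<close> to another.
\<close>

theorem Bernstein_inequality:
  assumes D: "\<And>B. B \<subseteq> words (radius d + length ks * d) \<Longrightarrow> indep_mod B \<Longrightarrow> card B \<le> D"
  shows "(d + 1) ^ length ks \<le> D * D"
proof (rule ccontr)
  assume *: "\<not> ?thesis"
  let ?r = "radius d" and ?s = "radius d + length ks * d"
  obtain B where B: "B \<subseteq> words ?r" "indep_mod B"
    "\<forall>w\<in>words ?r. \<exists>\<beta>. w - (\<Sum>b\<in>B. scale (\<beta> b) b) \<in> J"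
    by (rule ex_indep_mod_spanning[OF finite_words])
  obtain B' where B': "B' \<subseteq> words ?s" "indep_mod B'"
    "\<forall>w\<in>words ?s. \<exists>\<beta>. w - (\<Sum>b\<in>B'. scale (\<beta> b) b) \<in> J"
    by (rule ex_indep_mod_spanning[OF finite_words])
  have fin: "finite B" "finite B'"
    using B(1) B'(1) finite_words finite_subset by blast+
  have "card B \<le> D" "card B' \<le> D"
    using D B B' words_mono[of ?r ?s] by auto
  then have "card (B \<times> B') < card (box d)"
    using * by (simp add: card_cartesian_product card_box) (meson mult_le_mono not_le order_trans)
  \<comment> \<open>The matrix, with respect to \<open>B\<close> and \<open>B'\<close>, of right
    multiplication by \<open>monom e\<close> modulo \<open>J\<close>.\<close>
  define C where "C = (\<lambda>b e. SOME \<beta>. b * monom e - (\<Sum>b'\<in>B'. scale (\<beta> b') b') \<in> J)"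
  have ex: "\<exists>\<beta>. b * monom e - (\<Sum>b'\<in>B'. scale (\<beta> b') b') \<in> J" if "b \<in> B" "e \<in> box d" for b e
    using that B(1) by (intro B'(3)[rule_format] words_mult monom_in_words) (auto simp: box_def)
  have C: "b * monom e - (\<Sum>b'\<in>B'. scale (C b e b') b') \<in> J" if "b \<in> B" "e \<in> box d" for b e
    unfolding C_def by (rule someI_ex[OF ex[OF that]])
  have "finite (B \<times> B')"
    using fin by simp
  \<comment> \<open>There are fewer matrix entries than monomials in the box, so some nontrivial
    combination of monomials has the zero matrix.\<close>
  from ex_nontrivial_solution[OF this finite_box \<open>card (B \<times> B') < card (box d)\<close>,
      of "\<lambda>p e. C (fst p) e (snd p)"]
  obtain \<alpha> where \<alpha>: "\<exists>e\<in>box d. \<alpha> e \<noteq> 0"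
    "\<forall>p\<in>B \<times> B'. (\<Sum>e\<in>box d. \<alpha> e * C (fst p) e (snd p)) = 0"
    by (elim exE conjE)
  have J1: "(\<Sum>e\<in>box d. scale (\<alpha> e) (b * monom e)) \<in> J" if b: "b \<in> B" for b
  proof -
    have "(\<Sum>e\<in>box d. scale (\<alpha> e) (b * monom e - (\<Sum>b'\<in>B'. scale (C b e b') b'))) \<in> J"
      using C[OF b] by (intro J_sum J_scale)
    also have "(\<Sum>e\<in>box d. scale (\<alpha> e) (b * monom e - (\<Sum>b'\<in>B'. scale (C b e b') b'))) =
        (\<Sum>e\<in>box d. scale (\<alpha> e) (b * monom e)) -
        (\<Sum>e\<in>box d. \<Sum>b'\<in>B'. scale (\<alpha> e * C b e b') b')"
      by (simp add: free_alg.scale_right_diff_distrib sum_subtractf free_alg.scale_sum_right)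
    also have "(\<Sum>e\<in>box d. \<Sum>b'\<in>B'. scale (\<alpha> e * C b e b') b') =
        (\<Sum>b'\<in>B'. scale (\<Sum>e\<in>box d. \<alpha> e * C b e b') b')"
      by (subst sum.swap) (simp add: free_alg.scale_sum_left)
    also have "\<dots> = 0"
      using \<alpha>(2) b by simp
    finally show ?thesis
      by simp
  qed
  \<comment> \<open>Modulo \<open>J\<close> the word \<open>w\<close> is a combination of
    \<open>B\<close>, and right multiplication by the combination of monomials keeps the difference
    in \<open>J\<close>. The relation thus passes from \<open>B\<close> to all words, against
    \<open>monoms_separated\<close>.\<close>
  have "(\<Sum>e\<in>box d. scale (\<alpha> e) (w * monom e)) \<in> J" if "w \<in> words ?r" for w
  proof -
    from B(3)[rule_format, OF that]
    obtain \<beta> where \<beta>: "w - (\<Sum>b\<in>B. scale (\<beta> b) b) \<in> J"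
      by (rule exE)
    have "(w - (\<Sum>b\<in>B. scale (\<beta> b) b)) * (\<Sum>e\<in>box d. scale (\<alpha> e) (monom e)) +
        (\<Sum>b\<in>B. scale (\<beta> b) (\<Sum>e\<in>box d. scale (\<alpha> e) (b * monom e))) \<in> J"
      by (intro J_add J_mult_right[OF \<beta>] J_sum J_scale[OF J1])
    also have "(\<Sum>b\<in>B. scale (\<beta> b) (\<Sum>e\<in>box d. scale (\<alpha> e) (b * monom e))) =
        (\<Sum>b\<in>B. scale (\<beta> b) b) * (\<Sum>e\<in>box d. scale (\<alpha> e) (monom e))"
      by (simp add: sum_distrib_left sum_distrib_right scale_mult_left[symmetric]
          scale_mult_right[symmetric] free_alg.scale_sum_right sum.swap[of _ B] mult.commute)
    finally show ?thesis
      by (simp add: left_diff_distrib sum_distrib_left scale_mult_right sum_subtractf)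
  qed
  moreover obtain e0 where "e0 \<in> box d" "\<alpha> e0 \<noteq> 0"
    using \<alpha>(1) by (rule bexE)
  ultimately show False
    using monoms_separated[of e0 d \<alpha>] by simp
qed

end

section \<open>Relations in quantum Heisenberg space\<close>

lemma Kn_relations_carrier: "Kn_relations n p q \<gamma> \<subseteq> carrier (free_algebra (gens n))"
  unfolding Kn_relations_def Let_def
  by (auto simp: carrier_free_algebra proj_alg_minus proj_alg_mult proj_alg_scale proj_alg_sum proj_alg_var)

lemma ideal_Kn_ideal: "ideal (Kn_ideal n p q \<gamma>) (free_algebra (gens n))"
  unfolding Kn_ideal_def by (rule ring.genideal_ideal[OF ring_free_algebra Kn_relations_carrier])

lemma Kn_relations_subset: "Kn_relations n p q \<gamma> \<subseteq> Kn_ideal n p q \<gamma>"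
  unfolding Kn_ideal_def by (rule ring.genideal_self[OF ring_free_algebra Kn_relations_carrier])

locale heisenberg =
  fixes n :: nat and q :: "'k::field"
  assumes q: "q \<noteq> 0" "\<forall>k::nat. k > 0 \<longrightarrow> q ^ k \<noteq> 1"
begin

definition generators :: "gen set"
  where "generators = gens n"

definition relation_ideal :: "(gen, 'k) free_alg set"
  where "relation_ideal = Kn_ideal n (\<lambda>_. q\<^sup>2) (\<lambda>_. 1) (heisenberg_gamma q)"

sublocale presented_algebra generators relation_ideal
  unfolding generators_def relation_ideal_def by (intro presented_algebra.intro ideal_Kn_ideal)

notation cong (infix \<open>\<approx>\<close> 50)

lemma A_eq: "A = quantum_heisenberg n q"
  unfolding A_def
  unfolding quantum_heisenberg_def Kn_def generators_def relation_ideal_def ..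

definition x :: "nat \<Rightarrow> (gen, 'k) free_alg" where "x i = var (X i)"
definition y :: "nat \<Rightarrow> (gen, 'k) free_alg" where "y i = var (Y i)"
definition z :: "nat \<Rightarrow> (gen, 'k) free_alg"
  where "z i = (\<Sum>l = 1..i. scale (1 - q\<^sup>2) (y l * x l))"

lemma one_minus_q2: "1 - q\<^sup>2 \<noteq> 0"
  using q(2) by auto

lemma relation_in_N:
  assumes "f \<in> Kn_relations n (\<lambda>_. q\<^sup>2) (\<lambda>_. 1) (heisenberg_gamma q)" shows "f \<in> N"
proof -
  have "proj_alg generators f = f" "f \<in> relation_ideal"
    using assms Kn_relations_carrier Kn_relations_subset unfolding relation_ideal_def generators_def
    by (blast intro: carrier_free_algebra[THEN iffD1])+
  then show ?thesis
    by (simp add: N_def)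
qed

lemma z_0 [simp]: "z 0 = 0"
  by (simp add: z_def)

lemma z_Suc: "z (Suc i) = z i + scale (1 - q\<^sup>2) (y (Suc i) * x (Suc i))"
  by (simp add: z_def)

lemma xx:
  assumes "1 \<le> i" "i < j" "j \<le> n" shows "scomm (inverse q) (x i) (x j)"
proof -
  have "x i * x j - scale (1 * inverse (q\<^sup>2) * heisenberg_gamma q i j) (x j * x i) \<in> N"
    by (rule relation_in_N) (use assms in \<open>auto simp: Kn_relations_def x_def\<close>)
  then show ?thesis
    using assms q(1) by (simp add: scomm_def cong_def heisenberg_gamma_def power2_eq_square mult.assoc)
qed

lemma yy:
  assumes "1 \<le> i" "i < j" "j \<le> n" shows "scomm q (y i) (y j)"
proof -
  have "y i * y j - scale (heisenberg_gamma q i j) (y j * y i) \<in> N"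
    by (rule relation_in_N) (use assms in \<open>auto simp: Kn_relations_def y_def\<close>)
  then show ?thesis
    using assms q(1) by (simp add: scomm_def cong_def heisenberg_gamma_def)
qed

text \<open>The two defining relations give the same factor: \<open>q\<^sup>2 * inverse q\<close>
  for \<open>i < j\<close> and \<open>inverse (inverse q)\<close> for \<open>i > j\<close>.\<close>

lemma xy:
  assumes "i \<in> {1..n}" "j \<in> {1..n}" "i \<noteq> j" shows "scomm q (x i) (y j)"
proof (cases "i < j")
  case True
  have "x i * y j - scale (q\<^sup>2 * inverse (heisenberg_gamma q i j)) (y j * x i) \<in> N"
    by (rule relation_in_N) (use assms True in \<open>auto simp: Kn_relations_def x_def y_def\<close>)
  then show ?thesis
    using assms q(1) True by (simp add: scomm_def cong_def heisenberg_gamma_def power2_eq_square mult.assoc)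
next
  case False
  have "x i * y j - scale (1 * inverse (heisenberg_gamma q i j)) (y j * x i) \<in> N"
    unfolding x_def y_def
    by (rule relation_in_N, unfold Kn_relations_def Let_def, rule UnI1, rule UnI2, rule CollectI,
        rule exI[of _ i], rule exI[of _ j], use assms False in auto)
  then show ?thesis
    using assms q(1) False by (simp add: scomm_def cong_def heisenberg_gamma_def)
qed

lemma xy_same:
  assumes "Suc i \<le> n" shows "x (Suc i) * y (Suc i) \<approx> y (Suc i) * x (Suc i) + z i"
proof -
  have "x (Suc i) * y (Suc i) - scale 1 (y (Suc i) * x (Suc i)) -
      (\<Sum>l = 1..<Suc i. scale (1 - q\<^sup>2) (y l * x l)) \<in> N"
    unfolding x_def y_def
    by (rule relation_in_N, unfold Kn_relations_def Let_def, rule UnI2, rule CollectI,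
        rule exI[of _ "Suc i"], use assms in auto)
  also have "{1..<Suc i} = {1..i}"
    by auto
  finally show ?thesis
    unfolding cong_def z_def by (simp add: diff_diff_eq)
qed

lemma yx:
  assumes "i \<in> {1..n}" "j \<in> {1..n}" "i \<noteq> j" shows "scomm (inverse q) (y i) (x j)"
  using scomm_sym[OF xy[OF assms(2,1)]] assms q(1) by auto

lemma xx':
  assumes "1 \<le> j" "j < i" "i \<le> n" shows "scomm q (x i) (x j)"
  using scomm_sym[OF xx[OF assms]] q(1) by auto

lemma yy':
  assumes "1 \<le> j" "j < i" "i \<le> n" shows "scomm (inverse q) (y i) (y j)"
  using scomm_sym[OF yy[OF assms]] q(1) by auto

text \<open>Here and in the next three lemmas, the factors contributed by \<open>y l\<close> and
  \<open>x l\<close> reinforce each other for \<open>l < j\<close> and cancel for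
  \<open>l > j\<close>. This is why \<open>z i\<close> commutes with every generator of index at
  most \<open>i\<close>.\<close>

lemma yx_x_less:
  assumes "1 \<le> l" "l < j" "j \<le> n" shows "scomm (q powi -2) (y l * x l) (x j)"
  using scomm_mult_left[OF yx[of l j] xx[of l j]] assms
  by (simp add: power_int_minus power2_eq_square)

lemma yx_y_less:
  assumes "1 \<le> l" "l < j" "j \<le> n" shows "scomm (q powi 2) (y l * x l) (y j)"
  using scomm_mult_left[OF yy[of l j] xy[of l j]] assms
  by (simp add: power2_eq_square)

lemma yx_x_greater:
  assumes "1 \<le> j" "j < l" "l \<le> n" shows "scomm 1 (y l * x l) (x j)"
  using scomm_mult_left[OF yx[of l j] xx'[of j l]] assms q(1) by simp

lemma yx_y_greater:
  assumes "1 \<le> j" "j < l" "l \<le> n" shows "scomm 1 (y l * x l) (y j)"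
  using scomm_mult_left[OF yy'[of j l] xy[of l j]] assms q(1) by simp

lemma z_x_less:
  assumes "i < j" "j \<le> n" shows "scomm (q powi -2) (z i) (x j)"
  unfolding z_def using assms by (intro scomm_sum_left scomm_scale_left yx_x_less) auto

lemma z_y_less:
  assumes "i < j" "j \<le> n" shows "scomm (q powi 2) (z i) (y j)"
  unfolding z_def using assms by (intro scomm_sum_left scomm_scale_left yx_y_less) auto

text \<open>The diagonal relation has an error term \<open>z i\<close>, and it is exactly what is
  missing: moving \<open>x (Suc i)\<close> past \<open>z i\<close> gives \<open>q\<^sup>2\<close>,
  the error term adds \<open>1 - q\<^sup>2\<close>, and the sum is 1.\<close>

lemma z_x_same:
  assumes "Suc i \<le> n" shows "scomm 1 (z (Suc i)) (x (Suc i))"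
proof -
  let ?x = "x (Suc i)" and ?y = "y (Suc i)" and ?s = "1 - q\<^sup>2"
  have "?x * z i \<approx> scale (q\<^sup>2) (z i * ?x)"
    using scomm_sym[OF z_x_less[of i "Suc i"]] assms q(1)
    by (simp add: scomm_def power_int_minus)
  moreover have "scale ?s (?x * ?y * ?x) \<approx> scale ?s ((?y * ?x + z i) * ?x)"
    by (intro cong_scale cong_mult_right xy_same assms)
  ultimately have "?x * z i + scale ?s (?x * ?y * ?x) \<approx>
      scale (q\<^sup>2) (z i * ?x) + scale ?s ((?y * ?x + z i) * ?x)"
    by (rule cong_add)
  also have "\<dots> = z i * ?x + scale ?s (?y * ?x * ?x)"
    by (simp add: distrib_right free_alg.scale_right_distrib free_alg.scale_left_diff_distrib)
  finally have "?x * z (Suc i) \<approx> z (Suc i) * ?x"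
    by (simp add: z_Suc distrib_left distrib_right scale_mult_left[symmetric] scale_mult_right[symmetric] mult.assoc)
  then show ?thesis
    by (simp add: scomm_def cong_sym)
qed

lemma z_y_same:
  assumes "Suc i \<le> n" shows "scomm 1 (z (Suc i)) (y (Suc i))"
proof -
  let ?x = "x (Suc i)" and ?y = "y (Suc i)" and ?s = "1 - q\<^sup>2"
  have "z i * ?y \<approx> scale (q\<^sup>2) (?y * z i)"
    using z_y_less[of i "Suc i"] assms by (simp add: scomm_def)
  moreover have "scale ?s (?y * (?x * ?y)) \<approx> scale ?s (?y * (?y * ?x + z i))"
    by (intro cong_scale cong_mult_left xy_same assms)
  ultimately have "z i * ?y + scale ?s (?y * (?x * ?y)) \<approx>
      scale (q\<^sup>2) (?y * z i) + scale ?s (?y * (?y * ?x + z i))"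
    by (rule cong_add)
  also have "\<dots> = ?y * z i + scale ?s (?y * (?y * ?x))"
    by (simp add: distrib_left free_alg.scale_right_distrib free_alg.scale_left_diff_distrib)
  finally show ?thesis
    by (simp add: scomm_def z_Suc distrib_left distrib_right scale_mult_left[symmetric]
        scale_mult_right[symmetric] mult.assoc)
qed

lemma z_split: "j \<le> i \<Longrightarrow> z i = z j + (\<Sum>l = Suc j..i. scale (1 - q\<^sup>2) (y l * x l))"
  using sum.ub_add_nat[of 1 j "\<lambda>l. scale (1 - q\<^sup>2) (y l * x l)" "i - j"] by (simp add: z_def)

lemma z_x: "j \<in> {1..n} \<Longrightarrow> i \<le> n \<Longrightarrow> scomm (q powi (if i < j then -2 else 0)) (z i) (x j)"
proof (cases "i < j")
  case False
  assume *: "j \<in> {1..n}" "i \<le> n"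
  then obtain k where k: "j = Suc k"
    by (cases j) auto
  have "scomm 1 (z j + (\<Sum>l = Suc j..i. scale (1 - q\<^sup>2) (y l * x l))) (x j)"
    using * z_x_same[of k] unfolding k
    by (intro scomm_add_left scomm_sum_left scomm_scale_left yx_x_greater) auto
  then show ?thesis
    using False by (simp flip: z_split)
qed (use z_x_less in auto)

lemma z_y: "j \<in> {1..n} \<Longrightarrow> i \<le> n \<Longrightarrow> scomm (q powi (if i < j then 2 else 0)) (z i) (y j)"
proof (cases "i < j")
  case False
  assume *: "j \<in> {1..n}" "i \<le> n"
  then obtain k where k: "j = Suc k"
    by (cases j) auto
  have "scomm 1 (z j + (\<Sum>l = Suc j..i. scale (1 - q\<^sup>2) (y l * x l))) (y j)"
    using * z_y_same[of k] unfolding k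
    by (intro scomm_add_left scomm_sum_left scomm_scale_left yx_y_greater) auto
  then show ?thesis
    using False by (simp flip: z_split)
qed (use z_y_less in auto)

lemma zz:
  assumes "i \<le> n" "j \<le> n" shows "scomm 1 (z i) (z j)"
proof -
  have "scomm 1 (z i) (y l * x l)" if "l \<in> {1..n}" for l
    using scomm_mult_right[OF z_y[OF that assms(1)] z_x[OF that assms(1)]] q(1)
    by (auto simp: power_int_minus split: if_splits)
  then have "scomm 1 (y l * x l) (z i)" if "l \<in> {1..n}" for l
    using scomm_sym that by fastforce
  then have "scomm 1 (z j) (z i)"
    unfolding z_def[of j] using assms by (intro scomm_sum_left scomm_scale_left) auto
  then show ?thesis
    using scomm_sym by fastforce
qed

lemma y_mult_x: "i \<ge> 1 \<Longrightarrow> y i * x i = scale (inverse (1 - q\<^sup>2)) (z i - z (i - 1))"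
  using one_minus_q2 z_Suc[of "i - 1"] by simp

text \<open>Compared with \<open>y_mult_x\<close>, only the coefficient of \<open>z (i - 1)\<close>
  changes, from 1 to \<open>q\<^sup>2\<close>. This discrepancy is what later prevents powers of
  \<open>x i\<close> and of \<open>y i\<close> from both killing a vector.\<close>

lemma x_mult_y:
  assumes "i \<in> {1..n}"
  shows "x i * y i \<approx> scale (inverse (1 - q\<^sup>2)) (z i - scale (q\<^sup>2) (z (i - 1)))"
proof -
  have "x i * y i \<approx> y i * x i + z (i - 1)"
    using xy_same[of "i - 1"] assms by simp
  also have "y i * x i + z (i - 1) =
      scale (inverse (1 - q\<^sup>2)) (z i - z (i - 1) + scale (1 - q\<^sup>2) (z (i - 1)))"
    using assms one_minus_q2 by (simp add: y_mult_x free_alg.scale_right_distrib)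
  also have "z i - z (i - 1) + scale (1 - q\<^sup>2) (z (i - 1)) = z i - scale (q\<^sup>2) (z (i - 1))"
    by (simp add: free_alg.scale_left_diff_distrib)
  finally show ?thesis .
qed

end

section \<open>Spanning monomials\<close>

definition var_words :: "'g set \<Rightarrow> nat \<Rightarrow> ('g, 'k::field) free_alg set"
  where "var_words G d = {prod_list (map var ls) | ls. set ls \<subseteq> G \<and> length ls \<le> d}"

lemma prod_list_var: "prod_list (map var ls) = Poly_Mapping.single (Free_Word ls) 1"
proof (induction ls)
  case Nil
  then show ?case
    by (simp flip: single_one add: zero_free_word_def)
next
  case (Cons l ls)
  then show ?case
    by (simp add: var_def mult_single plus_free_word_def)
qed

lemma finite_var_words:
  assumes "finite G" shows "finite (var_words G d :: ('g, 'k::field) free_alg set)"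
proof -
  have "(var_words G d :: ('g, 'k) free_alg set) =
      (\<lambda>ls. prod_list (map var ls)) ` {ls. set ls \<subseteq> G \<and> length ls \<le> d}"
    by (auto simp: var_words_def)
  then show ?thesis
    using assms by (simp add: finite_lists_length_le)
qed

lemma var_words_mono: "d \<le> e \<Longrightarrow> var_words G d \<subseteq> var_words G e"
  by (fastforce simp: var_words_def)

lemma one_in_var_words: "1 \<in> var_words G d"
  by (auto simp: var_words_def intro!: exI[of _ "[]"])

lemma var_in_var_words: "g \<in> G \<Longrightarrow> var g \<in> var_words G 1"
  by (auto simp: var_words_def intro!: exI[of _ "[g]"])

lemma var_words_mult: "v \<in> var_words G d \<Longrightarrow> w \<in> var_words G e \<Longrightarrow> v * w \<in> var_words G (d + e)"
proof -
  assume "v \<in> var_words G d" "w \<in> var_words G e"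
  then obtain ks ls where "v = prod_list (map var ks)" "set ks \<subseteq> G" "length ks \<le> d"
    "w = prod_list (map var ls)" "set ls \<subseteq> G" "length ls \<le> e"
    by (auto simp: var_words_def)
  then show ?thesis
    by (auto simp: var_words_def intro!: exI[of _ "ks @ ls"])
qed

lemma span_var_words_mult:
  assumes "f \<in> free_alg.span (var_words G d)" "g \<in> free_alg.span (var_words G e)"
  shows "f * g \<in> free_alg.span (var_words G (d + e))"
  using assms(1)
proof (induction rule: free_alg.span_induct_alt)
  case base
  then show ?case
    by (simp add: free_alg.span_zero)
next
  case (step c v f)
  have "v * g \<in> free_alg.span (var_words G (d + e))"
    using assms(2)
  proof (induction rule: free_alg.span_induct_alt)
    case base
    then show ?case
      by (simp add: free_alg.span_zero)
  next
    case (step a w h)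
    then have "scale a (v * w) + v * h \<in> free_alg.span (var_words G (d + e))"
      using var_words_mult[OF \<open>v \<in> var_words G d\<close> step.hyps(1)]
      by (intro free_alg.span_add[OF free_alg.span_scale[OF free_alg.span_base]])
    then show ?case
      by (simp add: distrib_left scale_mult_right)
  qed
  then have "scale c (v * g) + f * g \<in> free_alg.span (var_words G (d + e))"
    using step.IH by (intro free_alg.span_add[OF free_alg.span_scale])
  then show ?case
    by (simp add: distrib_right scale_mult_left)
qed

lemma proj_alg_in_span_var_words: "\<exists>d. proj_alg G f \<in> free_alg.span (var_words G d)"
proof -
  let ?K = "Poly_Mapping.keys (proj_alg G f)"
  define d where "d = Max (insert 0 ((\<lambda>w. length (letters w)) ` ?K))"
  have "Poly_Mapping.single w (Poly_Mapping.lookup (proj_alg G f) w) \<in> free_alg.span (var_words G d)"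
    if w: "w \<in> ?K" for w
  proof -
    have "Poly_Mapping.single w (Poly_Mapping.lookup (proj_alg G f) w) =
        scale (Poly_Mapping.lookup (proj_alg G f) w) (prod_list (map var (letters w)))"
      by (simp add: prod_list_var scale_eq mult_single)
    moreover have "set (letters w) \<subseteq> G"
      using w by (auto simp: in_keys_iff lookup_proj_alg when_def split: if_splits)
    moreover have "length (letters w) \<le> d"
      unfolding d_def using w by (intro Max_ge) auto
    ultimately show ?thesis
      using free_alg.span_scale[OF free_alg.span_base[of "prod_list (map var (letters w))" "var_words G d"]]
      by (auto simp: var_words_def)
  qed
  then have "proj_alg G f \<in> free_alg.span (var_words G d)"
    by (subst poly_mapping_eq_sum_single) (rule free_alg.span_sum)
  then show ?thesis
    by blast
qed

section \<open>Reduction of words to monomials in the \<open>z i\<close> and one of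
  \<open>x j\<close>, \<open>y j\<close> for each \<open>j\<close>\<close>

context heisenberg
begin

text \<open>A signed exponent encodes a power of \<open>x j\<close> or of \<open>y j\<close>; mixed
  products of the two do not occur, since they reduce to \<open>z j\<close> and
  \<open>z (j - 1)\<close>.\<close>

definition U :: "nat \<Rightarrow> int \<Rightarrow> (gen, 'k) free_alg"
  where "U j b = (if b \<ge> 0 then x j ^ nat b else y j ^ nat (- b))"

definition z_monom :: "(nat \<Rightarrow> nat) \<Rightarrow> (gen, 'k) free_alg"
  where "z_monom a = prod_list (map (\<lambda>i. z i ^ a i) [1..<Suc n])"

definition zU_monom :: "(nat \<Rightarrow> nat) \<Rightarrow> (nat \<Rightarrow> int) \<Rightarrow> (gen, 'k) free_alg"
  where "zU_monom a b = z_monom a * prod_list (map (\<lambda>j. U j (b j)) [1..<Suc n])"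

definition zU_monoms :: "nat \<Rightarrow> (gen, 'k) free_alg set"
  where "zU_monoms d = (\<lambda>(a, b). zU_monom a b) `
    (({1..n} \<rightarrow>\<^sub>E {..d}) \<times> ({1..n} \<rightarrow>\<^sub>E {- int d..int d}))"

lemma finite_zU_monoms: "finite (zU_monoms d)"
  by (auto simp: zU_monoms_def intro!: finite_imageI finite_cartesian_product finite_PiE)

lemma card_zU_monoms: "card (zU_monoms d) \<le> (2 * d + 1) ^ (2 * n)"
proof -
  have "card (zU_monoms d) \<le> card (({1..n} \<rightarrow>\<^sub>E {..d}) \<times> ({1..n} \<rightarrow>\<^sub>E {- int d..int d}))"
    unfolding zU_monoms_def
    by (intro card_image_le finite_cartesian_product finite_PiE) auto
  also have "\<dots> = (d + 1) ^ n * (2 * d + 1) ^ n"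
    by (simp add: card_cartesian_product card_PiE nat_add_distrib nat_mult_distrib)
  also have "\<dots> \<le> (2 * d + 1) ^ n * (2 * d + 1) ^ n"
    by (intro mult_right_mono power_mono) auto
  finally show ?thesis
    by (simp add: mult_2 power_add)
qed

lemma zU_monom_in:
  assumes "\<And>i. i \<in> {1..n} \<Longrightarrow> a i \<le> d" "\<And>i. i \<in> {1..n} \<Longrightarrow> \<bar>b i\<bar> \<le> int d"
  shows "zU_monom a b \<in> zU_monoms d"
proof -
  have "zU_monom a b = zU_monom (restrict a {1..n}) (restrict b {1..n})"
    unfolding zU_monom_def z_monom_def
    by (intro arg_cong2[of _ _ _ _ "(*)"] arg_cong[of _ _ prod_list] map_cong) auto
  moreover have "\<dots> \<in> zU_monoms d"
    unfolding zU_monoms_def using assms by (intro image_eqI[of _ _ "(restrict a {1..n}, restrict b {1..n})"])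
      (auto simp: abs_le_iff minus_le_iff)
  ultimately show ?thesis
    by simp
qed

lemma qcomm_z_x: "i \<le> n \<Longrightarrow> j \<in> {1..n} \<Longrightarrow> qcomm (z i) (x j)"
  using qcommI[OF z_x] q(1) by simp

lemma qcomm_z_y: "i \<le> n \<Longrightarrow> j \<in> {1..n} \<Longrightarrow> qcomm (z i) (y j)"
  using qcommI[OF z_y] q(1) by simp

lemma qcomm_z_z: "i \<le> n \<Longrightarrow> j \<le> n \<Longrightarrow> qcomm (z i) (z j)"
  using qcommI[OF zz] by simp

lemma qcomm_x_x: "i \<in> {1..n} \<Longrightarrow> j \<in> {1..n} \<Longrightarrow> qcomm (x i) (x j)"
  using qcommI[OF xx[of i j]] qcommI[OF xx'[of j i]] qcommI[OF scomm_refl[of "x i"]] q(1)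
  by (cases i j rule: linorder_cases) auto

lemma qcomm_y_y: "i \<in> {1..n} \<Longrightarrow> j \<in> {1..n} \<Longrightarrow> qcomm (y i) (y j)"
  using qcommI[OF yy[of i j]] qcommI[OF yy'[of j i]] qcommI[OF scomm_refl[of "y i"]] q(1)
  by (cases i j rule: linorder_cases) auto

lemma qcomm_x_y: "i \<in> {1..n} \<Longrightarrow> j \<in> {1..n} \<Longrightarrow> i \<noteq> j \<Longrightarrow> qcomm (x i) (y j)"
  using qcommI[OF xy] q(1) by simp

lemma qcomm_y_x: "i \<in> {1..n} \<Longrightarrow> j \<in> {1..n} \<Longrightarrow> i \<noteq> j \<Longrightarrow> qcomm (y i) (x j)"
  using qcommI[OF yx] q(1) by simp

lemma qcomm_z_U: "i \<le> n \<Longrightarrow> j \<in> {1..n} \<Longrightarrow> qcomm (z i) (U j b)"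
  by (auto simp: U_def intro!: qcomm_power_right qcomm_z_x qcomm_z_y)

lemma qcomm_x_U: "i \<in> {1..n} \<Longrightarrow> j \<in> {1..n} \<Longrightarrow> i \<noteq> j \<Longrightarrow> qcomm (x i) (U j b)"
  by (auto simp: U_def intro!: qcomm_power_right qcomm_x_x qcomm_x_y)

lemma qcomm_y_U: "i \<in> {1..n} \<Longrightarrow> j \<in> {1..n} \<Longrightarrow> i \<noteq> j \<Longrightarrow> qcomm (y i) (U j b)"
  by (auto simp: U_def intro!: qcomm_power_right qcomm_y_x qcomm_y_y)

lemma scomm_1_power: "scomm 1 f g \<Longrightarrow> scomm 1 f (g ^ m)"
  by (induction m) (use scomm_mult_right[of 1 f g 1] in \<open>auto simp: scomm_def\<close>)

lemma z_mult_z_monom: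
  assumes "m \<in> {1..n}"
  shows "z m * z_monom a \<approx> z_monom (a(m := Suc (a m)))"
proof -
  have "z m * prod_list (map (\<lambda>i. z i ^ a i) ls) \<approx> prod_list (map (\<lambda>i. z i ^ (a(m := Suc (a m))) i) ls)"
    if "distinct ls" "m \<in> set ls" "set ls \<subseteq> {1..n}" for ls
    using that
  proof (induction ls)
    case (Cons l ls)
    show ?case
    proof (cases "l = m")
      case True
      then have "prod_list (map (\<lambda>i. z i ^ (a(m := Suc (a m))) i) ls) = prod_list (map (\<lambda>i. z i ^ a i) ls)"
        using Cons.prems by (intro arg_cong[of _ _ prod_list] map_cong) auto
      then show ?thesis
        using True by (simp del: fun_upd_apply map_eq_conv add: fun_upd_same mult.assoc)
    next
      case False
      let ?p = "prod_list (map (\<lambda>i. z i ^ a i) ls)"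
      have "z m * z l ^ a l \<approx> z l ^ a l * z m"
        using scomm_1_power[OF zz[of m l], of "a l"] Cons.prems assms by (simp add: scomm_def)
      from cong_mult_right[OF this, of ?p]
      have "z m * (z l ^ a l * ?p) \<approx> z l ^ a l * (z m * ?p)"
        by (simp add: mult.assoc)
      also have "\<dots> \<approx> z l ^ a l * prod_list (map (\<lambda>i. z i ^ (a(m := Suc (a m))) i) ls)"
        using Cons.prems False by (intro cong_mult_left Cons.IH) auto
      finally show ?thesis
        using False by simp
    qed
  qed simp
  from this[of "[1..<Suc n]", unfolded set_upt atLeastLessThanSuc_atLeastAtMost,
      OF distinct_upt assms order_refl]
  show ?thesis
    by (simp only: z_monom_def)
qed

definition S :: "nat \<Rightarrow> (gen, 'k) free_alg set"
  where "S d = {f. \<exists>g\<in>free_alg.span (zU_monoms d). f \<approx> g}"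

lemma S_cong: "f \<approx> g \<Longrightarrow> g \<in> S d \<Longrightarrow> f \<in> S d"
  by (auto simp: S_def intro: cong_trans)

lemma S_add: "f \<in> S d \<Longrightarrow> g \<in> S d \<Longrightarrow> f + g \<in> S d"
  by (auto simp: S_def intro: cong_add free_alg.span_add)

lemma S_scale: "f \<in> S d \<Longrightarrow> scale c f \<in> S d"
  by (auto simp: S_def intro: cong_scale free_alg.span_scale)

lemma S_zero: "0 \<in> S d"
  by (auto simp: S_def intro!: bexI[of _ 0] free_alg.span_zero)

lemma zU_monom_in_S:
  assumes "\<And>i. i \<in> {1..n} \<Longrightarrow> a i \<le> d" "\<And>i. i \<in> {1..n} \<Longrightarrow> \<bar>b i\<bar> \<le> int d"
  shows "zU_monom a b \<in> S d"
  using zU_monom_in[OF assms] by (auto simp: S_def intro!: bexI[of _ "zU_monom a b"] free_alg.span_base)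

text \<open>Either the power grows by one, or an adjacent product \<open>y k * x k\<close> or
  \<open>x k * y k\<close> appears and is replaced by \<open>z k\<close> and
  \<open>z (k - 1)\<close>. The three coefficients cover both outcomes: \<open>r\<close> serves the
  first, \<open>c\<close> and \<open>d\<close> the second.\<close>

lemma U_mult_gen:
  assumes "k \<in> {1..n}" "g = x k \<or> g = y k"
  shows "\<exists>b' r c d. \<bar>b'\<bar> \<le> \<bar>b\<bar> + 1 \<and>
    U k b * g \<approx> scale r (U k b') + scale c (U k b' * z k) + scale d (U k b' * z (k - 1))"
proof -
  let ?s = "inverse (1 - q\<^sup>2)"
  consider "g = x k" "b \<ge> 0" | "g = x k" "b < 0" | "g = y k" "b \<le> 0" | "g = y k" "b > 0"
    using assms(2) by linarith
  then show ?thesis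
  proof cases
    case 1
    then have "U k b * g = U k (b + 1)"
      by (simp add: U_def nat_add_distrib power_commutes)
    then show ?thesis
      using 1 by (intro exI[of _ "b + 1"] exI[of _ 1] exI[of _ 0]) auto
  next
    case 2
    then obtain m where "b = - int (Suc m)"
      using negD by blast
    then have "U k b = U k (b + 1) * y k"
      by (cases m) (simp_all add: U_def mult.assoc power_commutes nat_add_distrib)
    then have "U k b * g = U k (b + 1) * (y k * x k)"
      using 2 by (simp add: mult.assoc)
    also have "\<dots> = scale ?s (U k (b + 1) * z k) + scale (- ?s) (U k (b + 1) * z (k - 1))"
      using assms(1) y_mult_x[of k]
      by (simp add: scale_mult_right[symmetric] right_diff_distrib free_alg.scale_right_diff_distrib)
    finally show ?thesis
      using 2 by (intro exI[of _ "b + 1"] exI[of _ 0] exI[of _ ?s] exI[of _ "- ?s"]) auto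
  next
    case 3
    then have "b = - int (nat (- b))"
      by simp
    then obtain m where "b = - int m" ..
    then have "U k b * g = U k (b - 1)"
      using 3 by (cases m) (simp_all add: U_def mult.assoc power_commutes nat_add_distrib)
    then show ?thesis
      using 3 by (intro exI[of _ "b - 1"] exI[of _ 1] exI[of _ 0]) auto
  next
    case 4
    then obtain m where "b = int (Suc m)"
      using pos_int_cases by (metis Suc_pred)
    then have "U k b = U k (b - 1) * x k"
      by (simp add: U_def mult.assoc power_commutes nat_add_distrib)
    then have "U k b * g = U k (b - 1) * (x k * y k)"
      using 4 by (simp add: mult.assoc)
    also have "\<dots> \<approx> U k (b - 1) * scale ?s (z k - scale (q\<^sup>2) (z (k - 1)))"
      using assms(1) x_mult_y[of k] by (intro cong_mult_left) auto
    also have "\<dots> = scale ?s (U k (b - 1) * z k) + scale (- ?s * q\<^sup>2) (U k (b - 1) * z (k - 1))"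
      by (simp add: scale_mult_right[symmetric] right_diff_distrib free_alg.scale_right_diff_distrib)
    finally show ?thesis
      using 4 by (intro exI[of _ "b - 1"] exI[of _ 0] exI[of _ ?s] exI[of _ "- ?s * q\<^sup>2"]) auto
  qed
qed

text \<open>\<open>g\<close> is moved left to the power with its own index and merged there, and any
  resulting \<open>z m\<close> is moved to the front. All moves cost only scalars, so each exponent
  grows by at most one.\<close>

lemma zU_monom_mult_gen:
  assumes k: "k \<in> {1..n}" "g = x k \<or> g = y k"
    and ab: "\<And>i. i \<in> {1..n} \<Longrightarrow> a i \<le> d" "\<And>i. i \<in> {1..n} \<Longrightarrow> \<bar>b i\<bar> \<le> int d"
  shows "zU_monom a b * g \<in> S (Suc d)"
proof -
  obtain b' r c e where b': "\<bar>b'\<bar> \<le> \<bar>b k\<bar> + 1"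
    "U k (b k) * g \<approx> scale r (U k b') + scale c (U k b' * z k) + scale e (U k b' * z (k - 1))"
    using U_mult_gen[OF k] by blast
  define l where "l = prod_list (map (\<lambda>j. U j (b j)) [1..<k])"
  define h where "h = prod_list (map (\<lambda>j. U j (b j)) [Suc k..<Suc n])"
  define b2 where "b2 = b(k := b')"
  have list: "[1..<Suc n] = [1..<k] @ k # [Suc k..<Suc n]"
    using k(1) upt_add_eq_append[of 1 k "Suc n - k"] by (simp add: upt_conv_Cons)
  have zU: "zU_monom a b = z_monom a * l * U k (b k) * h" for a
    unfolding zU_monom_def list l_def h_def by (simp add: mult.assoc)
  have "prod_list (map (\<lambda>j. U j (b2 j)) [1..<k]) = l"
    unfolding l_def b2_def by (intro arg_cong[of _ _ prod_list] map_cong) auto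
  moreover have "prod_list (map (\<lambda>j. U j (b2 j)) [Suc k..<Suc n]) = h"
    unfolding h_def b2_def by (intro arg_cong[of _ _ prod_list] map_cong) auto
  moreover have "b2 k = b'"
    by (simp add: b2_def)
  ultimately have zU2: "zU_monom a b2 = z_monom a * l * U k b' * h" for a
    unfolding zU_monom_def list by (simp only: map_append list.map prod_list.append prod_list.Cons mult.assoc)
  have b2_le: "\<bar>b2 i\<bar> \<le> int (Suc d)" if "i \<in> {1..n}" for i
    using ab(2)[OF that] b'(1) by (auto simp: b2_def)
  have "qcomm g h"
    unfolding h_def using k by (intro qcomm_prod_list) (auto intro!: qcomm_x_U qcomm_y_U)
  then obtain \<mu> where \<mu>: "scomm \<mu> h g"
    using qcomm_sym by (auto simp: qcomm_def)
  \<comment> \<open>For \<open>k = 1\<close> the index \<open>m = 0\<close> occurs, and that term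
    vanishes because \<open>z 0 = 0\<close>.\<close>
  have z_term: "z_monom a * l * U k b' * z m * h \<in> S (Suc d)" if "m = k \<or> m = k - 1" for m
  proof (cases "m = 0")
    case True
    then show ?thesis
      by (simp add: S_zero)
  next
    case False
    with that k(1) have m: "m \<in> {1..n}"
      by auto
    have "qcomm (z m) (z_monom a * l * U k b')"
      unfolding z_monom_def l_def using m k(1)
      by (intro qcomm_mult_right qcomm_prod_list)
        (auto intro!: qcomm_z_U qcomm_power_right qcomm_z_z)
    then obtain \<nu> where \<nu>: "z_monom a * l * U k b' * z m \<approx> scale \<nu> (z m * (z_monom a * l * U k b'))"
      using qcomm_sym by (auto simp: qcomm_def scomm_def)
    from cong_mult_right[OF this, of h]
    have "z_monom a * l * U k b' * z m * h \<approx> scale \<nu> (z m * z_monom a * (l * U k b' * h))"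
      by (simp add: scale_mult_left[symmetric] mult.assoc)
    also have "\<dots> \<approx> scale \<nu> (z_monom (a(m := Suc (a m))) * (l * U k b' * h))"
      by (intro cong_scale cong_mult_right z_mult_z_monom m)
    also have "z_monom (a(m := Suc (a m))) * (l * U k b' * h) = zU_monom (a(m := Suc (a m))) b2"
      by (simp add: zU2 mult.assoc)
    finally show ?thesis
      by (rule S_cong) (use ab(1) b2_le in \<open>auto intro!: S_scale zU_monom_in_S simp: le_SucI\<close>)
  qed
  have "zU_monom a b * g = z_monom a * l * U k (b k) * (h * g)"
    by (simp add: zU mult.assoc)
  also have "\<dots> \<approx> z_monom a * l * U k (b k) * scale \<mu> (g * h)"
    using \<mu> by (intro cong_mult_left) (simp add: scomm_def)
  also have "\<dots> = scale \<mu> (z_monom a * l * (U k (b k) * g) * h)"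
    by (simp add: scale_mult_right[symmetric] mult.assoc)
  also have "\<dots> \<approx> scale \<mu> (z_monom a * l *
      (scale r (U k b') + scale c (U k b' * z k) + scale e (U k b' * z (k - 1))) * h)"
    by (intro cong_scale cong_mult_right cong_mult_left b')
  also have "\<dots> = scale \<mu> (scale r (zU_monom a b2) + scale c (z_monom a * l * U k b' * z k * h) +
      scale e (z_monom a * l * U k b' * z (k - 1) * h))"
    by (simp add: zU2 distrib_left distrib_right scale_mult_left[symmetric] scale_mult_right[symmetric]
        mult.assoc)
  finally show ?thesis
    by (rule S_cong) (use ab(1) b2_le in \<open>auto intro!: S_scale S_add zU_monom_in_S z_term simp: le_SucI\<close>)
qed

lemma S_mult_gen:
  assumes "f \<in> S d" "g \<in> generators"
  shows "f * var g \<in> S (Suc d)"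
proof -
  obtain k where k: "k \<in> {1..n}" "var g = x k \<or> var g = y k"
    using assms(2) by (auto simp: generators_def x_def y_def)
  obtain h where h: "h \<in> free_alg.span (zU_monoms d)" "f \<approx> h"
    using assms(1) by (auto simp: S_def)
  have "h * var g \<in> S (Suc d)"
    using h(1)
  proof (induction rule: free_alg.span_induct_alt)
    case (step c m h)
    then obtain a b where m: "m = zU_monom a b" and
      ab: "a \<in> {1..n} \<rightarrow>\<^sub>E {..d}" "b \<in> {1..n} \<rightarrow>\<^sub>E {- int d..int d}"
      by (auto simp: zU_monoms_def)
    have "m * var g \<in> S (Suc d)"
      unfolding m using ab by (intro zU_monom_mult_gen[OF k]) (auto simp: PiE_iff abs_le_iff minus_le_iff)
    then have "scale c (m * var g) + h * var g \<in> S (Suc d)"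
      using step.IH by (intro S_add S_scale)
    then show ?case
      by (simp add: distrib_right scale_mult_left)
  qed (simp add: S_zero)
  then show ?thesis
    using cong_mult_right[OF h(2)] S_cong by blast
qed

lemma S_mono: "d \<le> e \<Longrightarrow> S d \<subseteq> S e"
proof -
  assume "d \<le> e"
  then have "zU_monoms d \<subseteq> zU_monoms e"
    unfolding zU_monoms_def by (intro image_mono Sigma_mono PiE_mono) auto
  then show ?thesis
    unfolding S_def using free_alg.span_mono by blast
qed

lemma var_words_subset_S: "var_words generators d \<subseteq> S d"
proof
  fix w :: "(gen, 'k) free_alg" assume "w \<in> var_words generators d"
  then obtain ls where ls: "w = prod_list (map var ls)" "set ls \<subseteq> generators" "length ls \<le> d"
    by (auto simp: var_words_def)
  have "prod_list (map var ls) \<in> S (length ls)"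
    using ls(2)
  proof (induction ls rule: rev_induct)
    case Nil
    have "zU_monom (\<lambda>_. 0) (\<lambda>_. 0) = 1"
      by (simp add: zU_monom_def z_monom_def U_def map_replicate_const prod_list_replicate del: upt_Suc)
    then show ?case
      using zU_monom_in_S[of "\<lambda>_. 0" 0 "\<lambda>_. 0"] by simp
  next
    case (snoc l ls)
    then show ?case
      using S_mult_gen[of "prod_list (map var ls)" "length ls" l] by simp
  qed
  then show "w \<in> S d"
    using S_mono[OF ls(3)] ls(1) by auto
qed

lemma span_var_words_subset_S: "free_alg.span (var_words generators d) \<subseteq> S d"
proof
  fix f :: "(gen, 'k) free_alg" assume "f \<in> free_alg.span (var_words generators d)"
  then show "f \<in> S d"
  proof (induction rule: free_alg.span_induct_alt)
    case (step c w f)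
    then show ?case
      using var_words_subset_S by (intro S_add S_scale) auto
  qed (simp add: S_zero)
qed

end

section \<open>A representation by monomial operators\<close>

lemma lookup_scale: "Poly_Mapping.lookup (scale c p) w = c * Poly_Mapping.lookup p w"
  by (simp add: scale_def Poly_Mapping.map.rep_eq when_def)

text \<open>A left action: the last letter of a word is applied first, so that products act by
  composition.\<close>

definition word_act :: "('g \<Rightarrow> ('t \<Rightarrow> 'k::field) \<Rightarrow> 't \<Rightarrow> 'k) \<Rightarrow> ('g, 'k) free_alg \<Rightarrow> ('t \<Rightarrow> 'k) \<Rightarrow> 't \<Rightarrow> 'k"
  where "word_act op p f t =
    (\<Sum>w\<in>Poly_Mapping.keys p. Poly_Mapping.lookup p w * foldr op (letters w) f t)"

locale linear_operators =
  fixes op :: "'g \<Rightarrow> ('t \<Rightarrow> 'k::field) \<Rightarrow> 't \<Rightarrow> 'k"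
  assumes op_add: "op g (\<lambda>t. f t + f' t) = (\<lambda>t. op g f t + op g f' t)"
    and op_scale: "op g (\<lambda>t. c * f t) = (\<lambda>t. c * op g f t)"
begin

lemma word_act_superset:
  assumes "finite S" "Poly_Mapping.keys p \<subseteq> S"
  shows "word_act op p f t = (\<Sum>w\<in>S. Poly_Mapping.lookup p w * foldr op (letters w) f t)"
  unfolding word_act_def using assms by (intro sum.mono_neutral_left) (auto simp: in_keys_iff)

lemma word_act_zero [simp]: "word_act op 0 f t = 0"
  by (simp add: word_act_def)

lemma word_act_add: "word_act op (p + r) f t = word_act op p f t + word_act op r f t"
proof -
  let ?S = "Poly_Mapping.keys p \<union> Poly_Mapping.keys r"
  have "word_act op s f t = (\<Sum>w\<in>?S. Poly_Mapping.lookup s w * foldr op (letters w) f t)"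
    if "s \<in> {p, r, p + r}" for s
    using that Poly_Mapping.keys_add[of p r] by (intro word_act_superset) auto
  then show ?thesis
    by (simp add: lookup_add distrib_right sum.distrib)
qed

lemma word_act_sum: "word_act op (\<Sum>i\<in>S. p i) f t = (\<Sum>i\<in>S. word_act op (p i) f t)"
  by (induction S rule: infinite_finite_induct) (simp_all add: word_act_add)

lemma word_act_single: "word_act op (Poly_Mapping.single w c) f t = c * foldr op (letters w) f t"
  by (cases "c = 0") (simp_all add: word_act_def)

lemma word_act_scale: "word_act op (scale c p) f t = c * word_act op p f t"
proof -
  have "word_act op (scale c p) f t =
      (\<Sum>w\<in>Poly_Mapping.keys p. Poly_Mapping.lookup (scale c p) w * foldr op (letters w) f t)"
    by (rule word_act_superset) (auto simp: lookup_scale in_keys_iff)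
  then show ?thesis
    by (simp add: word_act_def lookup_scale sum_distrib_left mult.assoc)
qed

lemma word_act_diff: "word_act op (p - r) f t = word_act op p f t - word_act op r f t"
  using word_act_add[of "p - r" r f t] by simp

lemma foldr_op_add: "foldr op ls (\<lambda>t. f t + f' t) = (\<lambda>t. foldr op ls f t + foldr op ls f' t)"
  by (induction ls) (auto simp: op_add)

lemma foldr_op_scale: "foldr op ls (\<lambda>t. c * f t) = (\<lambda>t. c * foldr op ls f t)"
  by (induction ls) (auto simp: op_scale)

lemma foldr_op_zero: "foldr op ls (\<lambda>t. 0) = (\<lambda>t. 0)"
  using foldr_op_scale[of ls 0] by simp

lemma foldr_op_sum: "foldr op ls (\<lambda>t. \<Sum>i\<in>S. f i t) = (\<lambda>t. \<Sum>i\<in>S. foldr op ls (f i) t)"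
  by (induction S rule: infinite_finite_induct) (simp_all add: foldr_op_add foldr_op_zero)

lemma word_act_mult: "word_act op (p * r) f = word_act op p (word_act op r f)"
proof
  fix t
  let ?p = "\<Sum>v\<in>Poly_Mapping.keys p. Poly_Mapping.single v (Poly_Mapping.lookup p v)"
  let ?r = "\<Sum>v\<in>Poly_Mapping.keys r. Poly_Mapping.single v (Poly_Mapping.lookup r v)"
  have "?p * ?r = (\<Sum>v\<in>Poly_Mapping.keys p. \<Sum>w\<in>Poly_Mapping.keys r.
      Poly_Mapping.single (v + w) (Poly_Mapping.lookup p v * Poly_Mapping.lookup r w))"
    by (simp add: sum_product mult_single)
  then have "word_act op (?p * ?r) f t = word_act op ?p (\<lambda>t. word_act op ?r f t) t"
    by (simp add: word_act_sum word_act_single foldr_op_sum foldr_op_scale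
        sum_distrib_left mult.assoc)
  then show "word_act op (p * r) f t = word_act op p (word_act op r f) t"
    by (simp flip: poly_mapping_eq_sum_single)
qed

lemma word_act_var: "word_act op (var g) f = op g f"
  by (rule ext) (simp add: var_def word_act_single)

lemma word_act_zero_fun: "word_act op p (\<lambda>t. 0) = (\<lambda>t. 0)"
  by (rule ext) (simp add: word_act_def foldr_op_zero)

lemma word_act_one: "word_act op 1 f = f"
  by (rule ext) (simp flip: single_one add: word_act_single)

text \<open>The elements that act as zero form an ideal, so checking the relations is enough for the
  action to descend to the presented algebra.\<close>

lemma word_act_genideal:
  assumes "R \<subseteq> carrier (free_algebra G)" "\<And>p f t. p \<in> R \<Longrightarrow> word_act op p f t = 0"
    and "p \<in> Idl\<^bsub>free_algebra G\<^esub> R"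
  shows "word_act op p f t = 0"
proof -
  interpret F: ring "free_algebra G :: ('k, ('g, 'k) free_alg) module"
    by (rule ring_free_algebra)
  let ?K = "{p \<in> carrier (free_algebra G). \<forall>f t. word_act op p f t = 0}"
  have "ideal ?K (free_algebra G)"
  proof (rule idealI)
    show "subgroup ?K (add_monoid (free_algebra G))"
    proof (rule F.add.subgroupI)
      show "\<ominus>\<^bsub>free_algebra G\<^esub> p \<in> ?K" if p: "p \<in> ?K" for p
      proof -
        have "p + \<ominus>\<^bsub>free_algebra G\<^esub> p = 0"
          using F.r_neg[of p] p by simp
        then have "\<ominus>\<^bsub>free_algebra G\<^esub> p = 0 - p"
          by (simp add: eq_neg_iff_add_eq_0 add.commute)
        then show ?thesis
          using p F.a_inv_closed[of p] word_act_diff[of 0 p] by simp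
      qed
    qed (use F.zero_closed F.a_closed in \<open>auto simp: word_act_add\<close>)
    show "x \<otimes>\<^bsub>free_algebra G\<^esub> p \<in> ?K" "p \<otimes>\<^bsub>free_algebra G\<^esub> x \<in> ?K"
      if "p \<in> ?K" "x \<in> carrier (free_algebra G)" for p x
    proof -
      have "word_act op p f = (\<lambda>t. 0)" for f
        using that by auto
      then show "x \<otimes>\<^bsub>free_algebra G\<^esub> p \<in> ?K" "p \<otimes>\<^bsub>free_algebra G\<^esub> x \<in> ?K"
        using that F.m_closed[of x p] F.m_closed[of p x] by (auto simp: word_act_mult word_act_zero_fun)
    qed
  qed (rule ring_free_algebra)
  moreover have "R \<subseteq> ?K"
    using assms(1,2) by auto
  ultimately show ?thesis
    using F.genideal_minimal assms(3) by blast
qed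

end

section \<open>The action of quantum Heisenberg space through a quantum torus\<close>

context heisenberg
begin

text \<open>Coordinate \<open>Y i\<close> is the exponent of \<open>z i\<close>. The coefficients 2
  and 1 are the powers of \<open>q\<close> that arise when \<open>x j\<close> crosses
  \<open>z i\<close> and \<open>x i\<close> from left to right, for \<open>i < j\<close>.\<close>

definition shift_weight :: "nat \<Rightarrow> (gen \<Rightarrow> int) \<Rightarrow> int"
  where "shift_weight j t = (\<Sum>i\<in>{1..<j}. 2 * t (Y i) + t (X i))"

definition unit_exp :: "gen \<Rightarrow> gen \<Rightarrow> int"
  where "unit_exp g h = (if h = g then 1 else 0)"

text \<open>
  \<open>twisted_shift e \<sigma> j\<close> is a monomial of a quantum torus acting on functions on its
  exponent lattice; \<open>x\<^sub>j\<close> and \<open>z\<^sub>j\<close> will act by such monomials, and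
  \<open>y\<^sub>j = (z\<^sub>j - z\<^sub>j\<^sub>-\<^sub>1) x\<^sub>j\<^sup>-\<^sup>1 / (1 - q\<^sup>2)\<close>.
\<close>

definition twisted_shift :: "(gen \<Rightarrow> int) \<Rightarrow> int \<Rightarrow> nat \<Rightarrow> ((gen \<Rightarrow> int) \<Rightarrow> 'k) \<Rightarrow> (gen \<Rightarrow> int) \<Rightarrow> 'k"
  where "twisted_shift e \<sigma> j f t = q powi (\<sigma> * shift_weight j t) * f (\<lambda>g. t g + e g)"

text \<open>The factor \<open>q\<^sup>2\<close> arises because the shift of \<open>z (j - 1)\<close>
  is applied inside the twist of the inverse of \<open>x j\<close> and raises
  \<open>shift_weight j\<close> by 2; the shift of \<open>z j\<close> leaves it unchanged. For
  \<open>j \<le> 1\<close> the second term is absent, matching \<open>z 0 = 0\<close>.\<close>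

fun torus_op :: "gen \<Rightarrow> ((gen \<Rightarrow> int) \<Rightarrow> 'k) \<Rightarrow> (gen \<Rightarrow> int) \<Rightarrow> 'k"
  where
    "torus_op (X j) f t = twisted_shift (unit_exp (X j)) (-1) j f t"
  | "torus_op (Y j) f t = inverse (1 - q\<^sup>2) *
      (twisted_shift (\<lambda>g. unit_exp (Y j) g - unit_exp (X j) g) 1 j f t -
       (if j \<le> 1 then 0
        else q\<^sup>2 * twisted_shift (\<lambda>g. unit_exp (Y (j - 1)) g - unit_exp (X j) g) 1 j f t))"

lemma twisted_shift_add:
  "twisted_shift e \<sigma> j (\<lambda>t. f t + f' t) t = twisted_shift e \<sigma> j f t + twisted_shift e \<sigma> j f' t"
  by (simp add: twisted_shift_def algebra_simps)

lemma twisted_shift_diff: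
  "twisted_shift e \<sigma> j (\<lambda>t. f t - f' t) t = twisted_shift e \<sigma> j f t - twisted_shift e \<sigma> j f' t"
  by (simp add: twisted_shift_def algebra_simps)

lemma twisted_shift_scale: "twisted_shift e \<sigma> j (\<lambda>t. c * f t) t = c * twisted_shift e \<sigma> j f t"
  by (simp add: twisted_shift_def algebra_simps)

sublocale torus: linear_operators torus_op
proof
  show "torus_op g (\<lambda>t. f t + f' t) = (\<lambda>t. torus_op g f t + torus_op g f' t)" for g f f'
    by (rule ext, cases g) (auto simp: twisted_shift_add algebra_simps)
  show "torus_op g (\<lambda>t. c * f t) = (\<lambda>t. c * torus_op g f t)" for g c f
    by (rule ext, cases g) (auto simp: twisted_shift_scale algebra_simps)
qed

lemma shift_weight_add: "shift_weight j (\<lambda>g. s g + t g) = shift_weight j s + shift_weight j t"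
  by (simp add: shift_weight_def sum.distrib algebra_simps)

lemma shift_weight_diff: "shift_weight j (\<lambda>g. s g - t g) = shift_weight j s - shift_weight j t"
  by (simp add: shift_weight_def sum_subtractf algebra_simps)

lemma shift_weight_unit_X: "shift_weight j (unit_exp (X i)) = (if i \<in> {1..<j} then 1 else 0)"
  by (simp add: shift_weight_def unit_exp_def)

lemma shift_weight_unit_Y: "shift_weight j (unit_exp (Y i)) = (if i \<in> {1..<j} then 2 else 0)"
  by (simp add: shift_weight_def unit_exp_def if_distrib[of "\<lambda>c. 2 * c"] cong: if_cong)

lemmas shift_weight_simps = shift_weight_add shift_weight_diff shift_weight_unit_X shift_weight_unit_Y

text \<open>Translations commute; only each twist notices the displacement made by the other
  operator, whence the skew exponent.\<close>

lemma twisted_shift_comp: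
  "twisted_shift e \<sigma> j (twisted_shift e' \<sigma>' j' f) t =
    q powi (\<sigma>' * shift_weight j' e - \<sigma> * shift_weight j e') *
      twisted_shift e' \<sigma>' j' (twisted_shift e \<sigma> j f) t"
proof -
  have "(\<lambda>g. t g + e g + e' g) = (\<lambda>g. t g + e' g + e g)"
    by (simp add: add_ac)
  moreover have "q powi (\<sigma> * shift_weight j t) * q powi (\<sigma>' * (shift_weight j' t + shift_weight j' e)) =
      q powi (\<sigma>' * shift_weight j' e - \<sigma> * shift_weight j e') *
      (q powi (\<sigma>' * shift_weight j' t) * q powi (\<sigma> * (shift_weight j t + shift_weight j e')))"
    by (simp only: power_int_add[OF disjI1[OF q(1)], symmetric]) (simp add: algebra_simps)
  ultimately show ?thesis
    by (simp only: twisted_shift_def shift_weight_add mult.assoc[symmetric])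
qed

text \<open>\<open>YX1 j\<close> and \<open>YX2 j\<close> are the exponent vectors of the two torus
  monomials in \<open>y j\<close>: \<open>z j\<close> and \<open>z (j - 1)\<close>, each times the
  inverse of \<open>x j\<close>.\<close>

definition YX1 :: "nat \<Rightarrow> gen \<Rightarrow> int"
  where "YX1 j g = unit_exp (Y j) g - unit_exp (X j) g"

definition YX2 :: "nat \<Rightarrow> gen \<Rightarrow> int"
  where "YX2 j g = unit_exp (Y (j - 1)) g - unit_exp (X j) g"

definition Y_coeff :: "nat \<Rightarrow> 'k"
  where "Y_coeff j = (if j \<le> 1 then 0 else q\<^sup>2)"

lemma torus_op_X: "torus_op (X j) f = twisted_shift (unit_exp (X j)) (-1) j f"
  by (rule ext) simp

lemma torus_op_Y: "torus_op (Y j) f = (\<lambda>t. inverse (1 - q\<^sup>2) *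
    (twisted_shift (YX1 j) 1 j f t - Y_coeff j * twisted_shift (YX2 j) 1 j f t))"
  by (rule ext) (auto simp: Y_coeff_def YX1_def[abs_def] YX2_def[abs_def])

declare torus_op.simps [simp del]

lemma shift_weight_YX1: "shift_weight j (YX1 i) = (if i \<in> {1..<j} then 1 else 0)"
  unfolding YX1_def shift_weight_diff shift_weight_unit_X shift_weight_unit_Y by simp

lemma shift_weight_YX2:
  "i \<noteq> 1 \<Longrightarrow> shift_weight j (YX2 i) =
    (if i - 1 \<in> {1..<j} then 2 else 0) - (if i \<in> {1..<j} then 1 else 0)"
  unfolding YX2_def shift_weight_diff shift_weight_unit_X shift_weight_unit_Y by simp

lemma twisted_shift_commute:
  assumes "\<sigma>' * shift_weight j' e - \<sigma> * shift_weight j e' = d"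
  shows "twisted_shift e \<sigma> j (twisted_shift e' \<sigma>' j' f) t =
    q powi d * twisted_shift e' \<sigma>' j' (twisted_shift e \<sigma> j f) t"
  using twisted_shift_comp[of e \<sigma> j e' \<sigma>' j' f t] unfolding assms .

lemma torus_xx:
  assumes "1 \<le> i" "i < j"
  shows "torus_op (X i) (torus_op (X j) f) t = inverse q * torus_op (X j) (torus_op (X i) f) t"
proof -
  have "twisted_shift (unit_exp (X i)) (-1) i (twisted_shift (unit_exp (X j)) (-1) j f) t =
      q powi -1 * twisted_shift (unit_exp (X j)) (-1) j (twisted_shift (unit_exp (X i)) (-1) i f) t"
    by (rule twisted_shift_commute) (use assms in \<open>simp add: shift_weight_unit_X\<close>)
  then show ?thesis
    by (simp add: torus_op_X power_int_minus)
qed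

lemma torus_xy:
  assumes "1 \<le> i" "1 \<le> j" "i \<noteq> j"
  shows "torus_op (X i) (torus_op (Y j) f) t = q * torus_op (Y j) (torus_op (X i) f) t"
proof -
  have 1: "twisted_shift (unit_exp (X i)) (-1) i (twisted_shift (YX1 j) 1 j f) t =
      q powi 1 * twisted_shift (YX1 j) 1 j (twisted_shift (unit_exp (X i)) (-1) i f) t"
    by (rule twisted_shift_commute) (use assms in \<open>auto simp: shift_weight_unit_X shift_weight_YX1\<close>)
  have 2: "Y_coeff j * twisted_shift (unit_exp (X i)) (-1) i (twisted_shift (YX2 j) 1 j f) t =
      q * (Y_coeff j * twisted_shift (YX2 j) 1 j (twisted_shift (unit_exp (X i)) (-1) i f) t)"
  proof (cases "j = 1")
    case False
    have "twisted_shift (unit_exp (X i)) (-1) i (twisted_shift (YX2 j) 1 j f) t =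
        q powi 1 * twisted_shift (YX2 j) 1 j (twisted_shift (unit_exp (X i)) (-1) i f) t"
      by (rule twisted_shift_commute)
        (use assms False in \<open>auto simp: shift_weight_unit_X shift_weight_YX2\<close>)
    then show ?thesis
      by simp
  qed (simp add: Y_coeff_def)
  show ?thesis
    unfolding torus_op_X torus_op_Y twisted_shift_scale twisted_shift_diff 1 2
    by (simp add: algebra_simps)
qed

text \<open>All four pairs of torus monomials in the two operators commute with the same factor
  \<open>q\<close>. Index 1 has only one monomial, so the statements about \<open>YX2 i\<close>
  carry the coefficient \<open>Y_coeff i\<close>, which vanishes there.\<close>

lemma torus_yy:
  assumes "1 \<le> i" "i < j"
  shows "torus_op (Y i) (torus_op (Y j) f) t = q * torus_op (Y j) (torus_op (Y i) f) t"
proof -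
  have ij: "\<not> j - Suc 0 < i" "i - Suc 0 < j"
    using assms by auto
  have 11: "twisted_shift (YX1 i) 1 i (twisted_shift (YX1 j) 1 j f) t =
      q * twisted_shift (YX1 j) 1 j (twisted_shift (YX1 i) 1 i f) t"
    using twisted_shift_commute[of 1 j "YX1 i" 1 i "YX1 j" 1] assms by (simp add: shift_weight_YX1)
  have 12: "twisted_shift (YX1 i) 1 i (twisted_shift (YX2 j) 1 j f) t =
      q * twisted_shift (YX2 j) 1 j (twisted_shift (YX1 i) 1 i f) t"
    using twisted_shift_commute[of 1 j "YX1 i" 1 i "YX2 j" 1] assms ij
    by (auto simp: shift_weight_YX1 shift_weight_YX2)
  have 21: "Y_coeff i * twisted_shift (YX2 i) 1 i (twisted_shift (YX1 j) 1 j f) t =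
      q * (Y_coeff i * twisted_shift (YX1 j) 1 j (twisted_shift (YX2 i) 1 i f) t)"
    using twisted_shift_commute[of 1 j "YX2 i" 1 i "YX1 j" 1] assms ij
    by (cases "i = 1") (auto simp: shift_weight_YX1 shift_weight_YX2 Y_coeff_def)
  have 22: "Y_coeff i * twisted_shift (YX2 i) 1 i (twisted_shift (YX2 j) 1 j f) t =
      q * (Y_coeff i * twisted_shift (YX2 j) 1 j (twisted_shift (YX2 i) 1 i f) t)"
    using twisted_shift_commute[of 1 j "YX2 i" 1 i "YX2 j" 1] assms ij
    by (cases "i = 1") (auto simp: shift_weight_YX1 shift_weight_YX2 Y_coeff_def)
  have bilinear: "a * (a * (u - k' * v) - k * (a * (w - k' * s))) =
      q * (a * (a * (u' - k * w') - k' * (a * (v' - k * s'))))"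
    if "u = q * u'" "v = q * v'" "k * w = q * (k * w')" "k * s = q * (k * s')"
    for a k k' u v w s u' v' w' s' :: 'k
  proof -
    have "a * (a * (u - k' * v) - k * (a * (w - k' * s))) = a * a * (u - k' * v - k * w + k' * (k * s))"
      by (simp add: algebra_simps)
    also have "\<dots> = a * a * (q * u' - k' * (q * v') - q * (k * w') + k' * (q * (k * s')))"
      by (simp only: that)
    finally show ?thesis
      by (simp add: algebra_simps)
  qed
  show ?thesis
    unfolding torus_op_Y twisted_shift_scale twisted_shift_diff by (rule bilinear[OF 11 12 21 22])
qed

lemma twisted_shift_YX1_X:
  "twisted_shift (YX1 j) 1 j (twisted_shift (unit_exp (X j)) (-1) j f) t = f (\<lambda>g. t g + unit_exp (Y j) g)"
  using q(1)
  by (simp add: twisted_shift_def shift_weight_add shift_weight_YX1 power_int_add[symmetric] mult.assoc[symmetric])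
    (simp add: YX1_def)

lemma twisted_shift_YX2_X:
  assumes "j > 1"
  shows "twisted_shift (YX2 j) 1 j (twisted_shift (unit_exp (X j)) (-1) j f) t =
    q powi -2 * f (\<lambda>g. t g + unit_exp (Y (j - 1)) g)"
  using q(1) assms
  by (simp add: twisted_shift_def shift_weight_add shift_weight_YX2 power_int_add[symmetric] mult.assoc[symmetric])
    (simp add: YX2_def)

lemma twisted_shift_X_YX:
  "twisted_shift (unit_exp (X j)) (-1) j (twisted_shift (YX1 j) 1 j f) t = f (\<lambda>g. t g + unit_exp (Y j) g)"
  "twisted_shift (unit_exp (X j)) (-1) j (twisted_shift (YX2 j) 1 j f) t =
    f (\<lambda>g. t g + unit_exp (Y (j - 1)) g)"
  using q(1)
  by (simp_all add: twisted_shift_def shift_weight_add shift_weight_unit_X power_int_add[symmetric] mult.assoc[symmetric])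
    (simp_all add: YX1_def YX2_def)

lemma torus_yx_same:
  "torus_op (Y j) (torus_op (X j) f) t = inverse (1 - q\<^sup>2) *
    (f (\<lambda>g. t g + unit_exp (Y j) g) - (if j \<le> 1 then 0 else f (\<lambda>g. t g + unit_exp (Y (j - 1)) g)))"
proof (cases "j \<le> 1")
  case True
  then show ?thesis
    unfolding torus_op_X torus_op_Y twisted_shift_YX1_X by (simp add: Y_coeff_def)
next
  case False
  then show ?thesis
    unfolding torus_op_X torus_op_Y twisted_shift_YX1_X using twisted_shift_YX2_X[of j f t] q(1)
    by (simp add: Y_coeff_def power_int_minus)
qed

lemma torus_xy_same:
  "torus_op (X j) (torus_op (Y j) f) t = inverse (1 - q\<^sup>2) *
    (f (\<lambda>g. t g + unit_exp (Y j) g) - Y_coeff j * f (\<lambda>g. t g + unit_exp (Y (j - 1)) g))"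
  unfolding torus_op_X torus_op_Y twisted_shift_scale twisted_shift_diff twisted_shift_X_YX ..

text \<open>Up to the factor \<open>1 - q\<^sup>2\<close>, each \<open>y l * x l\<close> acts as the
  shift along \<open>Y l\<close> minus the shift along \<open>Y (l - 1)\<close>. The sum telescopes,
  and \<open>z i\<close> acts as an untwisted shift.\<close>

lemma word_act_sum_yx:
  "word_act torus_op (\<Sum>l = 1..i. scale (1 - q\<^sup>2) (var (Y l) * var (X l))) f t =
    (if i = 0 then 0 else f (\<lambda>g. t g + unit_exp (Y i) g))"
proof (induction i)
  case (Suc i)
  then show ?case
    using one_minus_q2
    by (simp add: torus.word_act_add torus.word_act_scale torus.word_act_mult torus.word_act_var torus_yx_same
        mult.assoc[symmetric])
qed simp

lemma word_act_relations:
  assumes "p \<in> Kn_relations n (\<lambda>_. q\<^sup>2) (\<lambda>_. 1) (heisenberg_gamma q)"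
  shows "word_act torus_op p f t = 0"
proof -
  note act = torus.word_act_diff torus.word_act_scale torus.word_act_mult torus.word_act_var
  consider
      i j where "1 \<le> i" "i < j" "p = var (X i) * var (X j) -
        scale (1 * inverse (q\<^sup>2) * heisenberg_gamma q i j) (var (X j) * var (X i))"
    | i j where "1 \<le> i" "i < j" "p = var (Y i) * var (Y j) -
        scale (heisenberg_gamma q i j) (var (Y j) * var (Y i))"
    | i j where "1 \<le> i" "i < j" "p = var (X i) * var (Y j) -
        scale (q\<^sup>2 * inverse (heisenberg_gamma q i j)) (var (Y j) * var (X i))"
    | i j where "1 \<le> j" "j < i" "p = var (X i) * var (Y j) -
        scale (1 * inverse (heisenberg_gamma q i j)) (var (Y j) * var (X i))"
    | i where "1 \<le> i" "p = var (X i) * var (Y i) - scale 1 (var (Y i) * var (X i)) -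
        (\<Sum>l = 1..<i. scale (1 - q\<^sup>2) (var (Y l) * var (X l)))"
    using assms unfolding Kn_relations_def Let_def Un_iff mem_Collect_eq by (elim disjE exE conjE) blast+
  then show ?thesis
  proof cases
    case 1
    then show ?thesis
      using q(1) torus_xx[of i j f t]
      by (simp add: act heisenberg_gamma_def power2_eq_square mult.assoc)
  next
    case 2
    then show ?thesis
      using torus_yy[of i j f t] by (simp add: act heisenberg_gamma_def)
  next
    case 3
    then show ?thesis
      using q(1) torus_xy[of i j f t]
      by (simp add: act heisenberg_gamma_def power2_eq_square mult.assoc)
  next
    case 4
    then show ?thesis
      using torus_xy[of i j f t] by (simp add: act heisenberg_gamma_def)
  next
    case 5
    have "{1..<i} = {1..i - 1}"
      using 5(1) by auto
    then have "word_act torus_op p f t = torus_op (X i) (torus_op (Y i) f) t -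
        torus_op (Y i) (torus_op (X i) f) t - (if i - 1 = 0 then 0 else f (\<lambda>g. t g + unit_exp (Y (i - 1)) g))"
      unfolding 5(2) word_act_sum_yx[symmetric] by (simp only: act) simp
    moreover have "inverse (1 - q\<^sup>2) * (u - q\<^sup>2 * v) - inverse (1 - q\<^sup>2) * (u - v) = v" for u v
    proof -
      have "inverse (1 - q\<^sup>2) * (u - q\<^sup>2 * v) - inverse (1 - q\<^sup>2) * (u - v) =
          inverse (1 - q\<^sup>2) * ((1 - q\<^sup>2) * v)"
        unfolding right_diff_distrib[symmetric] by (simp add: left_diff_distrib)
      then show ?thesis
        using one_minus_q2 by (simp add: mult.assoc[symmetric])
    qed
    ultimately have "word_act torus_op p f t = 0"
      using 5(1) by (auto simp: torus_yx_same torus_xy_same Y_coeff_def)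
    then show ?thesis .
  qed
qed

lemma word_act_N:
  assumes "p \<in> N" shows "word_act torus_op (proj_alg generators p) f t = 0"
proof -
  have "proj_alg generators p \<in> relation_ideal"
    using assms by (simp add: N_def)
  then show ?thesis
    unfolding relation_ideal_def Kn_ideal_def
    by (rule torus.word_act_genideal[OF Kn_relations_carrier, rotated]) (rule word_act_relations)
qed

text \<open>The element acts as one torus monomial. Of its coefficient function only nonvanishing is
  recorded, which is all that independence uses.\<close>

definition shifts :: "(gen, 'k) free_alg \<Rightarrow> (gen \<Rightarrow> int) \<Rightarrow> bool"
  where "shifts p e \<longleftrightarrow> (\<exists>\<kappa>. (\<forall>t. \<kappa> t \<noteq> 0) \<and>
    (\<forall>f t. word_act torus_op (proj_alg generators p) f t = \<kappa> t * f (\<lambda>g. t g + e g)))"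

lemma shifts_mult:
  assumes "shifts p e" "shifts r e'" shows "shifts (p * r) (\<lambda>g. e g + e' g)"
proof -
  obtain \<kappa> where \<kappa>: "\<And>t. \<kappa> t \<noteq> 0"
    "\<And>f t. word_act torus_op (proj_alg generators p) f t = \<kappa> t * f (\<lambda>g. t g + e g)"
    using assms(1) unfolding shifts_def by blast
  obtain \<mu> where \<mu>: "\<And>t. \<mu> t \<noteq> 0"
    "\<And>f t. word_act torus_op (proj_alg generators r) f t = \<mu> t * f (\<lambda>g. t g + e' g)"
    using assms(2) unfolding shifts_def by blast
  show ?thesis
    unfolding shifts_def proj_alg_mult torus.word_act_mult \<kappa>(2) \<mu>(2)
    using \<kappa>(1) \<mu>(1) by (intro exI[of _ "\<lambda>t. \<kappa> t * \<mu> (\<lambda>g. t g + e g)"]) (simp add: mult.assoc add.assoc)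
qed

lemma shifts_one: "shifts 1 (\<lambda>_. 0)"
  unfolding shifts_def by (intro exI[of _ "\<lambda>_. 1"]) (simp add: torus.word_act_one)

lemma shifts_power: "shifts p e \<Longrightarrow> shifts (p ^ m) (\<lambda>g. int m * e g)"
proof (induction m)
  case (Suc m)
  show ?case
    using shifts_mult[OF Suc.prems Suc.IH[OF Suc.prems]] by (simp add: algebra_simps)
qed (simp add: shifts_one)

lemma shifts_prod_list:
  "(\<And>l. l \<in> set ls \<Longrightarrow> shifts (p l) (e l)) \<Longrightarrow>
    shifts (prod_list (map p ls)) (\<lambda>g. \<Sum>l\<leftarrow>ls. e l g)"
  by (induction ls) (auto intro: shifts_one shifts_mult)

lemma shifts_x: "j \<in> {1..n} \<Longrightarrow> shifts (x j) (unit_exp (X j))"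
  unfolding shifts_def using q(1)
  by (intro exI[of _ "\<lambda>t. q powi (- shift_weight j t)"])
    (simp add: x_def proj_alg_var generators_def torus.word_act_var torus_op_X twisted_shift_def)

lemma shifts_z: "j \<in> {1..n} \<Longrightarrow> shifts (z j) (unit_exp (Y j))"
proof -
  assume j: "j \<in> {1..n}"
  have "proj_alg generators (z j) = (\<Sum>l = 1..j. scale (1 - q\<^sup>2) (var (Y l) * var (X l)))"
    unfolding z_def x_def y_def proj_alg_sum proj_alg_scale proj_alg_mult
    using j by (intro sum.cong) (auto simp: proj_alg_var generators_def)
  then show ?thesis
    unfolding shifts_def using j word_act_sum_yx[of j] by (intro exI[of _ "\<lambda>_. 1"]) simp
qed

text \<open>Nonnegative powers of \<open>x j\<close> alone already supply as many monomials as
  growth \<open>2 n\<close> demands, and each acts by a single shift, whereas \<open>y j\<close>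
  acts by two when \<open>j > 1\<close>.\<close>

definition zx_monom :: "(nat \<Rightarrow> nat) \<times> (nat \<Rightarrow> nat) \<Rightarrow> (gen, 'k) free_alg"
  where "zx_monom = (\<lambda>(a, b). z_monom a * prod_list (map (\<lambda>j. x j ^ b j) [1..<Suc n]))"

definition zx_exp :: "(nat \<Rightarrow> nat) \<times> (nat \<Rightarrow> nat) \<Rightarrow> gen \<Rightarrow> int"
  where "zx_exp = (\<lambda>(a, b) g. (\<Sum>i\<leftarrow>[1..<Suc n]. int (a i) * unit_exp (Y i) g) +
    (\<Sum>j\<leftarrow>[1..<Suc n]. int (b j) * unit_exp (X j) g))"

lemma shifts_zx_monom: "shifts (zx_monom ab) (zx_exp ab)"
  unfolding zx_monom_def zx_exp_def z_monom_def
  by (auto simp del: upt_Suc split: prod.splits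
      intro!: shifts_mult shifts_prod_list shifts_power shifts_z shifts_x)

lemma zx_exp_inj:
  "inj_on zx_exp (({1..n} \<rightarrow>\<^sub>E {..d}) \<times> ({1..n} \<rightarrow>\<^sub>E {..d}))"
proof (rule inj_onI)
  fix ab cd
  assume *: "ab \<in> ({1..n} \<rightarrow>\<^sub>E {..d}) \<times> ({1..n} \<rightarrow>\<^sub>E {..d})" "cd \<in> ({1..n} \<rightarrow>\<^sub>E {..d}) \<times> ({1..n} \<rightarrow>\<^sub>E {..d})"
    "zx_exp ab = zx_exp cd"
  obtain a b c d' where ab: "ab = (a, b)" and cd: "cd = (c, d')"
    by (cases ab, cases cd)
  have Y: "zx_exp (u, v) (Y i) = int (u i)" if "i \<in> {1..n}" for u v i
    using that by (simp add: zx_exp_def unit_exp_def sum_list_distinct_conv_sum_set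
        atLeastLessThanSuc_atLeastAtMost if_distrib sum.delta del: upt_Suc cong: if_cong)
  have X: "zx_exp (u, v) (X i) = int (v i)" if "i \<in> {1..n}" for u v i
    using that by (simp add: zx_exp_def unit_exp_def sum_list_distinct_conv_sum_set
        atLeastLessThanSuc_atLeastAtMost if_distrib sum.delta del: upt_Suc cong: if_cong)
  have "a i = c i" "b i = d' i" if "i \<in> {1..n}" for i
    using that *(3) X[of i a b] X[of i c d'] Y[of i a b] Y[of i c d'] by (auto simp: ab cd)
  then have "a = c" "b = d'"
    using *(1,2) PiE_ext[of a "{1..n}" "\<lambda>_. {..d}" c] PiE_ext[of b "{1..n}" "\<lambda>_. {..d}" d']
    unfolding ab cd by blast+
  then show "ab = cd"
    by (simp add: ab cd)
qed

text \<open>Distinct monomials translate by distinct vectors. Applying the relation to the indicator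
  function of \<open>zx_exp cd\<close> and evaluating at the origin isolates the coefficient of
  \<open>cd\<close>.\<close>

lemma zx_monoms_independent:
  assumes "(\<Sum>ab\<in>B. scale (\<alpha> ab) (zx_monom ab)) \<in> N" "finite B" "inj_on zx_exp B" "cd \<in> B"
  shows "\<alpha> cd = 0"
proof -
  have "\<exists>\<kappa>. \<forall>ab. \<kappa> ab \<noteq> 0 \<and> (\<forall>f. word_act torus_op (proj_alg generators (zx_monom ab)) f (\<lambda>_. 0) =
      \<kappa> ab * f (zx_exp ab))"
  proof (rule choice, rule allI)
    fix ab
    show "\<exists>\<kappa>. \<kappa> \<noteq> 0 \<and> (\<forall>f. word_act torus_op (proj_alg generators (zx_monom ab)) f (\<lambda>_. 0) =
        \<kappa> * f (zx_exp ab))"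
      using shifts_zx_monom[of ab] unfolding shifts_def by auto
  qed
  then obtain \<kappa> where \<kappa>: "\<And>ab. \<kappa> ab \<noteq> 0"
    "\<And>ab f. word_act torus_op (proj_alg generators (zx_monom ab)) f (\<lambda>_. 0) = \<kappa> ab * f (zx_exp ab)"
    by blast
  define f where "f = (\<lambda>t. if t = zx_exp cd then 1 else 0 :: 'k)"
  have "0 = (\<Sum>ab\<in>B. \<alpha> ab * (\<kappa> ab * f (zx_exp ab)))"
    using word_act_N[OF assms(1), of f "\<lambda>_. 0"]
    by (simp add: proj_alg_sum proj_alg_scale torus.word_act_sum torus.word_act_scale \<kappa>(2))
  also have "\<dots> = (\<Sum>ab\<in>B. if ab = cd then \<alpha> cd * \<kappa> cd else 0)"
    using assms(3,4) by (intro sum.cong) (auto simp: f_def inj_on_def)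
  also have "\<dots> = \<alpha> cd * \<kappa> cd"
    using assms(2,4) by simp
  finally show ?thesis
    using \<kappa>(1) by simp
qed

end

section \<open>Growth\<close>

lemma tendsto_const_over_ln: "(\<lambda>m. c / ln (real m)) \<longlonglongrightarrow> 0"
  by (intro tendsto_divide_0[OF tendsto_const] filterlim_at_top_imp_at_infinity
      filterlim_compose[OF ln_at_top filterlim_real_sequentially])

text \<open>With \<open>k = m div \<kappa>\<close> the number \<open>k + 1\<close> is at least
  \<open>m / \<kappa>\<close>. Taking logarithms to base \<open>m\<close> loses only
  \<open>N * ln \<kappa> / ln m\<close>, which tends to 0.\<close>

lemma growth_exponent_ge:
  assumes \<kappa>: "\<kappa> > 0" and d: "\<And>k m. \<kappa> * k \<le> m \<Longrightarrow> (k + 1) ^ N \<le> d m"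
  shows "ereal (real N) \<le> growth_exponent d"
proof -
  define c where "c = ln (real \<kappa>)"
  have "(\<lambda>m. real N * (1 - c / ln (real m))) \<longlonglongrightarrow> real N * (1 - 0)"
    by (intro tendsto_intros tendsto_const_over_ln)
  then have "(\<lambda>m. ereal (real N * (1 - c / ln (real m)))) \<longlonglongrightarrow> ereal (real N)"
    by simp
  then have "ereal (real N) = limsup (\<lambda>m. ereal (real N * (1 - c / ln (real m))))"
    by (intro lim_imp_Limsup[symmetric]) auto
  also have "\<dots> \<le> growth_exponent d"
    unfolding growth_exponent_def
  proof (rule Limsup_mono, rule eventually_sequentiallyI[of 2])
    fix m :: nat assume m: "m \<ge> 2"
    have "\<kappa> * (m div \<kappa>) \<le> m"
      by simp
    then have dm: "(m div \<kappa> + 1) ^ N \<le> d m"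
      by (rule d)
    then have pos: "d m > 0"
      by (metis add_is_0 gr0I le_zero_eq power_not_zero zero_neq_one)
    have "m \<le> \<kappa> * (m div \<kappa> + 1)"
      using dividend_less_times_div[OF \<kappa>, of m] by (simp add: mult.commute)
    then have "real m \<le> real \<kappa> * real (m div \<kappa> + 1)"
      unfolding of_nat_mult[symmetric] of_nat_le_iff .
    then have "real m / real \<kappa> \<le> real (m div \<kappa> + 1)"
      using \<kappa> by (simp add: field_simps)
    then have "(real m / real \<kappa>) ^ N \<le> real (m div \<kappa> + 1) ^ N"
      by (intro power_mono) auto
    also have "\<dots> \<le> real (d m)"
      using of_nat_mono[OF dm, where 'a = real] by simp
    finally have "ln ((real m / real \<kappa>) ^ N) \<le> ln (real (d m))"
      using m \<kappa> pos by (subst ln_le_cancel_iff) auto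
    then have "real N * (ln (real m) - c) \<le> ln (real (d m))"
      using m \<kappa> by (simp add: ln_realpow ln_div c_def)
    then have "real N * (ln (real m) - c) / ln (real m) \<le> ln (real (d m)) / ln (real m)"
      using m by (intro divide_right_mono) auto
    moreover have "real N * (ln (real m) - c) / ln (real m) = real N * (1 - c / ln (real m))"
      using m by (simp add: field_simps)
    ultimately show "ereal (real N * (1 - c / ln (real m))) \<le>
        (if d m = 0 then - \<infinity> else ereal (log (real m) (real (d m))))"
      using pos by (simp add: log_def)
  qed
  finally show ?thesis .
qed

lemma growth_exponent_le:
  assumes \<kappa>: "\<kappa> > 0" and d: "\<And>m. m \<ge> 1 \<Longrightarrow> d m \<le> (\<kappa> * m) ^ N"
  shows "growth_exponent d \<le> ereal (real N)"
proof -
  define c where "c = ln (real \<kappa>)"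
  have "(\<lambda>m. real N * (1 + c / ln (real m))) \<longlonglongrightarrow> real N * (1 + 0)"
    by (intro tendsto_intros tendsto_const_over_ln)
  then have lim: "(\<lambda>m. ereal (real N * (1 + c / ln (real m)))) \<longlonglongrightarrow> ereal (real N)"
    by simp
  have "growth_exponent d \<le> limsup (\<lambda>m. ereal (real N * (1 + c / ln (real m))))"
    unfolding growth_exponent_def
  proof (rule Limsup_mono, rule eventually_sequentiallyI[of 2])
    fix m :: nat assume m: "m \<ge> 2"
    show "(if d m = 0 then - \<infinity> else ereal (log (real m) (real (d m)))) \<le>
        ereal (real N * (1 + c / ln (real m)))"
    proof (cases "d m = 0")
      case False
      have "real (d m) \<le> (real \<kappa> * real m) ^ N"
        using of_nat_mono[OF d[of m], where 'a = real] m by simp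
      then have "ln (real (d m)) \<le> ln ((real \<kappa> * real m) ^ N)"
        using m \<kappa> False by (subst ln_le_cancel_iff) auto
      then have "ln (real (d m)) \<le> real N * (ln (real m) + c)"
        using m \<kappa> by (simp add: ln_realpow ln_mult c_def add.commute)
      then have "ln (real (d m)) / ln (real m) \<le> real N * (ln (real m) + c) / ln (real m)"
        using m by (intro divide_right_mono) auto
      moreover have "real N * (ln (real m) + c) / ln (real m) = real N * (1 + c / ln (real m))"
        using m by (simp add: field_simps)
      ultimately show ?thesis
        using False by (simp add: log_def)
    qed simp
  qed
  also have "\<dots> = ereal (real N)"
    using lim by (intro lim_imp_Limsup) auto
  finally show ?thesis .
qed

lemma power_in_span_var_words:
  "f \<in> free_alg.span (var_words G d) \<Longrightarrow> f ^ m \<in> free_alg.span (var_words G (m * d))"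
proof (induction m)
  case 0
  then show ?case
    by (simp add: free_alg.span_base one_in_var_words)
next
  case (Suc m)
  then show ?case
    using span_var_words_mult[of f G d "f ^ m" "m * d"] by simp
qed

lemma prod_list_in_span_var_words:
  "(\<And>f. f \<in> set fs \<Longrightarrow> f \<in> free_alg.span (var_words G d)) \<Longrightarrow>
    prod_list fs \<in> free_alg.span (var_words G (length fs * d))"
proof (induction fs)
  case Nil
  then show ?case
    by (simp add: free_alg.span_base one_in_var_words)
next
  case (Cons f fs)
  then show ?case
    using span_var_words_mult[of f G d "prod_list fs" "length fs * d"] by simp
qed

lemma span_var_words_mono: "d \<le> e \<Longrightarrow> free_alg.span (var_words G d) \<subseteq> free_alg.span (var_words G e)"
  by (intro free_alg.span_mono var_words_mono)

section \<open>Power sums of subspaces as images of words of bounded length\<close>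

context presented_algebra
begin

sublocale cls: free_alg_map A cls
  by (intro free_alg_map.intro vectorspace_A free_alg_map_axioms.intro) auto

lemma A_image_subspace: "VectorSpace.subspace class_ring (cls ` free_alg.span W) A"
  unfolding cls.span_image[symmetric] by (rule cls.span_is_subspace) auto

lemma finite_subset_in_var_words:
  assumes "finite T" "T \<subseteq> carrier A"
  shows "\<exists>r. T \<subseteq> cls ` free_alg.span (var_words G r)"
  using assms
proof (induction T rule: finite_induct)
  case (insert t T)
  then obtain r where r: "T \<subseteq> cls ` free_alg.span (var_words G r)"
    by auto
  obtain f where f: "t = cls f"
    using insert.prems by (auto elim: carrier_A_cases)
  obtain s where s: "proj_alg G f \<in> free_alg.span (var_words G s)"
    using proj_alg_in_span_var_words by blast
  have t: "t \<in> cls ` free_alg.span (var_words G s)"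
    using s f cls_proj[of f] by (metis imageI)
  have sub: "cls ` free_alg.span (var_words G d) \<subseteq> cls ` free_alg.span (var_words G (max r s))"
    if "d \<le> max r s" for d
    using span_var_words_mono[OF that] by (rule image_mono)
  have "insert t T \<subseteq> cls ` free_alg.span (var_words G (max r s))"
    unfolding insert_subset by (intro conjI subsetD[OF sub t] subset_trans[OF r sub]) auto
  then show ?case
    by blast
qed auto

lemma fin_dim_subspace_in_var_words:
  assumes "V \<in> fin_dim_subspaces class_ring A"
  shows "\<exists>r. V \<subseteq> cls ` free_alg.span (var_words G r)"
proof -
  have V: "VectorSpace.subspace class_ring V A" "vectorspace.fin_dim class_ring (A\<lparr>carrier := V\<rparr>)"
    using assms by (auto simp: fin_dim_subspaces_def)
  interpret V: vectorspace class_ring "A\<lparr>carrier := V\<rparr>"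
    by (rule cls.subspace_is_vs[OF V(1)])
  obtain T where T: "finite T" "T \<subseteq> V" "V.span T = V"
    using V(2) by (auto simp: V.fin_dim_def)
  have sub: "LinearCombinations.submodule class_ring V A"
    using V(1) by (simp add: VectorSpace.subspace_def)
  then have "V \<subseteq> carrier A"
    by (simp add: submodule_def)
  then obtain r where r: "T \<subseteq> cls ` free_alg.span (var_words G r)"
    using finite_subset_in_var_words[OF T(1)] T(2) by blast
  have "cls.span T \<subseteq> cls ` free_alg.span (var_words G r)"
    using A_image_subspace by (intro cls.span_is_subset[OF r]) (simp add: VectorSpace.subspace_def)
  then show ?thesis
    using cls.span_li_not_depend(1)[OF T(2) sub] T(3) by auto
qed

lemma foldr_mult_cls:
  "foldr (mult A) (map cls fs) \<one>\<^bsub>A\<^esub> = cls (prod_list fs)"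
  by (induction fs) (simp_all add: one_A)

lemma power_sum_subset:
  assumes "V \<subseteq> cls ` free_alg.span (var_words G r)"
  shows "power_sum class_ring A V m \<subseteq> cls ` free_alg.span (var_words G (m * r))"
  unfolding power_sum_def
proof (rule cls.span_is_subset)
  show "LinearCombinations.submodule class_ring (cls ` free_alg.span (var_words G (m * r))) A"
    using A_image_subspace by (simp add: VectorSpace.subspace_def)
  show "{foldr (mult A) vs \<one>\<^bsub>A\<^esub> | vs. set vs \<subseteq> V \<and> length vs \<le> m} \<subseteq>
      cls ` free_alg.span (var_words G (m * r))"
  proof safe
    fix vs assume vs: "set vs \<subseteq> V" "length vs \<le> m"
    have "\<exists>fs. vs = map cls fs \<and> set fs \<subseteq> free_alg.span (var_words G r)"
      using vs(1)
    proof (induction vs)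
      case (Cons v vs)
      then obtain f fs where "v = cls f" "f \<in> free_alg.span (var_words G r)"
        "vs = map cls fs" "set fs \<subseteq> free_alg.span (var_words G r)"
        using assms by auto
      then show ?case
        by (intro exI[of _ "f # fs"]) auto
    qed simp
    then obtain fs where fs: "vs = map cls fs" "set fs \<subseteq> free_alg.span (var_words G r)"
      by blast
    have "prod_list fs \<in> free_alg.span (var_words G (length fs * r))"
      using fs(2) by (intro prod_list_in_span_var_words) auto
    moreover have "length fs * r \<le> m * r"
      using vs(2) fs(1) by simp
    ultimately have "prod_list fs \<in> free_alg.span (var_words G (m * r))"
      using span_var_words_mono by blast
    then show "foldr (mult A) vs \<one>\<^bsub>A\<^esub> \<in> cls ` free_alg.span (var_words G (m * r))"
      by (simp add: fs(1) foldr_mult_cls)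
  qed
qed

lemma power_sum_subspace:
  assumes "V \<subseteq> carrier A"
  shows "VectorSpace.subspace class_ring (power_sum class_ring A V m) A"
proof -
  have "foldr (mult A) vs \<one>\<^bsub>A\<^esub> \<in> carrier A" if "set vs \<subseteq> V" for vs
    using that
  proof (induction vs)
    case Nil
    show ?case
      by (simp add: one_A)
  next
    case (Cons v vs)
    then show ?case
      using assms ring.ring_simprules(5)[OF ring_A] by auto
  qed
  then show ?thesis
    unfolding power_sum_def by (intro cls.span_is_subspace) auto
qed

text \<open>Its power sums are exactly the images of the words of bounded length, so this one
  subspace suffices for lower bounds on growth.\<close>

definition gen_space :: "('g, 'k) free_alg set set"
  where "gen_space = cls ` free_alg.span (var ` G)"

lemma gen_space_subset: "gen_space \<subseteq> cls ` free_alg.span (var_words G 1)"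
  unfolding gen_space_def by (intro image_mono free_alg.span_mono) (auto intro: var_in_var_words[simplified])

lemma power_sum_gen_space: "power_sum class_ring A gen_space m = cls ` free_alg.span (var_words G m)"
proof
  show "power_sum class_ring A gen_space m \<subseteq> cls ` free_alg.span (var_words G m)"
    using power_sum_subset[OF gen_space_subset, of m] by simp
  have "cls w \<in> {foldr (mult A) vs \<one>\<^bsub>A\<^esub> | vs. set vs \<subseteq> gen_space \<and> length vs \<le> m}"
    if w: "w \<in> var_words G m" for w
  proof -
    obtain ls where ls: "w = prod_list (map var ls)" "set ls \<subseteq> G" "length ls \<le> m"
      using w by (auto simp: var_words_def)
    then have "set (map cls (map var ls)) \<subseteq> gen_space"
      by (auto simp: gen_space_def intro!: imageI free_alg.span_base)
    moreover have "cls w = foldr (mult A) (map cls (map var ls)) \<one>\<^bsub>A\<^esub>"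
      by (simp only: foldr_mult_cls ls(1))
    ultimately show ?thesis
      using ls(3) by (intro CollectI exI[of _ "map cls (map var ls)"]) simp
  qed
  then show "cls ` free_alg.span (var_words G m) \<subseteq> power_sum class_ring A gen_space m"
    unfolding power_sum_def cls.span_image[symmetric] by (intro cls.span_is_monotone) auto
qed

lemma gen_space_fin_dim:
  assumes "finite G" shows "gen_space \<in> fin_dim_subspaces class_ring A"
proof -
  have "VectorSpace.subspace class_ring gen_space A"
    unfolding gen_space_def by (rule A_image_subspace)
  moreover have "gen_space \<subseteq> cls.span (cls ` var ` G)"
    unfolding gen_space_def cls.span_image ..
  moreover have "cls ` var ` G \<subseteq> carrier A"
    by auto
  ultimately show ?thesis
    unfolding fin_dim_subspaces_def using assms cls.subspace_of_finite_span(1)[of "cls ` var ` G" gen_space]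
    by auto
qed

end

section \<open>Gelfand-Kirillov dimension of the algebra\<close>

context heisenberg
begin

lemma finite_generators: "finite generators"
  by (simp add: generators_def)

lemma power_sum_fin_dim:
  assumes "V \<subseteq> cls ` free_alg.span (var_words generators r)"
  shows "vectorspace.fin_dim class_ring (A\<lparr>carrier := power_sum class_ring A V m\<rparr>)"
    "vectorspace.dim class_ring (A\<lparr>carrier := power_sum class_ring A V m\<rparr>) \<le> (2 * (m * r) + 1) ^ (2 * n)"
proof -
  let ?Z = "cls ` zU_monoms (m * r)"
  have "cls ` S (m * r) \<subseteq> cls ` free_alg.span (zU_monoms (m * r))"
  proof safe
    fix f assume "f \<in> S (m * r)"
    then obtain g where "g \<in> free_alg.span (zU_monoms (m * r))" "f \<approx> g"
      by (auto simp: S_def)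
    then show "cls f \<in> cls ` free_alg.span (zU_monoms (m * r))"
      using cls_eq_iff[of f g] by (auto simp: cong_def)
  qed
  then have sub: "power_sum class_ring A V m \<subseteq> cls.span ?Z"
    unfolding cls.span_image using power_sum_subset[OF assms, of m] span_var_words_subset_S[of "m * r"]
    by blast
  have V: "V \<subseteq> carrier A"
    using assms by auto
  have fin: "finite ?Z" "?Z \<subseteq> carrier A"
    using finite_zU_monoms by auto
  note * = cls.subspace_of_finite_span[OF fin power_sum_subspace[OF V] sub]
  show "vectorspace.fin_dim class_ring (A\<lparr>carrier := power_sum class_ring A V m\<rparr>)"
    by (rule *)
  show "vectorspace.dim class_ring (A\<lparr>carrier := power_sum class_ring A V m\<rparr>) \<le> (2 * (m * r) + 1) ^ (2 * n)"
    using *(2) card_image_le[OF finite_zU_monoms, of cls] card_zU_monoms by (meson order_trans)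
qed

lemma x_in_span: "j \<in> {1..n} \<Longrightarrow> x j \<in> free_alg.span (var_words generators 1)"
  unfolding x_def by (intro free_alg.span_base var_in_var_words) (auto simp: generators_def)

lemma y_in_span: "j \<in> {1..n} \<Longrightarrow> y j \<in> free_alg.span (var_words generators 1)"
  unfolding y_def by (intro free_alg.span_base var_in_var_words) (auto simp: generators_def)

lemma z_in_span: "j \<le> n \<Longrightarrow> z j \<in> free_alg.span (var_words generators 2)"
  unfolding z_def
proof (intro free_alg.span_sum free_alg.span_scale)
  fix l assume "j \<le> n" "l \<in> {1..j}"
  then show "y l * x l \<in> free_alg.span (var_words generators 2)"
    using span_var_words_mult[OF y_in_span x_in_span, of l l] by (simp add: numeral_2_eq_2)
qed

text \<open>Each \<open>z i\<close> has degree 2 and each \<open>x i\<close> degree 1 in the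
  generators: \<open>n\<close> pairs with exponents at most \<open>k\<close> make
  \<open>3 * n * k\<close>.\<close>

lemma zx_monom_in_span:
  assumes "\<And>i. i \<in> {1..n} \<Longrightarrow> a i \<le> k" "\<And>i. i \<in> {1..n} \<Longrightarrow> b i \<le> k"
  shows "zx_monom (a, b) \<in> free_alg.span (var_words generators (3 * n * k))"
proof -
  have "z i ^ a i \<in> free_alg.span (var_words generators (2 * k))" if "i \<in> {1..n}" for i
    using power_in_span_var_words[OF z_in_span, of i "a i"] span_var_words_mono[of "a i * 2" "2 * k"]
      that assms(1)[OF that] by auto
  then have "prod_list (map (\<lambda>i. z i ^ a i) [1..<Suc n]) \<in>
      free_alg.span (var_words generators (length (map (\<lambda>i. z i ^ a i) [1..<Suc n]) * (2 * k)))"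
    by (intro prod_list_in_span_var_words) (auto simp del: upt_Suc)
  then have 1: "z_monom a \<in> free_alg.span (var_words generators (n * (2 * k)))"
    by (simp add: z_monom_def del: upt_Suc)
  have "x i ^ b i \<in> free_alg.span (var_words generators k)" if "i \<in> {1..n}" for i
    using power_in_span_var_words[OF x_in_span, of i "b i"] span_var_words_mono[of "b i * 1" k]
      that assms(2)[OF that] by auto
  then have "prod_list (map (\<lambda>j. x j ^ b j) [1..<Suc n]) \<in>
      free_alg.span (var_words generators (length (map (\<lambda>j. x j ^ b j) [1..<Suc n]) * k))"
    by (intro prod_list_in_span_var_words) (auto simp del: upt_Suc)
  then have 2: "prod_list (map (\<lambda>j. x j ^ b j) [1..<Suc n]) \<in> free_alg.span (var_words generators (n * k))"
    by (simp del: upt_Suc)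
  show ?thesis
    using span_var_words_mult[OF 1 2] by (simp add: zx_monom_def algebra_simps)
qed

lemma zx_monom_inj_on:
  assumes "inj_on zx_exp B" shows "inj_on zx_monom B"
proof (rule inj_onI)
  fix u v assume uv: "u \<in> B" "v \<in> B" "zx_monom u = zx_monom v"
  show "u = v"
  proof (rule ccontr)
    assume "u \<noteq> v"
    define \<alpha> where "\<alpha> = (\<lambda>w. if w = u then 1 else - 1 :: 'k)"
    have "(\<Sum>w\<in>{u, v}. scale (\<alpha> w) (zx_monom w)) \<in> N"
      using uv(3) \<open>u \<noteq> v\<close> by (simp add: \<alpha>_def)
    moreover have "inj_on zx_exp {u, v}"
      using uv by (intro inj_on_subset[OF assms]) blast
    ultimately have "\<alpha> u = 0"
      by (intro zx_monoms_independent[of \<alpha> "{u, v}" u]) simp_all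
    then show False
      by (simp add: \<alpha>_def)
  qed
qed

text \<open>The constant is the degree count \<open>3 * n\<close>, plus 1 so that it is positive for
  every \<open>n\<close>, as \<open>growth_exponent_ge\<close> requires.\<close>

lemma power_sum_gen_space_dim:
  assumes "(3 * n + 1) * k \<le> m"
  shows "(k + 1) ^ (2 * n) \<le>
    vectorspace.dim class_ring (A\<lparr>carrier := power_sum class_ring A gen_space m\<rparr>)"
proof -
  let ?B = "({1..n} \<rightarrow>\<^sub>E {..k}) \<times> ({1..n} \<rightarrow>\<^sub>E {..k})"
  have fin: "finite ?B"
    by (intro finite_cartesian_product finite_PiE) auto
  have inj: "inj_on zx_monom ?B"
    by (intro zx_monom_inj_on zx_exp_inj)
  have "cls.indep (zx_monom ` ?B)"
    unfolding cls.indep_def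
  proof (intro allI impI)
    fix \<alpha> assume "cls (\<Sum>b\<in>zx_monom ` ?B. scale (\<alpha> b) b) = \<zero>\<^bsub>A\<^esub>"
    then have *: "(\<Sum>ab\<in>?B. scale (\<alpha> (zx_monom ab)) (zx_monom ab)) \<in> N"
      unfolding cls_eq_zero_iff sum.reindex[OF inj] comp_def .
    show "\<forall>b\<in>zx_monom ` ?B. \<alpha> b = 0"
      using zx_monoms_independent[OF * fin zx_exp_inj] by blast
  qed
  moreover have "3 * n * k \<le> m"
    using assms by simp
  then have "zx_monom ab \<in> free_alg.span (var_words generators m)" if "ab \<in> ?B" for ab
    using that zx_monom_in_span[of "fst ab" k "snd ab"] span_var_words_mono[of "3 * n * k" m generators]
    by (force simp: PiE_iff)
  then have "cls ` zx_monom ` ?B \<subseteq> power_sum class_ring A gen_space m"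
    unfolding power_sum_gen_space by blast
  moreover have "gen_space \<subseteq> carrier A"
    using gen_space_subset by auto
  ultimately have "card (zx_monom ` ?B) \<le>
      vectorspace.dim class_ring (A\<lparr>carrier := power_sum class_ring A gen_space m\<rparr>)"
    using fin power_sum_subspace power_sum_fin_dim(1)[OF gen_space_subset]
    by (intro cls.indep_card_le_dim) auto
  also have "card (zx_monom ` ?B) = (k + 1) ^ (2 * n)"
    unfolding card_image[OF inj] by (simp add: card_cartesian_product card_PiE mult_2 power_add)
  finally show ?thesis .
qed

theorem GK_dim_A: "GK_dim class_ring A = ereal (real (2 * n))"
proof (rule antisym)
  show "GK_dim class_ring A \<le> ereal (real (2 * n))"
    unfolding GK_dim_def
  proof (rule SUP_least)
    fix V assume "V \<in> fin_dim_subspaces class_ring A"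
    then obtain r where r: "V \<subseteq> cls ` free_alg.span (var_words generators r)"
      using fin_dim_subspace_in_var_words by blast
    show "growth_exponent (\<lambda>m. vectorspace.dim class_ring (A\<lparr>carrier := power_sum class_ring A V m\<rparr>))
        \<le> ereal (real (2 * n))"
    proof (rule growth_exponent_le[of "2 * r + 1"])
      fix m :: nat assume "m \<ge> 1"
      then have "(2 * (m * r) + 1) ^ (2 * n) \<le> ((2 * r + 1) * m) ^ (2 * n)"
        by (intro power_mono) (auto simp: algebra_simps)
      then show "vectorspace.dim class_ring (A\<lparr>carrier := power_sum class_ring A V m\<rparr>) \<le>
          ((2 * r + 1) * m) ^ (2 * n)"
        using power_sum_fin_dim(2)[OF r, of m] by linarith
    qed simp
  qed
  have "ereal (real (2 * n)) \<le> growth_exponent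
      (\<lambda>m. vectorspace.dim class_ring (A\<lparr>carrier := power_sum class_ring A gen_space m\<rparr>))"
    by (rule growth_exponent_ge[of "3 * n + 1"]) (use power_sum_gen_space_dim in auto)
  also have "\<dots> \<le> GK_dim class_ring A"
    unfolding GK_dim_def by (intro SUP_upper gen_space_fin_dim finite_generators)
  finally show "ereal (real (2 * n)) \<le> GK_dim class_ring A" .
qed

end

section \<open>Words that do not kill a torsion-free vector\<close>

locale heisenberg_right_ideal = heisenberg +
  fixes J
  assumes J_add': "f \<in> J \<Longrightarrow> g \<in> J \<Longrightarrow> f + g \<in> J"
    and J_mult_right': "f \<in> J \<Longrightarrow> f * h \<in> J"
    and N_subset_J': "N \<subseteq> J"
begin

sublocale alg_right_ideal N J
  by standard (use J_add' J_mult_right' N_subset_J' in auto)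

text \<open>When \<open>J\<close> annihilates a vector \<open>m\<close>, this says that no word in
  \<open>E\<close> kills the moved vector \<open>m f\<close>.\<close>

definition free_on :: "(gen, 'a) free_alg \<Rightarrow> (gen, 'a) free_alg set \<Rightarrow> bool"
  where "free_on f E \<longleftrightarrow> (\<forall>gs. set gs \<subseteq> E \<longrightarrow> f * prod_list gs \<notin> J)"

text \<open>Up to a nonzero scalar all occurrences of \<open>u\<close> can be collected at the
  front, so enlarging \<open>E\<close> by \<open>u\<close> only requires testing words that begin
  with a power of \<open>u\<close> and continue in \<open>E\<close>.\<close>

lemma prod_list_insert_cong:
  assumes "\<And>g. g \<in> E \<Longrightarrow> qcomm u g" "set ls \<subseteq> insert u E"
  shows "\<exists>c b gs. c \<noteq> 0 \<and> set gs \<subseteq> E \<and> prod_list ls \<approx> scale c (u ^ b * prod_list gs)"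
  using assms(2)
proof (induction ls)
  case Nil
  show ?case
    by (intro exI[of _ 1] exI[of _ 0] exI[of _ "[]"]) simp
next
  case (Cons l ls)
  then obtain c b gs where *: "c \<noteq> 0" "set gs \<subseteq> E" "prod_list ls \<approx> scale c (u ^ b * prod_list gs)"
    by auto
  have l: "prod_list (l # ls) \<approx> scale c (l * u ^ b * prod_list gs)"
    using cong_mult_left[OF *(3), of l] by (simp add: scale_mult_right[symmetric] mult.assoc)
  show ?case
  proof (cases "l \<in> E")
    case False
    then have "l = u"
      using Cons.prems by auto
    then show ?thesis
      using l *(1,2) by (intro exI[of _ c] exI[of _ "Suc b"] exI[of _ gs]) simp
  next
    case True
    have "qcomm l (u ^ b)"
      by (rule qcomm_power_right[OF qcomm_sym[OF assms(1)[OF True]]])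
    then obtain d where d: "d \<noteq> 0" "l * u ^ b \<approx> scale d (u ^ b * l)"
      by (auto simp: qcomm_def scomm_def)
    note l
    also have "scale c (l * u ^ b * prod_list gs) \<approx> scale c (scale d (u ^ b * l) * prod_list gs)"
      by (intro cong_scale cong_mult_right d)
    also have "\<dots> = scale (c * d) (u ^ b * prod_list (l # gs))"
      by (simp add: scale_mult_left[symmetric] mult.assoc)
    finally show ?thesis
      using d(1) *(1,2) True by (intro exI[of _ "c * d"] exI[of _ b] exI[of _ "l # gs"]) simp
  qed
qed

lemma free_on_insert:
  assumes "\<And>g. g \<in> E \<Longrightarrow> qcomm u g"
    and "\<And>b gs. set gs \<subseteq> E \<Longrightarrow> f * (u ^ b * prod_list gs) \<notin> J"
  shows "free_on f (insert u E)"
  unfolding free_on_def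
proof (intro allI impI)
  fix ls assume "set ls \<subseteq> insert u E"
  then obtain c b gs where *: "c \<noteq> 0" "set gs \<subseteq> E" "prod_list ls \<approx> scale c (u ^ b * prod_list gs)"
    using prod_list_insert_cong[OF assms(1)] by blast
  have "f * prod_list ls \<approx> scale c (f * (u ^ b * prod_list gs))"
    using cong_mult_left[OF *(3), of f] by (simp add: scale_mult_right)
  then show "f * prod_list ls \<notin> J"
    using J_cong J_scale_iff[OF *(1)] assms(2)[OF *(2)] by blast
qed

text \<open>
  If \<open>x\<^sub>j\<close> kills \<open>f\<close> modulo \<open>J\<close>, then \<open>f z\<^sub>j = q\<^sup>2 f z\<^sub>j\<^sub>-\<^sub>1\<close>, and as \<open>q\<close> is not a root of unity
  no power of \<open>y\<^sub>j\<close> can kill \<open>f\<close>.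
\<close>

lemma y_power_x_power:
  assumes j: "j \<in> {1..n}" and f: "f * x j \<in> J"
  shows "\<exists>r. r \<noteq> 0 \<and> f * (y j ^ c * x j ^ c) - scale r (f * z (j - 1) ^ c) \<in> J"
proof (induction c)
  case 0
  then show ?case
    by (intro exI[of _ 1]) simp
next
  case (Suc c)
  let ?s = "inverse (1 - q\<^sup>2)" and ?z = "z (j - 1)"
  obtain r where r: "r \<noteq> 0" "f * (y j ^ c * x j ^ c) - scale r (f * ?z ^ c) \<in> J"
    using Suc by blast
  have "f * (x j * y j) \<approx> f * scale ?s (z j - scale (q\<^sup>2) ?z)"
    by (intro cong_mult_left x_mult_y j)
  moreover have "f * (x j * y j) \<in> J"
    using J_mult_right[OF f] by (simp add: mult.assoc)
  ultimately have "scale ?s (f * (z j - scale (q\<^sup>2) ?z)) \<in> J"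
    using J_cong by (simp add: scale_mult_right)
  then have fz: "f * (z j - scale (q\<^sup>2) ?z) \<in> J"
    using one_minus_q2 by (subst (asm) J_scale_iff) auto
  have zy: "scomm (q powi 2) ?z (y j)"
    using z_y[of j "j - 1"] j by (auto split: if_splits)
  have "scomm (q powi (2 * int c)) ?z (y j ^ c)"
  proof (induction c)
    case (Suc c)
    have "q powi 2 * q powi (2 * int c) = q powi (2 * int (Suc c))"
      by (simp only: power_int_add[OF disjI1[OF q(1)], symmetric]) (simp add: algebra_simps)
    with scomm_mult_right[OF zy Suc] show ?case
      by (simp only: power_Suc)
  qed (simp add: scomm_def)
  from scomm_sym[OF this] have yz: "y j ^ c * ?z \<approx> scale (q powi (- 2 * int c)) (?z * y j ^ c)"
    using q(1) by (simp add: scomm_def power_int_minus)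
  have "scomm 1 (y j) (z j)"
    using scomm_sym[OF z_y[of j j]] j by simp
  then have "scomm 1 (z j) (y j)"
    using scomm_sym by fastforce
  then have yzj: "y j ^ c * z j \<approx> z j * y j ^ c"
    using scomm_1_power[of "z j" "y j" c] by (simp add: scomm_def cong_sym)
  have "qcomm ?z (y j ^ c * x j ^ c)"
    using j by (intro qcomm_mult_right qcomm_power_right qcomm_z_x qcomm_z_y) auto
  then obtain e where e: "e \<noteq> 0" "?z * (y j ^ c * x j ^ c) \<approx> scale e (y j ^ c * x j ^ c * ?z)"
    by (auto simp: qcomm_def scomm_def)
  \<comment> \<open>Crossing \<open>y j ^ c\<close> gives \<open>z (j - 1)\<close> the factor
    \<open>q powi (- 2 * int c)\<close>, while on \<open>f\<close> the element \<open>z j\<close>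
    acts as \<open>q\<^sup>2\<close> times \<open>z (j - 1)\<close>. The difference \<open>t\<close>
    is nonzero because 2 is never \<open>- 2 * c\<close> for a natural number
    \<open>c\<close>.\<close>
  define t where "t = q\<^sup>2 - q powi (- 2 * int c)"
  have "q powi 2 \<noteq> q powi (- 2 * int c)"
    unfolding power_int_eq_iff_of_no_root[OF q] by linarith
  then have t: "t \<noteq> 0"
    by (simp add: t_def)
  let ?p = "y j ^ c * x j ^ c"
  have "f * (y j ^ Suc c * x j ^ Suc c) = scale ?s (f * (y j ^ c * (z j - ?z) * x j ^ c))"
  proof -
    have "y j ^ Suc c * x j ^ Suc c = y j ^ c * (y j * x j) * x j ^ c"
      unfolding power_Suc2[of "y j"] power_Suc[of "x j"] by (simp add: mult.assoc)
    then show ?thesis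
      using j by (simp add: y_mult_x scale_mult_right[symmetric] scale_mult_left[symmetric])
  qed
  also have "\<dots> \<approx> scale ?s (f * ((z j * y j ^ c - scale (q powi (- 2 * int c)) (?z * y j ^ c)) * x j ^ c))"
    unfolding right_diff_distrib[of "y j ^ c"]
    by (intro cong_scale cong_mult_left cong_mult_right cong_diff yz yzj)
  finally have 1: "f * (y j ^ Suc c * x j ^ Suc c) \<approx>
      scale ?s (f * ((z j * y j ^ c - scale (q powi (- 2 * int c)) (?z * y j ^ c)) * x j ^ c))" .
  have 2: "f * ((z j * y j ^ c - scale (q powi (- 2 * int c)) (?z * y j ^ c)) * x j ^ c) =
      f * (z j - scale (q\<^sup>2) ?z) * ?p + scale t (f * (?z * ?p))"
    by (simp add: t_def left_diff_distrib right_diff_distrib free_alg.scale_left_diff_distrib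
        scale_mult_left[symmetric] scale_mult_right[symmetric] mult.assoc)
  have "f * (?z * ?p) \<approx> f * scale e (?p * ?z)"
    by (intro cong_mult_left e)
  then have 3: "f * (?z * ?p) \<approx> scale e (f * ?p * ?z)"
    by (simp add: scale_mult_right mult.assoc)
  have "f * (y j ^ Suc c * x j ^ Suc c) \<approx>
      scale ?s (f * (z j - scale (q\<^sup>2) ?z) * ?p + scale t (scale e (f * ?p * ?z)))"
    using 1 unfolding 2 by (rule cong_trans) (intro cong_scale cong_add cong_refl 3)
  then have 4: "f * (y j ^ Suc c * x j ^ Suc c) - scale (?s * t * e * r) (f * ?z ^ Suc c) \<approx>
      scale ?s (f * (z j - scale (q\<^sup>2) ?z) * ?p + scale t (scale e (f * ?p * ?z))) -
      scale (?s * t * e * r) (f * ?z ^ Suc c)"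
    by (intro cong_diff cong_refl)
  also have "\<dots> = scale ?s (f * (z j - scale (q\<^sup>2) ?z) * ?p) +
      scale (?s * t * e) ((f * ?p - scale r (f * ?z ^ c)) * ?z)"
    by (simp add: free_alg.scale_right_distrib free_alg.scale_right_diff_distrib left_diff_distrib
        scale_mult_left[symmetric] mult.assoc power_commutes)
  finally have "f * (y j ^ Suc c * x j ^ Suc c) - scale (?s * t * e * r) (f * ?z ^ Suc c) \<approx>
      scale ?s (f * (z j - scale (q\<^sup>2) ?z) * ?p) +
      scale (?s * t * e) ((f * ?p - scale r (f * ?z ^ c)) * ?z)" .
  moreover have "scale ?s (f * (z j - scale (q\<^sup>2) ?z) * ?p) +
      scale (?s * t * e) ((f * ?p - scale r (f * ?z ^ c)) * ?z) \<in> J"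
    by (intro J_add J_scale J_mult_right[OF fz] J_mult_right[OF r(2)])
  ultimately have "f * (y j ^ Suc c * x j ^ Suc c) - scale (?s * t * e * r) (f * ?z ^ Suc c) \<in> J"
    using J_cong by blast
  moreover have "?s * t * e * r \<noteq> 0"
    using one_minus_q2 t e(1) r(1) by simp
  ultimately show ?case
    by blast
qed

text \<open>If no power of \<open>x j\<close> followed by a word in \<open>E\<close> kills
  \<open>f\<close>, then \<open>x j\<close> can be added. Otherwise a least such power exists and is
  positive; one power less, followed by the word, gives \<open>f'\<close>, which \<open>x j\<close>
  kills but no word in \<open>E\<close> does, and then \<open>y j\<close> can be added. That last
  step uses \<open>z (j - 1)\<close> in \<open>E\<close>, hence \<open>j \<ge> 2\<close>.\<close>

lemma free_on_extend:
  assumes f: "free_on f E" and j: "j \<in> {2..n}" and zE: "z (j - 1) \<in> E"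
    and qx: "\<And>g. g \<in> E \<Longrightarrow> qcomm (x j) g" and qy: "\<And>g. g \<in> E \<Longrightarrow> qcomm (y j) g"
  shows "\<exists>f'. free_on f' (insert (x j) E) \<or> free_on f' (insert (y j) E)"
proof (cases "\<exists>b gs. set gs \<subseteq> E \<and> f * (x j ^ b * prod_list gs) \<in> J")
  case False
  then have "free_on f (insert (x j) E)"
    using qx by (intro free_on_insert) auto
  then show ?thesis
    by blast
next
  case True
  define b where "b = (LEAST b. \<exists>gs. set gs \<subseteq> E \<and> f * (x j ^ b * prod_list gs) \<in> J)"
  obtain gs where gs: "set gs \<subseteq> E" "f * (x j ^ b * prod_list gs) \<in> J"
    using LeastI_ex[OF True] unfolding b_def by blast
  have "b \<noteq> 0"
    using f gs by (cases "b = 0") (auto simp: free_on_def)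
  then obtain b' where b': "b = Suc b'"
    by (cases b) auto
  have min: "f * (x j ^ b' * prod_list hs) \<notin> J" if "set hs \<subseteq> E" for hs
    using not_less_Least[of b' "\<lambda>b. \<exists>gs. set gs \<subseteq> E \<and> f * (x j ^ b * prod_list gs) \<in> J"] that b'
    unfolding b_def[symmetric] by auto
  define f' where "f' = f * (x j ^ b' * prod_list gs)"
  have f': "f' * prod_list hs \<notin> J" if "set hs \<subseteq> E" for hs
    using min[of "gs @ hs"] gs(1) that by (simp add: f'_def mult.assoc)
  have "qcomm (prod_list gs) (x j)"
    using gs(1) qx by (intro qcomm_sym[OF qcomm_prod_list]) auto
  then obtain d where d: "prod_list gs * x j \<approx> scale d (x j * prod_list gs)"
    by (auto simp: qcomm_def scomm_def)
  have "f' * x j \<approx> scale d (f * (x j ^ b * prod_list gs))"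
    using cong_mult_left[OF d, of "f * x j ^ b'"]
    by (simp add: f'_def b' scale_mult_right[symmetric] mult.assoc power_commutes)
      (simp add: mult.assoc[symmetric] power_commutes)
  then have f'x: "f' * x j \<in> J"
    using J_cong J_scale[OF gs(2)] by blast
  have "f' * (y j ^ c * prod_list hs) \<notin> J" if hs: "set hs \<subseteq> E" for c hs
  proof
    assume *: "f' * (y j ^ c * prod_list hs) \<in> J"
    obtain r where r: "r \<noteq> 0" "f' * (y j ^ c * x j ^ c) - scale r (f' * z (j - 1) ^ c) \<in> J"
      using y_power_x_power[OF _ f'x, of c] j by auto
    \<comment> \<open>Multiplying by \<open>x j ^ c\<close> on the right and moving it next to
      \<open>y j ^ c\<close> turns the two powers into a nonzero multiple of
      \<open>z (j - 1) ^ c\<close>. This leaves a word in \<open>E\<close>, which cannot kill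
      \<open>f'\<close>.\<close>
    have "qcomm (prod_list hs) (x j ^ c)"
      using hs qx by (intro qcomm_power_right qcomm_sym[OF qcomm_prod_list]) auto
    then obtain e where e: "e \<noteq> 0" "prod_list hs * x j ^ c \<approx> scale e (x j ^ c * prod_list hs)"
      by (auto simp: qcomm_def scomm_def)
    have "f' * (y j ^ c * prod_list hs) * x j ^ c \<approx> scale e (f' * (y j ^ c * x j ^ c) * prod_list hs)"
      using cong_mult_left[OF e(2), of "f' * y j ^ c"] by (simp add: scale_mult_right[symmetric] mult.assoc)
    then have 1: "f' * (y j ^ c * x j ^ c) * prod_list hs \<in> J"
      using J_cong J_mult_right[OF *] J_scale_iff[OF e(1)] by blast
    have "scale r (f' * z (j - 1) ^ c * prod_list hs) \<in> J"
      using J_diff[OF 1 J_mult_right[OF r(2), of "prod_list hs"]]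
      by (simp add: left_diff_distrib scale_mult_left)
    then have "f' * prod_list (replicate c (z (j - 1)) @ hs) \<in> J"
      using J_scale_iff[OF r(1)] by (simp add: prod_list_replicate mult.assoc)
    moreover have "set (replicate c (z (j - 1)) @ hs) \<subseteq> E"
      using hs zE by auto
    ultimately show False
      using f' by blast
  qed
  then have "free_on f' (insert (y j) E)"
    using qy by (intro free_on_insert) auto
  then show ?thesis
    by blast
qed

definition xy_choice :: "(nat \<Rightarrow> bool) \<Rightarrow> nat \<Rightarrow> (gen, 'a) free_alg"
  where "xy_choice \<epsilon> j = (if \<epsilon> j then x j else y j)"

lemma ex_free_on:
  assumes "free_on 1 (z ` {1..n})" "k \<le> n"
  shows "\<exists>f \<epsilon>. free_on f (z ` {1..n} \<union> xy_choice \<epsilon> ` {2..k})"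
  using assms(2)
proof (induction k)
  case 0
  then show ?case
    using assms(1) by (intro exI[of _ 1]) simp
next
  case (Suc k)
  then obtain f \<epsilon> where f: "free_on f (z ` {1..n} \<union> xy_choice \<epsilon> ` {2..k})"
    by auto
  show ?case
  proof (cases "k = 0")
    case True
    then show ?thesis
      using f by (intro exI[of _ f] exI[of _ \<epsilon>]) simp
  next
    case False
    let ?E = "z ` {1..n} \<union> xy_choice \<epsilon> ` {2..k}"
    have "qcomm (x (Suc k)) g" "qcomm (y (Suc k)) g" if "g \<in> ?E" for g
      using that Suc.prems
      by (auto simp: xy_choice_def intro!: qcomm_sym[OF qcomm_z_x] qcomm_sym[OF qcomm_z_y]
          qcomm_x_x qcomm_x_y qcomm_y_x qcomm_y_y)
    then obtain f' where f': "free_on f' (insert (x (Suc k)) ?E) \<or> free_on f' (insert (y (Suc k)) ?E)"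
      using free_on_extend[OF f, of "Suc k"] Suc.prems False by force
    have *: "z ` {1..n} \<union> xy_choice (\<epsilon>(Suc k := b)) ` {2..Suc k} =
        insert (if b then x (Suc k) else y (Suc k)) ?E" for b
    proof -
      have "{2..Suc k} = insert (Suc k) {2..k}"
        using False by auto
      moreover have "xy_choice (\<epsilon>(Suc k := b)) ` {2..k} = xy_choice \<epsilon> ` {2..k}"
        by (intro image_cong) (auto simp: xy_choice_def)
      moreover have "xy_choice (\<epsilon>(Suc k := b)) (Suc k) = (if b then x (Suc k) else y (Suc k))"
        by (simp add: xy_choice_def)
      ultimately show ?thesis
        by (simp only: image_insert Un_insert_right)
    qed
    show ?thesis
      using f'
    proof
      assume "free_on f' (insert (x (Suc k)) ?E)"
      then show ?thesis
        by (intro exI[of _ f'] exI[of _ "\<epsilon>(Suc k := True)"]) (simp only: * if_True)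
    next
      assume "free_on f' (insert (y (Suc k)) ?E)"
      then show ?thesis
        by (intro exI[of _ f'] exI[of _ "\<epsilon>(Suc k := False)"]) (simp only: * if_False)
    qed
  qed
qed

end

section \<open>Application of the Bernstein inequality\<close>

lemma telescoping_zero:
  fixes F :: "nat \<Rightarrow> int"
  assumes "\<And>i. i \<in> {1..<n} \<Longrightarrow> (\<Sum>j\<in>{i<..n}. F j) = 0" "j \<in> {2..n}"
  shows "F j = 0"
proof -
  have "(\<Sum>j\<in>{j - 1<..n}. F j) = 0"
    using assms(2) by (intro assms(1)) auto
  moreover have "{j - 1<..n} = insert j {j<..n}"
    using assms(2) by auto
  moreover have "(\<Sum>j\<in>{j<..n}. F j) = 0"
    using assms(1)[of j] assms(2) by (cases "j = n") auto
  ultimately show ?thesis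
    by simp
qed

lemma telescoping_zero':
  fixes F :: "nat \<Rightarrow> int"
  assumes "\<And>j. j \<in> {2..n} \<Longrightarrow> (\<Sum>i\<in>{1..<j}. F i) = 0" "i \<in> {1..<n}"
  shows "F i = 0"
proof -
  have "(\<Sum>i\<in>{1..<Suc i}. F i) = 0"
    using assms(2) by (intro assms(1)) auto
  moreover have "(\<Sum>i\<in>{1..<i}. F i) = 0"
    using assms(1)[of i] assms(2) by (cases "i = 1") auto
  ultimately show ?thesis
    using assms(2) by simp
qed

section \<open>The chosen family, its nondegenerate form and the resulting dimension bound\<close>

context heisenberg_right_ideal
begin

text \<open>The index \<open>Y i\<close> stands for \<open>z\<^sub>i\<close>, the index \<open>X j\<close> for the chosen one of \<open>x\<^sub>j\<close> and \<open>y\<^sub>j\<close>.\<close>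

definition family_index :: "gen list"
  where "family_index = map Y [1..<n] @ map X [2..<Suc n]"

fun family :: "(nat \<Rightarrow> bool) \<Rightarrow> gen \<Rightarrow> (gen, 'a) free_alg"
  where
    "family \<epsilon> (Y i) = z i"
  | "family \<epsilon> (X j) = xy_choice \<epsilon> j"

definition choice_sign :: "(nat \<Rightarrow> bool) \<Rightarrow> nat \<Rightarrow> int"
  where "choice_sign \<epsilon> j = (if \<epsilon> j then 1 else -1)"

text \<open>Between two chosen elements only the choice at the larger index matters: replacing
  \<open>x j\<close> by \<open>y j\<close> inverts its factors with all \<open>z i\<close> and with
  all choices of smaller index.\<close>

fun family_weight :: "(nat \<Rightarrow> bool) \<Rightarrow> gen \<Rightarrow> gen \<Rightarrow> int"
  where
    "family_weight \<epsilon> (Y i) (Y k) = 0"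
  | "family_weight \<epsilon> (Y i) (X j) = (if i < j then - 2 * choice_sign \<epsilon> j else 0)"
  | "family_weight \<epsilon> (X j) (Y i) = (if i < j then 2 * choice_sign \<epsilon> j else 0)"
  | "family_weight \<epsilon> (X i) (X j) =
      (if i < j then - choice_sign \<epsilon> j else if j < i then choice_sign \<epsilon> i else 0)"

lemma set_family_index: "set family_index = Y ` {1..<n} \<union> X ` {2..n}"
  by (auto simp: family_index_def)

lemma sum_family_index:
  "(\<Sum>l\<in>set family_index. g l) = (\<Sum>i\<in>{1..<n}. g (Y i)) + (\<Sum>j\<in>{2..n}. g (X j :: gen))"
  unfolding set_family_index by (subst sum.union_disjoint) (auto simp: sum.reindex inj_on_def)

lemma scomm_z_choice:
  assumes "i \<le> n" "j \<in> {1..n}"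
  shows "scomm (q powi (if i < j then - 2 * choice_sign \<epsilon> j else 0)) (z i) (xy_choice \<epsilon> j)"
  using z_x[OF assms(2,1)] z_y[OF assms(2,1)] by (auto simp: xy_choice_def choice_sign_def)

lemma scomm_choice_less:
  assumes "1 \<le> i" "i < j" "j \<le> n"
  shows "scomm (q powi (- choice_sign \<epsilon> j)) (xy_choice \<epsilon> i) (xy_choice \<epsilon> j)"
  using xx[OF assms] yy[OF assms] xy[of i j] yx[of i j] assms
  by (auto simp: xy_choice_def choice_sign_def power_int_minus)

lemma scomm_family:
  assumes "k \<in> set family_index" "l \<in> set family_index"
  shows "scomm (q powi family_weight \<epsilon> k l) (family \<epsilon> k) (family \<epsilon> l)"
proof (cases k; cases l)
  fix i j assume "k = Y i" "l = Y j"
  then show ?thesis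
    using zz[of i j] assms by (auto simp: set_family_index)
next
  fix i j assume "k = Y i" "l = X j"
  then show ?thesis
    using scomm_z_choice[of i j \<epsilon>] assms by (auto simp: set_family_index)
next
  fix j i assume "k = X j" "l = Y i"
  then show ?thesis
    using scomm_sym[OF scomm_z_choice[of i j \<epsilon>]] q(1) assms
    by (auto simp: set_family_index power_int_minus split: if_splits)
next
  fix i j assume kl: "k = X i" "l = X j"
  consider "i < j" | "i = j" | "j < i"
    by linarith
  then show ?thesis
  proof cases
    case 1
    then show ?thesis
      using scomm_choice_less[of i j \<epsilon>] assms kl by (auto simp: set_family_index)
  next
    case 2
    then show ?thesis
      using kl by simp
  next
    case 3
    then show ?thesis
      using scomm_sym[OF scomm_choice_less[of j i \<epsilon>]] q(1) assms kl
      by (auto simp: set_family_index power_int_minus)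
  qed
qed

text \<open>The rows of the \<open>z i\<close> contain only tail sums of the signed
  \<open>X\<close>-coordinates, so differences of consecutive rows make each coordinate vanish. The
  rows of the chosen elements then reduce to initial sums of the \<open>Y\<close>-coordinates, and
  the same argument applies.\<close>

lemma family_weight_nondegenerate:
  fixes \<delta> :: "gen \<Rightarrow> int"
  assumes "\<And>k. k \<in> set family_index \<Longrightarrow> (\<Sum>l\<in>set family_index. family_weight \<epsilon> k l * \<delta> l) = 0"
    and "l \<in> set family_index"
  shows "\<delta> l = 0"
proof -
  have sign: "choice_sign \<epsilon> j \<noteq> 0" for j
    by (simp add: choice_sign_def)
  have X0: "\<delta> (X j) = 0" if j: "j \<in> {2..n}" for j
  proof -
    have "choice_sign \<epsilon> j * \<delta> (X j) = 0"
    proof (rule telescoping_zero[where F = "\<lambda>j. choice_sign \<epsilon> j * \<delta> (X j)", OF _ j])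
      fix i assume i: "i \<in> {1..<n}"
      have "0 = (\<Sum>j\<in>{2..n}. family_weight \<epsilon> (Y i) (X j) * \<delta> (X j))"
        using assms(1)[of "Y i"] i by (simp add: sum_family_index) (simp add: set_family_index)
      also have "\<dots> = (\<Sum>j\<in>{i<..n}. - 2 * (choice_sign \<epsilon> j * \<delta> (X j)))"
        using i by (intro sum.mono_neutral_cong_right) auto
      finally show "(\<Sum>j\<in>{i<..n}. choice_sign \<epsilon> j * \<delta> (X j)) = 0"
        by (simp add: sum_negf sum_distrib_left[symmetric])
    qed
    then show ?thesis
      using sign by simp
  qed
  have Y0: "\<delta> (Y i) = 0" if i: "i \<in> {1..<n}" for i
  proof (rule telescoping_zero'[OF _ i])
    fix j assume j: "j \<in> {2..n}"
    have "0 = (\<Sum>i\<in>{1..<n}. family_weight \<epsilon> (X j) (Y i) * \<delta> (Y i))"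
      using assms(1)[of "X j"] j X0 by (simp add: sum_family_index) (simp add: set_family_index)
    also have "\<dots> = (\<Sum>i\<in>{1..<j}. 2 * choice_sign \<epsilon> j * \<delta> (Y i))"
      using j by (intro sum.mono_neutral_cong_right) auto
    finally show "(\<Sum>i\<in>{1..<j}. \<delta> (Y i)) = 0"
      using sign by (simp add: sum_distrib_left[symmetric])
  qed
  show ?thesis
    using assms(2) X0 Y0 by (auto simp: set_family_index)
qed

lemma family_in_span:
  "k \<in> set family_index \<Longrightarrow> family \<epsilon> k \<in> free_alg.span (var_words generators 2)"
  using z_in_span x_in_span y_in_span span_var_words_mono[of 1 2 generators]
  by (fastforce simp: set_family_index xy_choice_def)

lemma free_on_dim_bound:
  assumes free: "free_on f (z ` {1..n} \<union> xy_choice \<epsilon> ` {2..n})"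
  obtains \<kappa> where "\<kappa> > 0" "\<And>k m D. \<kappa> * k \<le> m \<Longrightarrow>
    (\<And>B. finite B \<Longrightarrow> B \<subseteq> free_alg.span (var_words generators m) \<Longrightarrow>
      (\<forall>\<alpha>. f * (\<Sum>b\<in>B. scale (\<alpha> b) b) \<in> J \<longrightarrow> (\<forall>b\<in>B. \<alpha> b = 0)) \<Longrightarrow> card B \<le> D) \<Longrightarrow>
    (k + 1) ^ (n - 1) \<le> D"
proof -
  \<comment> \<open>If \<open>J\<close> annihilates a vector, this right ideal annihilates that
    vector moved by \<open>f\<close>.\<close>
  let ?J = "{g. f * g \<in> J}"
  interpret F: q_commuting_family N ?J q family_index "family \<epsilon>" "family_weight \<epsilon>"
  proof
    show "g + h \<in> ?J" if "g \<in> ?J" "h \<in> ?J" for g h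
      using that J_add by (simp add: distrib_left)
    show "g * h \<in> ?J" if "g \<in> ?J" for g h
      using that J_mult_right by (simp add: mult.assoc[symmetric])
    show "N \<subseteq> ?J"
      using N_mult_left N_subset_J by auto
    show "distinct family_index"
      by (auto simp: family_index_def distinct_map inj_on_def)
    show "prod_list (map (family \<epsilon>) xs) \<notin> ?J" if "set xs \<subseteq> set family_index" for xs
    proof -
      have "set (map (family \<epsilon>) xs) \<subseteq> z ` {1..n} \<union> xy_choice \<epsilon> ` {2..n}"
        using that by (fastforce simp: set_family_index)
      then show ?thesis
        using free unfolding free_on_def by blast
    qed
    show "scomm (q powi family_weight \<epsilon> k l) (family \<epsilon> k) (family \<epsilon> l)"
      if "k \<in> set family_index" "l \<in> set family_index" for k l
      using that by (rule scomm_family)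
    show "\<delta> l = 0" if "\<And>k. k \<in> set family_index \<Longrightarrow>
        (\<Sum>l\<in>set family_index. family_weight \<epsilon> k l * \<delta> l) = 0" "l \<in> set family_index" for \<delta> l
      using that by (rule family_weight_nondegenerate)
  qed (rule q)+
  have len: "length family_index = 2 * (n - 1)"
    by (simp add: family_index_def del: upt_Suc)
  have words: "F.words r \<subseteq> free_alg.span (var_words generators (2 * r))" for r
  proof
    fix w assume "w \<in> F.words r"
    then obtain xs where xs: "w = prod_list (map (family \<epsilon>) xs)" "set xs \<subseteq> set family_index" "length xs \<le> r"
      by (auto simp: F.words_def)
    have "prod_list (map (family \<epsilon>) xs) \<in>
        free_alg.span (var_words generators (length (map (family \<epsilon>) xs) * 2))"
      using xs(2) family_in_span by (intro prod_list_in_span_var_words) auto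
    then show "w \<in> free_alg.span (var_words generators (2 * r))"
      using xs(1,3) span_var_words_mono[of "length xs * 2" "2 * r" generators] by auto
  qed
  let ?L = "length family_index"
  \<comment> \<open>For \<open>k \<ge> 1\<close>, the word length \<open>F.radius k + ?L * k\<close>
    is at most \<open>k\<close> times the bracket. The factor 2 is the maximal degree of a family
    member in the generators, and the final 1 makes the constant positive.\<close>
  define \<kappa> where "\<kappa> = 2 * (?L * (2 * F.weight_bound + 1) + ?L) + 1"
  show thesis
  proof (rule that[of \<kappa>])
    show "\<kappa> > 0"
      by (simp add: \<kappa>_def)
    fix k m D
    assume km: "\<kappa> * k \<le> m" and D: "\<And>B. finite B \<Longrightarrow> B \<subseteq> free_alg.span (var_words generators m) \<Longrightarrow>
      (\<forall>\<alpha>. f * (\<Sum>b\<in>B. scale (\<alpha> b) b) \<in> J \<longrightarrow> (\<forall>b\<in>B. \<alpha> b = 0)) \<Longrightarrow> card B \<le> D"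
    show "(k + 1) ^ (n - 1) \<le> D"
    \<comment> \<open>For \<open>k = 0\<close> the radius is the length of the family and need not
      be 0, so no multiple of \<open>k\<close> bounds it. The single independent element 1 gives
      \<open>1 \<le> D\<close> directly.\<close>
    proof (cases "k = 0")
      case True
      have "1 \<notin> ?J"
        using F.words_notin_J[of "[]"] by simp
      then have "c = 0" if "scale c f \<in> J" for c
        using that J_scale_iff[of c f] by auto
      then have "card {1 :: (gen, 'a) free_alg} \<le> D"
        by (intro D) (auto simp: one_in_var_words free_alg.span_base scale_mult_right[symmetric])
      then show ?thesis
        using True by simp
    next
      case False
      have "2 * (F.radius k + ?L * k) \<le> \<kappa> * k"
        using False by (cases k) (simp_all add: F.radius_def \<kappa>_def algebra_simps)
      then have sub: "F.words (F.radius k + ?L * k) \<subseteq> free_alg.span (var_words generators m)"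
        using words[of "F.radius k + ?L * k"] span_var_words_mono[of _ m generators] km
        by (meson order_trans)
      have "(k + 1) ^ ?L \<le> D * D"
      proof (rule F.Bernstein_inequality)
        fix B assume "B \<subseteq> F.words (F.radius k + ?L * k)" "F.indep_mod B"
        then show "card B \<le> D"
          using sub F.finite_words by (intro D) (auto intro: finite_subset simp: F.indep_mod_def)
      qed
      then have "((k + 1) ^ (n - 1))\<^sup>2 \<le> D\<^sup>2"
        by (simp add: len power_mult[symmetric] power2_eq_square mult.commute[of 2] power_mult)
      then show ?thesis
        using power2_le_imp_le by blast
    qed
  qed
qed

end

section \<open>Growth of cyclic submodules of right modules\<close>

context presented_algebra
begin

lemma smult_one: "c \<odot>\<^bsub>A\<^esub> \<one>\<^bsub>A\<^esub> = cls (scale c 1)"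
  by (simp add: one_A)

lemma underlying_space_simps [simp]:
  "carrier (underlying_space A M) = carrier M" "zero (underlying_space A M) = \<zero>\<^bsub>M\<^esub>"
  "add (underlying_space A M) = add M"
  "c \<odot>\<^bsub>underlying_space A M\<^esub> m = m \<triangleleft>\<^bsub>M\<^esub> cls (scale c 1)"
  by (simp_all add: underlying_space_def smult_one)

lemma vectorspace_underlying_space:
  assumes "right_module A M"
  shows "vectorspace class_ring (underlying_space A M)"
proof -
  interpret R: right_module A M
    by (rule assms)
  show ?thesis
  proof (rule vs_criteria)
    show "field (class_ring :: 'k ring)"
      by (rule class_field.field_axioms)
    show "\<forall>v\<in>carrier (underlying_space A M). \<exists>w\<in>carrier (underlying_space A M).
        v \<oplus>\<^bsub>underlying_space A M\<^esub> w = \<zero>\<^bsub>underlying_space A M\<^esub>"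
      using R.M.add.r_inv_ex by simp
    show "\<forall>a b v. a \<in> carrier class_ring \<and> b \<in> carrier class_ring \<and> v \<in> carrier (underlying_space A M) \<longrightarrow>
        (a \<otimes>\<^bsub>class_ring\<^esub> b) \<odot>\<^bsub>underlying_space A M\<^esub> v =
        a \<odot>\<^bsub>underlying_space A M\<^esub> (b \<odot>\<^bsub>underlying_space A M\<^esub> v)"
      by (simp add: R.ract_mult[symmetric] scale_mult_left[symmetric] mult.commute)
    show "\<forall>a b v. a \<in> carrier class_ring \<and> b \<in> carrier class_ring \<and> v \<in> carrier (underlying_space A M) \<longrightarrow>
        (a \<oplus>\<^bsub>class_ring\<^esub> b) \<odot>\<^bsub>underlying_space A M\<^esub> v =
        a \<odot>\<^bsub>underlying_space A M\<^esub> v \<oplus>\<^bsub>underlying_space A M\<^esub> b \<odot>\<^bsub>underlying_space A M\<^esub> v"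
      by (simp add: R.ract_add_right[symmetric] free_alg.scale_left_distrib)
  qed (auto simp: R.ract_closed R.ract_add_left R.ract_one[unfolded one_A] R.M.add.m_ac)
qed

lemma free_alg_map_right_module:
  assumes "right_module A M" "v \<in> carrier M"
  shows "free_alg_map (underlying_space A M) (\<lambda>f. v \<triangleleft>\<^bsub>M\<^esub> cls f)"
proof -
  interpret R: right_module A M
    by (rule assms)
  show ?thesis
  proof (intro free_alg_map.intro vectorspace_underlying_space free_alg_map_axioms.intro)
    show "v \<triangleleft>\<^bsub>M\<^esub> cls (f + g) =
        v \<triangleleft>\<^bsub>M\<^esub> cls f \<oplus>\<^bsub>underlying_space A M\<^esub> v \<triangleleft>\<^bsub>M\<^esub> cls g" for f g
      using R.ract_add_right[OF assms(2), of "cls f" "cls g"] by simp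
    show "v \<triangleleft>\<^bsub>M\<^esub> cls (scale c f) = c \<odot>\<^bsub>underlying_space A M\<^esub> (v \<triangleleft>\<^bsub>M\<^esub> cls f)" for c f
      using R.ract_mult[OF assms(2), of "cls f" "cls (scale c 1)"] by (simp add: scale_mult_right[symmetric])
  qed (use assms in \<open>auto simp: R.ract_closed\<close>)
qed

text \<open>The generating space of the algebra and the line spanned by \<open>v\<close> form one
  term of the supremum. Quantifying \<open>bound\<close> over \<open>D\<close> keeps it a statement
  about independent sets in the free algebra; the dimension itself is then substituted for
  \<open>D\<close>.\<close>

lemma GK_dim_module_ge:
  assumes M: "right_module A M" and G: "finite G" and v: "v \<in> carrier M" and \<kappa>: "\<kappa> > 0"
    and bound: "\<And>k m D. \<kappa> * k \<le> m \<Longrightarrow>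
      (\<And>B. finite B \<Longrightarrow> B \<subseteq> free_alg.span (var_words G m) \<Longrightarrow>
        (\<forall>\<alpha>. v \<triangleleft>\<^bsub>M\<^esub> cls (\<Sum>b\<in>B. scale (\<alpha> b) b) = \<zero>\<^bsub>M\<^esub> \<longrightarrow> (\<forall>b\<in>B. \<alpha> b = 0)) \<Longrightarrow>
        card B \<le> D) \<Longrightarrow>
      (k + 1) ^ e \<le> D"
  shows "ereal (real e) \<le> GK_dim_module class_ring A M"
proof -
  let ?\<Phi> = "\<lambda>f. v \<triangleleft>\<^bsub>M\<^esub> cls f" and ?N = "underlying_space A M"
  interpret R: right_module A M
    by (rule M)
  interpret \<Phi>: free_alg_map ?N ?\<Phi>
    by (rule free_alg_map_right_module[OF M v])
  define F where "F = ?\<Phi> ` free_alg.span {1}"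
  define W where "W m = ?\<Phi> ` free_alg.span (var_words G m)" for m
  have sub: "VectorSpace.subspace class_ring (?\<Phi> ` free_alg.span E) ?N" for E
    unfolding \<Phi>.span_image[symmetric] by (rule \<Phi>.span_is_subspace) (auto simp: R.ract_closed v)
  have fin: "vectorspace.fin_dim class_ring (?N\<lparr>carrier := ?\<Phi> ` free_alg.span E\<rparr>)" if "finite E" for E
  proof (rule \<Phi>.subspace_of_finite_span(1)[of "?\<Phi> ` E"])
    show "?\<Phi> ` free_alg.span E \<subseteq> \<Phi>.span (?\<Phi> ` E)"
      unfolding \<Phi>.span_image ..
  qed (use that sub in \<open>auto simp: R.ract_closed v\<close>)
  have F: "F \<in> fin_dim_subspaces class_ring ?N"
    unfolding fin_dim_subspaces_def F_def using sub fin[of "{1}"] by blast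
  have W: "{f \<triangleleft>\<^bsub>M\<^esub> a | f a. f \<in> F \<and> a \<in> power_sum class_ring A gen_space m} = W m" for m
  proof
    show "{f \<triangleleft>\<^bsub>M\<^esub> a | f a. f \<in> F \<and> a \<in> power_sum class_ring A gen_space m} \<subseteq> W m"
    proof safe
      fix f a assume "f \<in> F" "a \<in> power_sum class_ring A gen_space m"
      then obtain g h where g: "f = v \<triangleleft>\<^bsub>M\<^esub> cls g" "g \<in> free_alg.span {1}"
        and h: "a = cls h" "h \<in> free_alg.span (var_words G m)"
        unfolding F_def power_sum_gen_space by blast
      have "{1} \<subseteq> var_words G 0"
        using one_in_var_words by blast
      then have "g \<in> free_alg.span (var_words G 0)"
        using g(2) free_alg.span_mono by blast
      then have "g * h \<in> free_alg.span (var_words G m)"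
        using span_var_words_mult[OF _ h(2), of g 0] by simp
      moreover have "f \<triangleleft>\<^bsub>M\<^esub> a = v \<triangleleft>\<^bsub>M\<^esub> cls (g * h)"
        using R.ract_mult[OF v, of "cls g" "cls h"] by (simp add: g h)
      ultimately show "f \<triangleleft>\<^bsub>M\<^esub> a \<in> W m"
        unfolding W_def by blast
    qed
    show "W m \<subseteq> {f \<triangleleft>\<^bsub>M\<^esub> a | f a. f \<in> F \<and> a \<in> power_sum class_ring A gen_space m}"
    proof
      fix w assume "w \<in> W m"
      then obtain h where h: "w = v \<triangleleft>\<^bsub>M\<^esub> cls h" "h \<in> free_alg.span (var_words G m)"
        unfolding W_def by blast
      have "v = v \<triangleleft>\<^bsub>M\<^esub> cls 1"
        using R.ract_one[OF v] by (simp add: one_A)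
      then have "v \<in> F"
        unfolding F_def using free_alg.span_base[of 1 "{1}"] by blast
      moreover have "cls h \<in> power_sum class_ring A gen_space m"
        unfolding power_sum_gen_space using h(2) by blast
      ultimately show "w \<in> {f \<triangleleft>\<^bsub>M\<^esub> a | f a. f \<in> F \<and> a \<in> power_sum class_ring A gen_space m}"
        using h(1) by blast
    qed
  qed
  have span_W: "\<Phi>.span (W m) = W m" for m
    unfolding W_def \<Phi>.span_image free_alg.span_span ..
  have "ereal (real e) \<le> growth_exponent (\<lambda>m. vectorspace.dim class_ring (?N\<lparr>carrier := W m\<rparr>))"
  proof (rule growth_exponent_ge[OF \<kappa>])
    fix k m assume km: "\<kappa> * k \<le> m"
    show "(k + 1) ^ e \<le> vectorspace.dim class_ring (?N\<lparr>carrier := W m\<rparr>)"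
    proof (rule bound[OF km])
      fix B assume B: "finite B" "B \<subseteq> free_alg.span (var_words G m)"
        "\<forall>\<alpha>. v \<triangleleft>\<^bsub>M\<^esub> cls (\<Sum>b\<in>B. scale (\<alpha> b) b) = \<zero>\<^bsub>M\<^esub> \<longrightarrow> (\<forall>b\<in>B. \<alpha> b = 0)"
      have "\<Phi>.indep B"
        using B(3) by (simp add: \<Phi>.indep_def)
      moreover have "?\<Phi> ` B \<subseteq> W m"
        unfolding W_def using B(2) by (rule image_mono)
      ultimately show "card B \<le> vectorspace.dim class_ring (?N\<lparr>carrier := W m\<rparr>)"
        using B(1) sub fin[OF finite_var_words[OF G]] unfolding W_def
        by (intro \<Phi>.indep_card_le_dim) auto
    qed
  qed
  also have "\<dots> \<le> GK_dim_module class_ring A M"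
    unfolding GK_dim_module_def Let_def
    by (rule SUP_upper2[of "(gen_space, F)"]) (simp_all add: F gen_space_fin_dim[OF G] W span_W)
  finally show ?thesis .
qed

end

section \<open>From a vector without torsion to the dimension bounds\<close>

context heisenberg
begin

lemma Kn_eq_A: "Kn n (\<lambda>_. q\<^sup>2) (\<lambda>_. 1) (heisenberg_gamma q) = A"
  unfolding A_eq quantum_heisenberg_def ..

lemma Kn_gen_eq:
  assumes "g \<in> generators"
  shows "Kn_gen n (\<lambda>_. q\<^sup>2) (\<lambda>_. 1) (heisenberg_gamma q) g = cls (var g)"
  using assms unfolding Kn_gen_def cls_def generators_def[symmetric] relation_ideal_def[symmetric]
  by (simp add: proj_alg_var)

lemma Kn_z_eq:
  assumes "i \<le> n"
  shows "Kn_z n (\<lambda>_. q\<^sup>2) (\<lambda>_. 1) (heisenberg_gamma q) i = cls (z i)"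
proof -
  have "(1 - q\<^sup>2) \<odot>\<^bsub>A\<^esub> (Kn_gen n (\<lambda>_. q\<^sup>2) (\<lambda>_. 1) (heisenberg_gamma q) (Y l) \<otimes>\<^bsub>A\<^esub>
      Kn_gen n (\<lambda>_. q\<^sup>2) (\<lambda>_. 1) (heisenberg_gamma q) (X l)) = cls (scale (1 - q\<^sup>2) (y l * x l))"
    if "l \<in> {1..i}" for l
  proof -
    have "X l \<in> generators" "Y l \<in> generators"
      using that assms by (auto simp: generators_def)
    then show ?thesis
      by (simp add: Kn_gen_eq x_def y_def)
  qed
  then have "Kn_z n (\<lambda>_. q\<^sup>2) (\<lambda>_. 1) (heisenberg_gamma q) i =
      (\<Oplus>\<^bsub>A\<^esub>l\<in>{1..i}. cls (scale (1 - q\<^sup>2) (y l * x l)))"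
    unfolding Kn_z_def Kn_eq_A by (intro cls.M.finsum_cong') auto
  then show ?thesis
    unfolding z_def by (simp only: cls.map_sum finite_atLeastAtMost)
qed

lemma cls_power: "cls f [^]\<^bsub>A\<^esub> (m :: nat) = cls (f ^ m)"
  by (induction m) (simp_all add: one_A power_commutes)

lemma z_monom_in_Z: "cls (z_monom a) \<in> heisenberg_Z n q"
proof -
  have "foldr (\<lambda>i b. (Kn_z n (\<lambda>_. q\<^sup>2) (\<lambda>_. 1) (heisenberg_gamma q) i [^]\<^bsub>A\<^esub> a i) \<otimes>\<^bsub>A\<^esub> b) ls \<one>\<^bsub>A\<^esub> =
      cls (prod_list (map (\<lambda>i. z i ^ a i) ls))" if "set ls \<subseteq> {..n}" for ls
    using that by (induction ls) (simp_all add: one_A Kn_z_eq cls_power)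
  moreover have "set [1..<Suc n] \<subseteq> {..n}"
    by auto
  ultimately have "foldr (\<lambda>i b. (Kn_z n (\<lambda>_. q\<^sup>2) (\<lambda>_. 1) (heisenberg_gamma q) i [^]\<^bsub>A\<^esub> a i) \<otimes>\<^bsub>A\<^esub> b)
      [1..<Suc n] \<one>\<^bsub>A\<^esub> = cls (z_monom a)"
    unfolding z_monom_def by blast
  then show ?thesis
    unfolding heisenberg_Z_def Kn_Z_def Kn_eq_A by (intro CollectI exI[of _ a]) simp
qed

text \<open>The \<open>z i\<close> commute modulo \<open>N\<close>, so the ordered products in
  \<open>heisenberg_Z\<close> represent all words in the \<open>z i\<close>.\<close>

lemma prod_list_z_cong:
  assumes "set gs \<subseteq> z ` {1..n}" shows "\<exists>a. prod_list gs \<approx> z_monom a"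
  using assms
proof (induction gs)
  case Nil
  have "z_monom (\<lambda>_. 0) = 1"
    by (simp add: z_monom_def map_replicate_const prod_list_replicate del: upt_Suc)
  then show ?case
    by (intro exI[of _ "\<lambda>_. 0"]) simp
next
  case (Cons g gs)
  then obtain a m where a: "prod_list gs \<approx> z_monom a" "g = z m" "m \<in> {1..n}"
    by auto
  have "prod_list (g # gs) \<approx> z m * z_monom a"
    using cong_mult_left[OF a(1), of "z m"] a(2) by simp
  also have "\<dots> \<approx> z_monom (a(m := Suc (a m)))"
    by (rule z_mult_z_monom[OF a(3)])
  finally show ?case
    by blast
qed

theorem GK_dim_module_ge_of_not_torsion:
  assumes M: "right_module A M" and "\<not> torsion_right_module (heisenberg_Z n q) M"
  shows "ereal (real (n - 1)) \<le> GK_dim_module class_ring A M"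
proof -
  interpret R: right_module A M
    by (rule M)
  \<comment> \<open>Failure of torsion supplies one vector that no element of
    \<open>heisenberg_Z\<close> kills; its annihilator is the right ideal \<open>J\<close>
    below.\<close>
  obtain m0 where m0: "m0 \<in> carrier M" "\<And>s. s \<in> heisenberg_Z n q \<Longrightarrow> m0 \<triangleleft>\<^bsub>M\<^esub> s \<noteq> \<zero>\<^bsub>M\<^esub>"
    using assms(2) unfolding torsion_right_module_def by blast
  interpret \<Phi>: free_alg_map "underlying_space A M" "\<lambda>f. m0 \<triangleleft>\<^bsub>M\<^esub> cls f"
    by (rule free_alg_map_right_module[OF M m0(1)])
  define J where "J = {f. m0 \<triangleleft>\<^bsub>M\<^esub> cls f = \<zero>\<^bsub>M\<^esub>}"
  have mult: "m0 \<triangleleft>\<^bsub>M\<^esub> cls (f * h) = (m0 \<triangleleft>\<^bsub>M\<^esub> cls f) \<triangleleft>\<^bsub>M\<^esub> cls h" for f h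
    using R.ract_mult[OF m0(1), of "cls f" "cls h"] by simp
  have zero_act: "\<zero>\<^bsub>M\<^esub> \<triangleleft>\<^bsub>M\<^esub> cls h = \<zero>\<^bsub>M\<^esub>" for h
    using R.ract_add_left[of "\<zero>\<^bsub>M\<^esub>" "\<zero>\<^bsub>M\<^esub>" "cls h"] R.ract_closed[of "\<zero>\<^bsub>M\<^esub>" "cls h"]
    by (simp add: R.M.add.l_cancel_one')
  interpret J: heisenberg_right_ideal n q J
  proof
    show "f + g \<in> J" if "f \<in> J" "g \<in> J" for f g
      using that \<Phi>.map_add[of f g] by (simp add: J_def)
    show "f * h \<in> J" if "f \<in> J" for f h
      using that by (simp add: J_def mult zero_act)
    show "N \<subseteq> J"
    proof
      fix f assume "f \<in> N"
      then have "cls f = cls 0"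
        by (simp add: cls_eq_iff)
      then show "f \<in> J"
        using \<Phi>.map_zero by (simp add: J_def)
    qed
  qed
  have "J.free_on 1 (z ` {1..n})"
    unfolding J.free_on_def
  proof (intro allI impI)
    fix gs assume "set gs \<subseteq> z ` {1..n}"
    then obtain a where "prod_list gs \<approx> z_monom a"
      using prod_list_z_cong by blast
    moreover have "z_monom a \<notin> J"
      using m0(2)[OF z_monom_in_Z] by (simp add: J_def)
    ultimately show "1 * prod_list gs \<notin> J"
      using J.J_cong by simp
  qed
  then obtain f \<epsilon> where f: "J.free_on f (z ` {1..n} \<union> J.xy_choice \<epsilon> ` {2..n})"
    using J.ex_free_on[of n] by auto
  show ?thesis
  proof (rule J.free_on_dim_bound[OF f])
    fix \<kappa> :: nat
    assume \<kappa>: "\<kappa> > 0" and bound: "\<And>k m D. \<kappa> * k \<le> m \<Longrightarrow>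
      (\<And>B. finite B \<Longrightarrow> B \<subseteq> free_alg.span (var_words generators m) \<Longrightarrow>
        (\<forall>\<alpha>. f * (\<Sum>b\<in>B. scale (\<alpha> b) b) \<in> J \<longrightarrow> (\<forall>b\<in>B. \<alpha> b = 0)) \<Longrightarrow> card B \<le> D) \<Longrightarrow>
      (k + 1) ^ (n - 1) \<le> D"
    show ?thesis
    \<comment> \<open>Growth is measured from \<open>m0\<close> moved by \<open>f\<close>, whose
      annihilator consists of the \<open>g\<close> with \<open>f * g \<in> J\<close>.\<close>
    proof (rule GK_dim_module_ge[OF M finite_generators _ \<kappa>])
      show "m0 \<triangleleft>\<^bsub>M\<^esub> cls f \<in> carrier M"
        by (simp add: R.ract_closed m0(1))
      fix k m D :: nat
      assume km: "\<kappa> * k \<le> m" and D: "\<And>B. finite B \<Longrightarrow> B \<subseteq> free_alg.span (var_words generators m) \<Longrightarrow>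
        (\<forall>\<alpha>. (m0 \<triangleleft>\<^bsub>M\<^esub> cls f) \<triangleleft>\<^bsub>M\<^esub> cls (\<Sum>b\<in>B. scale (\<alpha> b) b) = \<zero>\<^bsub>M\<^esub> \<longrightarrow>
          (\<forall>b\<in>B. \<alpha> b = 0)) \<Longrightarrow> card B \<le> D"
      show "(k + 1) ^ (n - 1) \<le> D"
      proof (rule bound[OF km])
        fix B assume "finite B" "B \<subseteq> free_alg.span (var_words generators m)"
          "\<forall>\<alpha>. f * (\<Sum>b\<in>B. scale (\<alpha> b) b) \<in> J \<longrightarrow> (\<forall>b\<in>B. \<alpha> b = 0)"
        then show "card B \<le> D"
          unfolding J_def mem_Collect_eq mult by (rule D)
      qed
    qed
  qed
qed

end

theorem corollary1p4:
  fixes q :: "'k::field" and n :: nat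
    and M :: "((gen, 'k) free_alg set, 'm) right_module"
  assumes "n \<ge> 1"
    and "q \<noteq> 0"
    and "\<forall>k::nat. k > 0 \<longrightarrow> q ^ k \<noteq> 1"
    and "right_module (quantum_heisenberg n q) M"
    and "fin_gen_right_module (quantum_heisenberg n q) M"
    and "carrier M \<noteq> {\<zero>\<^bsub>M\<^esub>}"
    and "\<not> torsion_right_module (heisenberg_Z n q) M"
  shows "GK_dim_module class_ring (quantum_heisenberg n q) M \<ge> ereal (real n - 1)
       \<and> ereal (real n - 1) = GK_dim class_ring (quantum_heisenberg n q) / 2 - 1"
proof -
  interpret heisenberg n q
    using assms(2,3) by unfold_locales
  \<comment> \<open>Here \<open>n \<ge> 1\<close> makes the truncated subtraction in the exponent
    agree with the real one.\<close>
  have eq: "real n - 1 = real (n - 1)"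
    using assms(1) by (simp add: of_nat_diff)
  have "ereal (real n - 1) \<le> GK_dim_module class_ring (quantum_heisenberg n q) M"
    unfolding eq by (rule GK_dim_module_ge_of_not_torsion[of M, unfolded A_eq, OF assms(4,7)])
  moreover have "ereal (real n - 1) = GK_dim class_ring (quantum_heisenberg n q) / 2 - 1"
    unfolding GK_dim_A[unfolded A_eq] numeral_eq_ereal one_ereal_def by simp
  ultimately show ?thesis
    by (rule conjI)
qed

end
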